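(* Let $k,d$ be positive integers with $k\geq 3$. Let $\mathbf n=(n,\dots,n)$ ($k$ entries). Then, asymptotically almost surely (as $n\to\infty$), the variety $\overline{\pi_{G(n,M_{d+1})}(\mathrm{im}\,\sigma_{\mathbf n})}$ is $d$-tangentially weakly non-defective over $\mathbb{C}$.
   Context: A $k$-graph is a $k$-uniform hypergraph. $K_n^k$ is the complete $k$-partite $k$-graph with vertex classes $V_1,\dots,V_k$, each of size $n$; its edges are all sets meeting each $V_i$ in exactly one vertex, and $N=kn$. Random graphs: order the $n^k$ edges of $K_n^k$ uniformly at random and let $G(n,m)$ be the subgraph of $K_n^k$ on the full vertex set formed by the first $m$ edges. $M_s=\min\{m:\text{the minimum degree of }G(n,m)\text{ is at least }s\}$, where the degree of a vertex is the number of edges containing it; $G(n,M_s)$ is the graph of this process at the random time $M_s$. A property holds asymptotically almost surely if its probability tends to $1$ as $n\to\infty$. Varieties: $\sigma_{\mathbf n}:\mathbb{C}^{N}\to\mathbb{C}^{E(K_n^k)}$ is the Segre map $\sigma_{\mathbf n}(\mathbf x)=(\prod_{v\in e}x_v)_{e\in E(K_n^k)}$. For $G\subseteq K_n^k$, $\pi_G:\mathbb{C}^{E(K_n^k)}\to\mathbb{C}^{E(G)}$ is the coordinate projection onto the coordinates indexed by $E(G)$. The bar denotes Zariski closure; $\overline{\pi_G(\mathrm{im}\,\sigma_{\mathbf n})}$ is an irreducible affine cone. For an irreducible affine cone $\mathcal V\subseteq\mathbb{C}^m$ and generic points $x_1,\dots,x_d\in\mathcal V$, the $d$-tangent contact locus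 is $C_{x_1,\dots,x_d}\mathcal V=\overline{\{y\in\mathcal V: T_y\mathcal V\subset\langle T_{x_1}\mathcal V,\dots,T_{x_d}\mathcal V\rangle\}}$, where $T_y\mathcal V$ is the tangent space (a linear subspace of $\mathbb{C}^m$) and $\langle\cdot\rangle$ is linear span. $\mathcal V$ is $d$-tangentially weakly defective if, for generic $x_1,\dots,x_d$, for some $i$ an irreducible component of $C_{x_1,\dots,x_d}\mathcal V$ containing $x_i$ has dimension at least two; otherwise it is $d$-tangentially weakly non-defective. *)

theory Defs
  imports
    "HOL-Analysis.Analysis"
    "HOL-Probability.Random_Permutations"
    "HOL-Library.Function_Algebras"
    "HOL-Library.Extended_Nat"
begin

section \<open>Affine spaces and the Zariski topology\<close>

text \<open>
  The space of complex vectors with coordinates indexed by a set \<open>E\<close>. Vectors are total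
  functions that vanish outside \<open>E\<close>, so that \<open>E\<close> may vary while the type is fixed.
\<close>

definition coord_space :: "'i set \<Rightarrow> ('i \<Rightarrow> complex) set" where
  "coord_space E = {x. \<forall>i. i \<notin> E \<longrightarrow> x i = 0}"

text \<open>
  Polynomials in the variables indexed by \<open>E\<close>, as functions (compare
  \<^const>\<open>real_polynomial_function\<close>); since the field is infinite, nothing is lost by this.
\<close>

inductive_set poly_functions :: "'i set \<Rightarrow> (('i \<Rightarrow> complex) \<Rightarrow> complex) set"
  for E :: "'i set" where
  const: "(\<lambda>x. c) \<in> poly_functions E"
| coord: "i \<in> E \<Longrightarrow> (\<lambda>x. x i) \<in> poly_functions E"
| add: "p \<in> poly_functions E \<Longrightarrow> q \<in> poly_functions E \<Longrightarrow> (\<lambda>x. p x + q x) \<in> poly_functions E"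
| mult: "p \<in> poly_functions E \<Longrightarrow> q \<in> poly_functions E \<Longrightarrow> (\<lambda>x. p x * q x) \<in> poly_functions E"

definition zero_locus :: "'i set \<Rightarrow> (('i \<Rightarrow> complex) \<Rightarrow> complex) set \<Rightarrow> ('i \<Rightarrow> complex) set" where
  "zero_locus E P = {x \<in> coord_space E. \<forall>p\<in>P. p x = 0}"

definition zariski :: "'i set \<Rightarrow> ('i \<Rightarrow> complex) topology" where
  "zariski E = topology (\<lambda>U. \<exists>P \<subseteq> poly_functions E. U = coord_space E - zero_locus E P)"

lemma istopology_zariski:
  "istopology (\<lambda>U. \<exists>P \<subseteq> poly_functions E. U = coord_space E - zero_locus E P)"
  unfolding istopology_def
proof (intro conjI allI impI)
  fix S T
  assume "\<exists>P \<subseteq> poly_functions E. S = coord_space E - zero_locus E P"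
    and "\<exists>P \<subseteq> poly_functions E. T = coord_space E - zero_locus E P"
  then obtain P Q where PQ: "P \<subseteq> poly_functions E" "S = coord_space E - zero_locus E P"
      "Q \<subseteq> poly_functions E" "T = coord_space E - zero_locus E Q"
    by blast
  let ?R = "(\<lambda>(p, q) x. p x * q x) ` (P \<times> Q)"
  have "?R \<subseteq> poly_functions E"
    using PQ by (auto intro!: poly_functions.mult)
  moreover have "S \<inter> T = coord_space E - zero_locus E ?R"
  proof (intro set_eqI iffI)
    fix x
    assume "x \<in> S \<inter> T"
    then obtain p q where "x \<in> coord_space E" "p \<in> P" "q \<in> Q" "p x \<noteq> 0" "q x \<noteq> 0"
      unfolding PQ zero_locus_def by blast
    then show "x \<in> coord_space E - zero_locus E ?R"
      unfolding zero_locus_def by force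
  next
    fix x
    assume "x \<in> coord_space E - zero_locus E ?R"
    then obtain p q where "x \<in> coord_space E" "p \<in> P" "q \<in> Q" "p x * q x \<noteq> 0"
      unfolding zero_locus_def by auto
    then show "x \<in> S \<inter> T"
      unfolding PQ zero_locus_def by auto
  qed
  ultimately show "\<exists>P \<subseteq> poly_functions E. S \<inter> T = coord_space E - zero_locus E P"
    by blast
next
  fix K
  assume "\<forall>S\<in>K. \<exists>P \<subseteq> poly_functions E. S = coord_space E - zero_locus E P"
  then obtain P where P: "\<And>S. S \<in> K \<Longrightarrow> P S \<subseteq> poly_functions E"
      "\<And>S. S \<in> K \<Longrightarrow> S = coord_space E - zero_locus E (P S)"
    by metis
  have "\<Union>K = (\<Union>S\<in>K. S)"
    by simp
  also have "\<dots> = (\<Union>S\<in>K. coord_space E - zero_locus E (P S))"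
    using P(2) by (intro SUP_cong refl)
  also have "\<dots> = coord_space E - zero_locus E (\<Union>S\<in>K. P S)"
    unfolding zero_locus_def by blast
  finally show "\<exists>P \<subseteq> poly_functions E. \<Union>K = coord_space E - zero_locus E P"
    using P(1) by (intro exI[of _ "\<Union>S\<in>K. P S"] conjI UN_least)
qed

lemma openin_zariski:
  "openin (zariski E) U \<longleftrightarrow> (\<exists>P \<subseteq> poly_functions E. U = coord_space E - zero_locus E P)"
  unfolding zariski_def by (simp add: topology_inverse'[OF istopology_zariski])

lemma topspace_zariski [simp]: "topspace (zariski E) = coord_space E"
proof -
  have "openin (zariski E) (coord_space E)"
    unfolding openin_zariski zero_locus_def
    by (rule exI[of _ "{\<lambda>x. 1}"]) (auto intro: poly_functions.const)
  moreover have "U \<subseteq> coord_space E" if "openin (zariski E) U" for U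
    using that unfolding openin_zariski by blast
  ultimately show ?thesis
    unfolding topspace_def by blast
qed

lemma closedin_zariski:
  "closedin (zariski E) C \<longleftrightarrow> (\<exists>P \<subseteq> poly_functions E. C = zero_locus E P)"
proof -
  have sub: "zero_locus E P \<subseteq> coord_space E" for P
    by (auto simp: zero_locus_def)
  show ?thesis
  proof
    assume "closedin (zariski E) C"
    then obtain P where "C \<subseteq> coord_space E" "P \<subseteq> poly_functions E"
        "coord_space E - C = coord_space E - zero_locus E P"
      unfolding closedin_def openin_zariski topspace_zariski by blast
    moreover from this sub[of P] have "C = zero_locus E P"
      by blast
    ultimately show "\<exists>P \<subseteq> poly_functions E. C = zero_locus E P"
      by blast
  next
    assume "\<exists>P \<subseteq> poly_functions E. C = zero_locus E P"
    then show "closedin (zariski E) C"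
      unfolding closedin_def openin_zariski topspace_zariski using sub by blast
  qed
qed

section \<open>Irreducibility and dimension\<close>

definition irreducible_in :: "'a topology \<Rightarrow> 'a set \<Rightarrow> bool" where
  "irreducible_in X S \<longleftrightarrow> S \<noteq> {} \<and> S \<subseteq> topspace X \<and>
     (\<forall>A B. closedin X A \<and> closedin X B \<and> S \<subseteq> A \<union> B \<longrightarrow> S \<subseteq> A \<or> S \<subseteq> B)"

definition irreducible_component_of :: "'a topology \<Rightarrow> 'a set \<Rightarrow> 'a set \<Rightarrow> bool" where
  "irreducible_component_of X W Z \<longleftrightarrow> irreducible_in X Z \<and> Z \<subseteq> W \<and>
     (\<forall>Z'. irreducible_in X Z' \<and> Z \<subseteq> Z' \<and> Z' \<subseteq> W \<longrightarrow> Z' = Z)"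

text \<open>
  Krull dimension: the supremum of the lengths \<open>n\<close> of chains
  \<open>C 0 \<subset> C 1 \<subset> \<dots> \<subset> C n\<close> of irreducible closed subsets of \<open>S\<close>.
  (The empty set gets dimension 0, but is never an irreducible component.)
\<close>

definition krull_dim :: "'a topology \<Rightarrow> 'a set \<Rightarrow> enat" where
  "krull_dim X S = Sup {enat n | n. \<exists>C. 
     (\<forall>i\<le>n. closedin (subtopology X S) (C i) \<and> irreducible_in X (C i)) \<and>
     (\<forall>i<n. C i \<subset> C (Suc i))}"

section \<open>Tangent spaces and tangent contact loci\<close>

global_interpretation complex_fun: vector_space "\<lambda>(c::complex) (v::'i \<Rightarrow> complex). (\<lambda>i. c * v i)"
  by unfold_locales (auto simp: fun_eq_iff algebra_simps)

definition vanishing_ideal :: "'i set \<Rightarrow> ('i \<Rightarrow> complex) set \<Rightarrow> (('i \<Rightarrow> complex) \<Rightarrow> complex) set" where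
  "vanishing_ideal E V = {p \<in> poly_functions E. \<forall>x\<in>V. p x = 0}"

definition partial_deriv :: "'i \<Rightarrow> (('i \<Rightarrow> complex) \<Rightarrow> complex) \<Rightarrow> ('i \<Rightarrow> complex) \<Rightarrow> complex" where
  "partial_deriv i p y = deriv (\<lambda>z. p (y(i := z))) (y i)"

text \<open>The Zariski tangent space at \<open>y\<close>, as a linear subspace; meaningful for finite \<open>E\<close>.\<close>

definition tangent_space :: "'i set \<Rightarrow> ('i \<Rightarrow> complex) set \<Rightarrow> ('i \<Rightarrow> complex) \<Rightarrow> ('i \<Rightarrow> complex) set" where
  "tangent_space E V y =
     {v \<in> coord_space E. \<forall>p \<in> vanishing_ideal E V. (\<Sum>i\<in>E. partial_deriv i p y * v i) = 0}"

text \<open>The points \<open>x\<^sub>1, \<dots>, x\<^sub>d\<close> are \<open>x 0, \<dots>, x (d - 1)\<close>.\<close>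

definition contact_locus ::
    "'i set \<Rightarrow> ('i \<Rightarrow> complex) set \<Rightarrow> nat \<Rightarrow> (nat \<Rightarrow> 'i \<Rightarrow> complex) \<Rightarrow> ('i \<Rightarrow> complex) set" where
  "contact_locus E V d x = zariski E closure_of
     {y \<in> V. tangent_space E V y \<subseteq> complex_fun.span (\<Union>i<d. tangent_space E V (x i))}"

text \<open>
  A property holds for generic \<open>x\<^sub>1, \<dots>, x\<^sub>d \<in> V\<close> if it holds on a nonempty Zariski open subset of the
  \<open>d\<close>-fold product \<open>V \<times> \<dots> \<times> V\<close>; for irreducible \<open>V\<close> the product is irreducible, so such a subset
  is dense. The product carries the Zariski topology of its ambient affine space
  (not the product topology), whose coordinates are indexed by \<open>{..<d} \<times> E\<close>.
\<close>

definition variety_power ::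
    "'i set \<Rightarrow> ('i \<Rightarrow> complex) set \<Rightarrow> nat \<Rightarrow> (nat \<times> 'i \<Rightarrow> complex) set" where
  "variety_power E V d = {z \<in> coord_space ({..<d} \<times> E). \<forall>i<d. (\<lambda>e. z (i, e)) \<in> V}"

definition generically ::
    "'i set \<Rightarrow> ('i \<Rightarrow> complex) set \<Rightarrow> nat \<Rightarrow> ((nat \<Rightarrow> 'i \<Rightarrow> complex) \<Rightarrow> bool) \<Rightarrow> bool" where
  "generically E V d P \<longleftrightarrow>
     (\<exists>U. openin (subtopology (zariski ({..<d} \<times> E)) (variety_power E V d)) U \<and> U \<noteq> {} \<and>
          (\<forall>z\<in>U. P (\<lambda>i e. z (i, e))))"

definition tangentially_weakly_defective :: "'i set \<Rightarrow> ('i \<Rightarrow> complex) set \<Rightarrow> nat \<Rightarrow> bool" where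
  "tangentially_weakly_defective E V d \<longleftrightarrow>
     generically E V d (\<lambda>x. \<exists>i<d. \<exists>Z. irreducible_component_of (zariski E) (contact_locus E V d x) Z
        \<and> x i \<in> Z \<and> krull_dim (zariski E) Z \<ge> 2)"

definition tangentially_weakly_nondefective :: "'i set \<Rightarrow> ('i \<Rightarrow> complex) set \<Rightarrow> nat \<Rightarrow> bool" where
  "tangentially_weakly_nondefective E V d \<longleftrightarrow> \<not> tangentially_weakly_defective E V d"

section \<open>Complete multipartite hypergraphs and the random graph process\<close>

text \<open>
  The \<open>j\<close>-th vertex of the \<open>i\<close>-th class is the pair \<open>(i, j)\<close>. All graphs are on the full vertex set
  and are represented by their edge sets.
\<close>

type_synonym vertex = "nat \<times> nat"

definition vertex_class :: "nat \<Rightarrow> nat \<Rightarrow> vertex set" where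
  "vertex_class n i = {i} \<times> {..<n}"

definition vertices :: "nat \<Rightarrow> nat \<Rightarrow> vertex set" where
  "vertices k n = (\<Union>i<k. vertex_class n i)"

definition complete_edges :: "nat \<Rightarrow> nat \<Rightarrow> vertex set set" where
  "complete_edges k n = {e. e \<subseteq> vertices k n \<and> (\<forall>i<k. card (e \<inter> vertex_class n i) = 1)}"

definition vertex_degree :: "vertex set set \<Rightarrow> vertex \<Rightarrow> nat" where
  "vertex_degree G v = card {e \<in> G. v \<in> e}"

definition min_degree :: "nat \<Rightarrow> nat \<Rightarrow> vertex set set \<Rightarrow> nat" where
  "min_degree k n G = Min (vertex_degree G ` vertices k n)"

definition edge_order :: "nat \<Rightarrow> nat \<Rightarrow> vertex set list pmf" where
  "edge_order k n = pmf_of_set (permutations_of_set (complete_edges k n))"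

definition process_graph :: "vertex set list \<Rightarrow> nat \<Rightarrow> vertex set set" where
  "process_graph es m = set (take m es)"

text \<open>Unspecified if even the complete graph has minimum degree below \<open>s\<close>,
  i.e. only for finitely many \<open>n\<close> once \<open>k \<ge> 2\<close> and \<open>s\<close> are fixed.\<close>

definition hitting_time :: "nat \<Rightarrow> nat \<Rightarrow> nat \<Rightarrow> vertex set list \<Rightarrow> nat" where
  "hitting_time k n s es = (LEAST m. min_degree k n (process_graph es m) \<ge> s)"

section \<open>Projected Segre varieties\<close>

definition segre :: "nat \<Rightarrow> nat \<Rightarrow> (vertex \<Rightarrow> complex) \<Rightarrow> vertex set \<Rightarrow> complex" where
  "segre k n x = (\<lambda>e. if e \<in> complete_edges k n then \<Prod>v\<in>e. x v else 0)"

definition coord_proj :: "'i set \<Rightarrow> ('i \<Rightarrow> complex) \<Rightarrow> 'i \<Rightarrow> complex" where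
  "coord_proj G y = (\<lambda>e. if e \<in> G then y e else 0)"

definition graph_variety :: "nat \<Rightarrow> nat \<Rightarrow> vertex set set \<Rightarrow> (vertex set \<Rightarrow> complex) set" where
  "graph_variety k n G =
     zariski G closure_of (coord_proj G ` segre k n ` coord_space (vertices k n))"

end

theory Submission
  imports Defs "HOL-Real_Asymp.Real_Asymp"
begin

text \<open>
  Tangent vectors at \<open>x = (\<Prod>v\<in>e. p v)\<^sub>e\<close> have the form \<open>(x\<^sub>e * (\<Sum>v\<in>e. s v))\<^sub>e\<close>, and \<open>T\<^sub>y \<subseteq> W\<close> imposes
  linear conditions on \<open>y\<close>, because the truncation of \<open>y\<close> to the edges at a vertex lies in \<open>T\<^sub>y\<close>.
  Hence the contact locus at \<open>x\<^sub>i\<close> is contained in a line as soon as a linear system, the Hessian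
  condition, has only scalar solutions. Like the triviality of all relations between the tangent
  spaces, this passes from a vertex set \<open>X\<close> to \<open>X \<union> {v}\<close> if \<open>d + 1\<close> edges at \<open>v\<close> lie in \<open>X \<union> {v}\<close>.

  It therefore suffices that the graph has a core where both conditions hold and from which such
  extensions reach every vertex. Splitting each class into \<open>d + 1\<close> blocks and specialising \<open>x\<^sub>i\<close> to the
  indicator of one block decouples the systems, and leaves incidence systems of box subgraphs. If
  every box of linear size contains more than \<open>n\<close> edges, these are trivial on a core missing few vertices.
  A random process of about \<open>n ln n\<close> edges has dense boxes, and no small set \<open>R\<close> has at most \<open>d * card R\<close>
  edges meeting it once and at least \<open>card R\<close> incidences with edges meeting it more often; the latter
  shows that the extension process cannot stop before every vertex of degree \<open>d + 1\<close> is reached.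
\<close>

section \<open>Polynomial functions and generic points\<close>

text \<open>The degree \<open>d + 1\<close> is the price of one extension: a new vertex carries one
  unknown per tangent space and one more from the Hessian condition. It is the only property used
  exactly at the hitting time. Everything else is read off at two fixed times, about
  \<open>3 / 4 * n * ln n\<close> and \<open>2 * n * ln n\<close>, that enclose it: dense boxes and
  edges meeting \<open>R\<close> once only become more numerous after the first, and edges meeting
  \<open>R\<close> more often are at most those present at the second. So nothing has to be analysed
  at a random time. The factor 3/4 is below 1, so that an isolated vertex remains and the first time
  precedes the hitting time; it exceeds 1/2 by enough for a union bound over all \<open>R\<close> to
  converge. The obstacle to specialising is that indicator points have zero coordinates, where the
  torus description of tangent vectors breaks down. The systems are therefore written with
  derivatives of the monomials, which are polynomial everywhere, and are rescaled back only at
  generic points.\<close>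

lemma poly_functions_sum:
  "(\<And>a. a \<in> A \<Longrightarrow> f a \<in> poly_functions E) \<Longrightarrow> (\<lambda>x. \<Sum>a\<in>A. f a x) \<in> poly_functions E"
  by (induction A rule: infinite_finite_induct)
     (auto intro: poly_functions.intros)

lemma poly_functions_prod:
  "(\<And>a. a \<in> A \<Longrightarrow> f a \<in> poly_functions E) \<Longrightarrow> (\<lambda>x. \<Prod>a\<in>A. f a x) \<in> poly_functions E"
  by (induction A rule: infinite_finite_induct)
     (auto intro: poly_functions.intros)

lemma poly_functions_cmult: "f \<in> poly_functions E \<Longrightarrow> (\<lambda>x. c * f x) \<in> poly_functions E"
  by (intro poly_functions.mult poly_functions.const)

lemma poly_functions_diff:
  assumes "f \<in> poly_functions E" "g \<in> poly_functions E"
  shows "(\<lambda>x. f x - g x) \<in> poly_functions E"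
  using poly_functions.add[OF assms(1) poly_functions_cmult[OF assms(2), of "-1"]] by simp

lemma poly_functions_power:
  "f \<in> poly_functions E \<Longrightarrow> (\<lambda>x. f x ^ n) \<in> poly_functions E"
  by (induction n) (auto intro: poly_functions.intros)

lemma poly_functions_subst:
  assumes "F \<in> poly_functions E" "\<And>e. e \<in> E \<Longrightarrow> g e \<in> poly_functions E'"
  shows "(\<lambda>x. F (\<lambda>e. g e x)) \<in> poly_functions E'"
  using assms by (induction rule: poly_functions.induct) (auto intro: poly_functions.intros)

text \<open>Restriction to a curve with polynomial coordinates reduces questions in several
  variables to the finiteness of the root set of a univariate polynomial.\<close>

lemma poly_functions_curve:
  assumes "F \<in> poly_functions E" "\<And>e. e \<in> E \<Longrightarrow> \<exists>q. \<forall>s. c s e = poly q s"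
  shows "\<exists>q. \<forall>s. F (c s) = poly q s"
  using assms
proof (induction rule: poly_functions.induct)
  case (const c) then show ?case by (intro exI[of _ "[:c:]"]) auto
next
  case (add p q) then show ?case by (metis poly_add)
next
  case (mult p q) then show ?case by (metis poly_mult)
qed auto

lemma poly_eq_0_cofinite:
  fixes q :: "complex poly"
  assumes "\<And>s. s \<notin> A \<Longrightarrow> poly q s = 0" "finite A"
  shows "q = 0"
proof (rule ccontr)
  assume "q \<noteq> 0"
  then have "finite {s. poly q s = 0}" by (rule poly_roots_finite)
  moreover have "- A \<subseteq> {s. poly q s = 0}" using assms by auto
  ultimately have "finite (- A)" using finite_subset by blast
  with \<open>finite A\<close> have "finite (UNIV :: complex set)"
    by (metis Compl_eq_Diff_UNIV finite_Diff2)
  then show False using infinite_UNIV_char_0 by blast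
qed

text \<open>On the line joining \<open>p\<close> to \<open>q\<close> both factors are nonzero
  univariate polynomials, one by its value at 0, the other by its value at 1. This is the
  irreducibility of affine space, and it makes genericity stable under conjunction.\<close>

lemma poly_functions_mult_nonzero:
  assumes "f \<in> poly_functions I" "g \<in> poly_functions I" "f p \<noteq> 0" "g q \<noteq> 0"
  shows "\<exists>r. f r * g r \<noteq> 0"
proof -
  let ?c = "\<lambda>s i. p i + s * (q i - p i)"
  have c: "\<exists>r. \<forall>s. ?c s i = poly r s" for i
    by (intro exI[of _ "[:p i, q i - p i:]"]) auto
  obtain F where F: "\<And>s. f (?c s) = poly F s" using poly_functions_curve[OF assms(1), of ?c] c by blast
  obtain G where G: "\<And>s. g (?c s) = poly G s" using poly_functions_curve[OF assms(2), of ?c] c by blast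
  have "poly F 0 \<noteq> 0" using F[of 0] assms(3) by simp
  moreover have "poly G 1 \<noteq> 0" using G[of 1] assms(4) by simp
  ultimately have "F * G \<noteq> 0" by auto
  then obtain s where "poly (F * G) s \<noteq> 0" using poly_all_0_iff_0 by blast
  then show ?thesis using F G by (metis poly_mult)
qed

section \<open>Genericity in the affine space of parameters\<close>

definition generic_point :: "'i set \<Rightarrow> (('i \<Rightarrow> complex) \<Rightarrow> bool) \<Rightarrow> bool" where
  "generic_point I P \<longleftrightarrow> (\<exists>h\<in>poly_functions I. (\<exists>p. h p \<noteq> 0) \<and> (\<forall>p. h p \<noteq> 0 \<longrightarrow> P p))"

lemma generic_point_poly:
  "h \<in> poly_functions I \<Longrightarrow> h p \<noteq> 0 \<Longrightarrow> generic_point I (\<lambda>p. h p \<noteq> 0)"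
  unfolding generic_point_def by blast

lemma generic_point_mono:
  "generic_point I P \<Longrightarrow> (\<And>p. P p \<Longrightarrow> Q p) \<Longrightarrow> generic_point I Q"
  unfolding generic_point_def by blast

lemma generic_pointE:
  assumes "generic_point I P"
  obtains h p where "h \<in> poly_functions I" "h p \<noteq> 0" "\<And>p. h p \<noteq> 0 \<Longrightarrow> P p"
  using assms unfolding generic_point_def by (elim bexE conjE exE) simp

lemma generic_point_conj:
  assumes "generic_point I P" "generic_point I Q"
  shows "generic_point I (\<lambda>p. P p \<and> Q p)"
proof -
  obtain f p where f: "f \<in> poly_functions I" "f p \<noteq> 0" "\<And>p. f p \<noteq> 0 \<Longrightarrow> P p"
    by (rule generic_pointE[OF assms(1)]) (rule that)
  obtain g q where g: "g \<in> poly_functions I" "g q \<noteq> 0" "\<And>p. g p \<noteq> 0 \<Longrightarrow> Q p"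
    by (rule generic_pointE[OF assms(2)]) (rule that)
  obtain r where "f r * g r \<noteq> 0"
    using poly_functions_mult_nonzero[where f = f and g = g and p = p and q = q, OF f(1) g(1) f(2) g(2)] by blast
  then have "generic_point I (\<lambda>p. f p * g p \<noteq> 0)"
    by (rule generic_point_poly[where h = "\<lambda>p. f p * g p", OF poly_functions.mult[OF f(1) g(1)]])
  then show ?thesis by (rule generic_point_mono) (use f(3) g(3) in auto)
qed

lemma generic_point_ball:
  assumes "finite A" "\<And>a. a \<in> A \<Longrightarrow> generic_point I (P a)"
  shows "generic_point I (\<lambda>p. \<forall>a\<in>A. P a p)"
  using assms
proof (induction A)
  case empty
  have "generic_point I (\<lambda>p. (1::complex) \<noteq> 0)"
    by (rule generic_point_poly[where h = "\<lambda>_. 1"]) (auto intro: poly_functions.const)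
  then show ?case by (rule generic_point_mono) auto
next
  case (insert a A)
  have "generic_point I (\<lambda>p. P a p \<and> (\<forall>a\<in>A. P a p))"
    using insert by (intro generic_point_conj) auto
  then show ?case by (rule generic_point_mono) auto
qed

lemma generic_point_ex: "generic_point I P \<Longrightarrow> \<exists>p. P p"
  unfolding generic_point_def by blast

text \<open>Gaussian elimination without division: if a matrix of polynomials is injective at one point,
  then some polynomial that is nonzero at this point annihilates all kernel vectors everywhere.\<close>

lemma poly_kernel_elimination:
  fixes R :: "('j \<Rightarrow> ('i \<Rightarrow> complex) \<Rightarrow> complex) set"
  assumes "finite J"
    and "\<And>M j. M \<in> R \<Longrightarrow> j \<in> J \<Longrightarrow> M j \<in> poly_functions I"
    and "\<And>t. (\<And>M. M \<in> R \<Longrightarrow> (\<Sum>j\<in>J. M j p0 * t j) = 0) \<Longrightarrow> \<forall>j\<in>J. t j = 0"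
  shows "\<exists>h\<in>poly_functions I. h p0 \<noteq> 0 \<and>
    (\<forall>p t. (\<forall>M\<in>R. (\<Sum>j\<in>J. M j p * t j) = 0) \<longrightarrow> (\<forall>j\<in>J. h p * t j = 0))"
  using assms
proof (induction J arbitrary: R)
  case empty
  show ?case by (rule bexI[of _ "\<lambda>_. 1"]) (auto intro: poly_functions.const)
next
  case (insert i J)
  have "\<exists>M0\<in>R. M0 i p0 \<noteq> 0"
  proof (rule ccontr)
    assume no_pivot: "\<not> ?thesis"
    have "\<forall>j\<in>insert i J. (if j = i then 1 else 0 :: complex) = 0"
    proof (rule insert.prems(2))
      fix M assume "M \<in> R"
      show "(\<Sum>j\<in>insert i J. M j p0 * (if j = i then 1 else 0)) = 0"
        by (rule sum.neutral) (use \<open>M \<in> R\<close> no_pivot in auto)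
    qed
    then show False by simp
  qed
  then obtain M0 where M0: "M0 \<in> R" "M0 i p0 \<noteq> 0" by blast
  \<comment> \<open>Cross-multiplication with the pivot row eliminates the variable \<open>i\<close>
    without division. The pivot polynomial is nonzero at \<open>p0\<close> and becomes a factor of
    the final polynomial.\<close>
  let ?N = "\<lambda>M j x. M0 i x * M j x - M i x * M0 j x"
  let ?R = "?N ` R"
  have 1: "M j \<in> poly_functions I" if "M \<in> ?R" "j \<in> J" for M j
    using that M0(1) insert.prems(1) by (auto intro!: poly_functions_diff poly_functions.mult)
  have 2: "\<forall>j\<in>J. t j = 0" if t: "\<And>M. M \<in> ?R \<Longrightarrow> (\<Sum>j\<in>J. M j p0 * t j) = 0" for t
  proof -
    define t' where "t' j = (if j = i then - (\<Sum>j\<in>J. M0 j p0 * t j) / M0 i p0 else t j)" for j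
    have "(\<Sum>j\<in>insert i J. M j p0 * t' j) = 0" if "M \<in> R" for M
    proof -
      have "(\<Sum>j\<in>J. ?N M j p0 * t j) = 0" using t that by blast
      then have *: "M0 i p0 * (\<Sum>j\<in>J. M j p0 * t j) = M i p0 * (\<Sum>j\<in>J. M0 j p0 * t j)"
        by (simp add: algebra_simps sum_subtractf sum_distrib_left)
      have "(\<Sum>j\<in>insert i J. M j p0 * t' j) = M i p0 * t' i + (\<Sum>j\<in>J. M j p0 * t j)"
        using insert.hyps by (auto simp: t'_def intro!: sum.cong)
      also have "\<dots> = 0" using * M0(2) by (simp add: t'_def field_simps)
      finally show ?thesis .
    qed
    then have "\<forall>j\<in>insert i J. t' j = 0" by (rule insert.prems(2))
    then show ?thesis using insert.hyps by (auto simp: t'_def split: if_splits)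
  qed
  have IH: "\<exists>h\<in>poly_functions I. h p0 \<noteq> 0 \<and>
    (\<forall>p t. (\<forall>M\<in>?R. (\<Sum>j\<in>J. M j p * t j) = 0) \<longrightarrow> (\<forall>j\<in>J. h p * t j = 0))"
    by (rule insert.IH) (fact 1, fact 2)
  obtain h where h: "h \<in> poly_functions I" "h p0 \<noteq> 0"
    "\<And>p t j. (\<forall>M\<in>?R. (\<Sum>j\<in>J. M j p * t j) = 0) \<Longrightarrow> j \<in> J \<Longrightarrow> h p * t j = 0"
    using IH by blast
  show ?case
  proof (intro bexI[of _ "\<lambda>x. h x * M0 i x"] conjI allI impI ballI)
    show "(\<lambda>x. h x * M0 i x) \<in> poly_functions I"
      using h(1) insert.prems(1) M0(1) by (auto intro!: poly_functions.mult)
    show "h p0 * M0 i p0 \<noteq> 0" using h M0 by simp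
    fix p t j assume t: "\<forall>M\<in>R. (\<Sum>j\<in>insert i J. M j p * t j) = 0" and j: "j \<in> insert i J"
    have eq: "M i p * t i = - (\<Sum>j\<in>J. M j p * t j)" if "M \<in> R" for M
      using bspec[OF t that] insert.hyps by (simp add: add_eq_0_iff)
    have "\<forall>M\<in>?R. (\<Sum>j\<in>J. M j p * t j) = 0"
    proof clarify
      fix M assume "M \<in> R"
      have "(\<Sum>j\<in>J. ?N M j p * t j) = M0 i p * (\<Sum>j\<in>J. M j p * t j) - M i p * (\<Sum>j\<in>J. M0 j p * t j)"
        by (simp add: algebra_simps sum_subtractf sum_distrib_left)
      also have "\<dots> = - (M0 i p * (M i p * t i)) + M i p * (M0 i p * t i)"
        unfolding eq[OF \<open>M \<in> R\<close>] eq[OF M0(1)] by simp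
      finally show "(\<Sum>j\<in>J. ?N M j p * t j) = 0" by simp
    qed
    then have J: "h p * t j = 0" if "j \<in> J" for j using h(3) that by blast
    have "h p * M0 i p * t i = - (\<Sum>j\<in>J. M0 j p * (h p * t j))"
      using eq[OF M0(1)] by (simp add: sum_distrib_left algebra_simps)
    also have "(\<Sum>j\<in>J. M0 j p * (h p * t j)) = 0" using J by (intro sum.neutral) auto
    finally show "h p * M0 i p * t j = 0" using j J by auto
  qed
qed

text \<open>Injectivity of a polynomial matrix is an open condition, so one well chosen witness
  \<open>p0\<close> settles the generic case. All later specialisations enter through this
  lemma.\<close>

lemma generic_point_injective:
  fixes R :: "('j \<Rightarrow> ('i \<Rightarrow> complex) \<Rightarrow> complex) set"
  assumes "finite J"
    and "\<And>M j. M \<in> R \<Longrightarrow> j \<in> J \<Longrightarrow> M j \<in> poly_functions I"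
    and "\<And>t. (\<And>M. M \<in> R \<Longrightarrow> (\<Sum>j\<in>J. M j p0 * t j) = 0) \<Longrightarrow> \<forall>j\<in>J. t j = 0"
  shows "generic_point I (\<lambda>p. \<forall>t. (\<forall>M\<in>R. (\<Sum>j\<in>J. M j p * t j) = 0) \<longrightarrow> (\<forall>j\<in>J. t j = 0))"
proof -
  have "\<exists>h\<in>poly_functions I. h p0 \<noteq> 0 \<and>
    (\<forall>p t. (\<forall>M\<in>R. (\<Sum>j\<in>J. M j p * t j) = 0) \<longrightarrow> (\<forall>j\<in>J. h p * t j = 0))"
    by (rule poly_kernel_elimination) (fact assms)+
  then obtain h where h: "h \<in> poly_functions I" "h p0 \<noteq> 0"
    and h0: "\<forall>p t. (\<forall>M\<in>R. (\<Sum>j\<in>J. M j p * t j) = 0) \<longrightarrow> (\<forall>j\<in>J. h p * t j = 0)"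
    by (elim bexE conjE) (rule that)
  have "\<forall>t. (\<forall>M\<in>R. (\<Sum>j\<in>J. M j p * t j) = 0) \<longrightarrow> (\<forall>j\<in>J. t j = 0)" if "h p \<noteq> 0" for p
    using h0[rule_format, of p] that by auto
  then show ?thesis
    by (rule generic_point_mono[OF generic_point_poly[where h = h and p = p0, OF h]])
qed

section \<open>Partial derivatives and finite differences of polynomials\<close>

lemma poly_functions_coord_differentiable:
  assumes "F \<in> poly_functions E"
  shows "(\<lambda>z. F (y(i := z))) field_differentiable at a"
proof -
  have "\<exists>q. \<forall>s. F (y(i := s)) = poly q s"
  proof (rule poly_functions_curve[OF assms])
    fix e
    show "\<exists>q. \<forall>s. (y(i := s)) e = poly q s"
      by (cases "e = i") (auto intro: exI[of _ "[:0,1:]"] exI[of _ "[:y e:]"])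
  qed
  then obtain q where "(\<lambda>z. F (y(i := z))) = poly q" by blast
  then show ?thesis using poly_DERIV field_differentiable_def by metis
qed

lemma partial_deriv_mult:
  assumes "F \<in> poly_functions E" "G \<in> poly_functions E"
  shows "partial_deriv i (\<lambda>x. F x * G x) y = F y * partial_deriv i G y + partial_deriv i F y * G y"
  unfolding partial_deriv_def
  using deriv_mult[OF poly_functions_coord_differentiable[OF assms(1)]
      poly_functions_coord_differentiable[OF assms(2)], of y i y i "y i"] by simp

lemma partial_deriv_add:
  assumes "F \<in> poly_functions E" "G \<in> poly_functions E"
  shows "partial_deriv i (\<lambda>x. F x + G x) y = partial_deriv i F y + partial_deriv i G y"
  unfolding partial_deriv_def
  using deriv_add[OF poly_functions_coord_differentiable[OF assms(1)]
      poly_functions_coord_differentiable[OF assms(2)], of y i y i "y i"] by simp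

lemma partial_deriv_coord: "partial_deriv i (\<lambda>x. x j) y = (if i = j then 1 else 0)"
  unfolding partial_deriv_def by auto

lemma partial_deriv_const: "partial_deriv i (\<lambda>x. c) y = 0"
  unfolding partial_deriv_def by auto

text \<open>Hadamard's lemma. A product is telescoped through \<open>p\<close> at \<open>g\<close>
  times \<open>q\<close> at \<open>h\<close>, so the coefficients stay polynomial, and where
  \<open>g\<close> and \<open>h\<close> agree they specialise to partial derivatives. The vanishing
  of a difference thus becomes a linear equation that can be evaluated at the base point without a
  limit.\<close>

lemma poly_functions_hadamard:
  assumes "F \<in> poly_functions E" "finite E"
    and "\<And>e. e \<in> E \<Longrightarrow> g e \<in> poly_functions E'" "\<And>e. e \<in> E \<Longrightarrow> h e \<in> poly_functions E'"
  obtains M where "\<And>e. e \<in> E \<Longrightarrow> M e \<in> poly_functions E'"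
    "\<And>y. F (\<lambda>e. g e y) - F (\<lambda>e. h e y) = (\<Sum>e\<in>E. M e y * (g e y - h e y))"
    "\<And>y e. e \<in> E \<Longrightarrow> (\<And>e. g e y = h e y) \<Longrightarrow> M e y = partial_deriv e F (\<lambda>e. g e y)"
proof -
  define H where "H F M \<longleftrightarrow> (\<forall>e\<in>E. M e \<in> poly_functions E') \<and>
    (\<forall>y. F (\<lambda>e. g e y) - F (\<lambda>e. h e y) = (\<Sum>e\<in>E. M e y * (g e y - h e y))) \<and>
    (\<forall>y e. e \<in> E \<longrightarrow> (\<forall>e. g e y = h e y) \<longrightarrow> M e y = partial_deriv e F (\<lambda>e. g e y))" for F M
  have H1: "M e \<in> poly_functions E'" if "H F M" "e \<in> E" for F M e
    using that unfolding H_def by blast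
  have H2: "F (\<lambda>e. g e y) - F (\<lambda>e. h e y) = (\<Sum>e\<in>E. M e y * (g e y - h e y))" if "H F M" for F M y
    using that unfolding H_def by blast
  have H3: "M e y = partial_deriv e F (\<lambda>e. g e y)" if "H F M" "e \<in> E" "\<And>e. g e y = h e y" for F M e y
    using that unfolding H_def by blast
  have "\<exists>M. H F M"
    using assms(1)
  proof (induction rule: poly_functions.induct)
    case (const c)
    have "H (\<lambda>x. c) (\<lambda>_ _. 0)"
      unfolding H_def by (auto simp: partial_deriv_const intro: poly_functions.const)
    then show ?case by blast
  next
    case (coord i)
    have "(\<Sum>e\<in>E. (if e = i then 1 else 0) * (g e y - h e y)) = g i y - h i y" for y
      using \<open>finite E\<close> coord by (simp add: if_distrib[of "\<lambda>x. x * _"] sum.delta cong: if_cong)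
    then have "H (\<lambda>x. x i) (\<lambda>e _. if e = i then 1 else 0)"
      unfolding H_def by (auto simp: partial_deriv_coord intro: poly_functions.const)
    then show ?case by blast
  next
    case (add p q)
    obtain M where M: "H p M" using add.IH(1) by (rule exE)
    obtain N where N: "H q N" using add.IH(2) by (rule exE)
    have "H (\<lambda>x. p x + q x) (\<lambda>e y. M e y + N e y)"
      unfolding H_def
    proof (intro conjI ballI allI impI)
      fix y
      have "p (\<lambda>e. g e y) + q (\<lambda>e. g e y) - (p (\<lambda>e. h e y) + q (\<lambda>e. h e y))
        = (p (\<lambda>e. g e y) - p (\<lambda>e. h e y)) + (q (\<lambda>e. g e y) - q (\<lambda>e. h e y))" by simp
      then show "p (\<lambda>e. g e y) + q (\<lambda>e. g e y) - (p (\<lambda>e. h e y) + q (\<lambda>e. h e y))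
        = (\<Sum>e\<in>E. (M e y + N e y) * (g e y - h e y))"
        unfolding H2[OF M] H2[OF N] by (simp add: distrib_right sum.distrib)
    next
      fix y e assume "e \<in> E" "\<forall>e. g e y = h e y"
      then show "M e y + N e y = partial_deriv e (\<lambda>x. p x + q x) (\<lambda>e. g e y)"
        using H3[OF M, of e y] H3[OF N, of e y] by (simp add: partial_deriv_add[OF add.hyps])
    qed (use H1[OF M] H1[OF N] in \<open>auto intro: poly_functions.add\<close>)
    then show ?case by blast
  next
    case (mult p q)
    obtain M where M: "H p M" using mult.IH(1) by (rule exE)
    obtain N where N: "H q N" using mult.IH(2) by (rule exE)
    have "H (\<lambda>x. p x * q x) (\<lambda>e y. p (\<lambda>e. g e y) * N e y + M e y * q (\<lambda>e. h e y))"
      unfolding H_def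
    proof (intro conjI ballI allI impI)
      fix e assume "e \<in> E"
      then show "(\<lambda>y. p (\<lambda>e. g e y) * N e y + M e y * q (\<lambda>e. h e y)) \<in> poly_functions E'"
        using H1[OF M] H1[OF N]
        by (intro poly_functions.add poly_functions.mult poly_functions_subst[OF mult.hyps(1)]
            poly_functions_subst[OF mult.hyps(2)] assms(3,4)) auto
    next
      fix y
      have "p (\<lambda>e. g e y) * q (\<lambda>e. g e y) - p (\<lambda>e. h e y) * q (\<lambda>e. h e y)
        = p (\<lambda>e. g e y) * (q (\<lambda>e. g e y) - q (\<lambda>e. h e y)) + (p (\<lambda>e. g e y) - p (\<lambda>e. h e y)) * q (\<lambda>e. h e y)"
        by (simp add: algebra_simps)
      also have "\<dots> = p (\<lambda>e. g e y) * (\<Sum>e\<in>E. N e y * (g e y - h e y)) +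
          (\<Sum>e\<in>E. M e y * (g e y - h e y)) * q (\<lambda>e. h e y)"
        unfolding H2[OF M] H2[OF N] ..
      also have "\<dots> = (\<Sum>e\<in>E. (p (\<lambda>e. g e y) * N e y + M e y * q (\<lambda>e. h e y)) * (g e y - h e y))"
        unfolding sum_distrib_left sum_distrib_right sum.distrib[symmetric]
        by (intro sum.cong refl) (simp add: algebra_simps)
      finally show "p (\<lambda>e. g e y) * q (\<lambda>e. g e y) - p (\<lambda>e. h e y) * q (\<lambda>e. h e y)
        = (\<Sum>e\<in>E. (p (\<lambda>e. g e y) * N e y + M e y * q (\<lambda>e. h e y)) * (g e y - h e y))" .
    next
      fix y e assume *: "e \<in> E" "\<forall>e. g e y = h e y"
      have "M e y = partial_deriv e p (\<lambda>e. g e y)" "N e y = partial_deriv e q (\<lambda>e. g e y)"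
        using H3[OF M *(1)] H3[OF N *(1)] *(2) by blast+
      moreover have "(\<lambda>e. h e y) = (\<lambda>e. g e y)" using *(2) by simp
      ultimately show "p (\<lambda>e. g e y) * N e y + M e y * q (\<lambda>e. h e y) =
        partial_deriv e (\<lambda>x. p x * q x) (\<lambda>e. g e y)"
        by (simp only: partial_deriv_mult[OF mult.hyps])
    qed
    then show ?case by blast
  qed
  then obtain M where "H F M" by (rule exE)
  then show thesis using that[of M] H1 H2 H3 by blast
qed

lemma closure_of_zariski:
  assumes "S \<subseteq> coord_space E"
  shows "zariski E closure_of S =
    {y \<in> coord_space E. \<forall>F\<in>poly_functions E. (\<forall>x\<in>S. F x = 0) \<longrightarrow> F y = 0}" (is "_ = ?T")
proof
  have "?T = zero_locus E {F \<in> poly_functions E. \<forall>x\<in>S. F x = 0}"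
    unfolding zero_locus_def by blast
  then have "closedin (zariski E) ?T"
    unfolding closedin_zariski by (intro exI[of _ "{F \<in> poly_functions E. \<forall>x\<in>S. F x = 0}"]) simp
  then show "zariski E closure_of S \<subseteq> ?T"
    using assms by (intro closure_of_minimal) auto
next
  have "closedin (zariski E) (zariski E closure_of S)" by simp
  then obtain P where P: "P \<subseteq> poly_functions E" "zariski E closure_of S = zero_locus E P"
    unfolding closedin_zariski by (elim exE conjE) (rule that)
  have "S \<subseteq> zero_locus E P" using assms unfolding P(2)[symmetric] by (simp add: closure_of_subset)
  then have "\<forall>x\<in>S. p x = 0" if "p \<in> P" for p using that by (auto simp: zero_locus_def)
  then show "?T \<subseteq> zariski E closure_of S" using P(1) unfolding P(2) zero_locus_def by auto
qed

section \<open>Monomial varieties and their tangent spaces\<close>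

lemma sum_function_apply: "(\<Sum>a\<in>A. f a) i = (\<Sum>a\<in>A. f a i)"
  for f :: "'a \<Rightarrow> 'b \<Rightarrow> 'c :: comm_monoid_add"
  by (induction A rule: infinite_finite_induct) auto

lemma coord_space_eq_sum_unit:
  assumes "finite E" "g \<in> coord_space E"
  shows "g = (\<Sum>e\<in>E. (\<lambda>i. g e * (if i = e then 1 else 0)))"
proof
  fix i
  have "(\<Sum>e\<in>E. (\<lambda>i. g e * (if i = e then 1 else 0))) i = (\<Sum>e\<in>E. if i = e then g e else 0)"
    by (simp add: sum_function_apply if_distrib[of "(*) _"] cong: if_cong)
  also have "\<dots> = g i" using assms by (auto simp: coord_space_def)
  finally show "g i = (\<Sum>e\<in>E. (\<lambda>i. g e * (if i = e then 1 else 0))) i" by simp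
qed

text \<open>A basis of \<open>S\<close> together with \<open>f\<close> is independent, so some
  functional kills \<open>S\<close> and is 1 at \<open>f\<close>; finiteness of \<open>E\<close>
  turns it into a coefficient vector. Subspaces are used below through such annihilators, because
  membership of a varying point then becomes a system of polynomial equations.\<close>

lemma subspace_separation:
  fixes S :: "('i \<Rightarrow> complex) set"
  assumes "finite E" "S \<subseteq> coord_space E" "complex_fun.subspace S" "f \<in> coord_space E" "f \<notin> S"
  shows "\<exists>a. (\<forall>g\<in>S. (\<Sum>e\<in>E. a e * g e) = 0) \<and> (\<Sum>e\<in>E. a e * f e) \<noteq> 0"
proof -
  interpret C: vector_space "(*) :: complex \<Rightarrow> complex \<Rightarrow> complex"
    by unfold_locales (auto simp: algebra_simps)
  interpret P: vector_space_pair "\<lambda>(c::complex) (v::'i \<Rightarrow> complex). (\<lambda>i. c * v i)" "(*) :: complex \<Rightarrow> complex \<Rightarrow> complex"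
    by unfold_locales
  obtain B where B: "B \<subseteq> S" "complex_fun.independent B" "S \<subseteq> complex_fun.span B"
    by (rule complex_fun.basis_exists[of S]) (rule that)
  have "complex_fun.span B \<subseteq> S"
    using B(1) assms(3) by (simp add: complex_fun.span_minimal)
  then have "f \<notin> complex_fun.span B" using assms(5) by blast
  then have "complex_fun.independent (insert f B)"
    using B(2) by (simp add: complex_fun.independent_insert)
  from P.linear_independent_extend[OF this, of "\<lambda>x. if x = f then 1 else 0"]
  obtain \<phi> where \<phi>: "Vector_Spaces.linear (\<lambda>c v i. c * v i) (*) \<phi>"
      "\<forall>x\<in>insert f B. \<phi> x = (if x = f then 1 else 0 :: complex)"
    by (elim exE conjE) (rule that)
  have fB: "f \<notin> B" using assms(5) B(1) by blast
  have "\<phi> x = 0" if "x \<in> complex_fun.span B" for x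
    by (rule P.linear_eq_0_on_span[OF \<phi>(1) _ that]) (use fB \<phi>(2) in force)
  then have S0: "\<phi> g = 0" if "g \<in> S" for g using B(3) that by blast
  define a where "a e = \<phi> (\<lambda>i. if i = e then 1 else 0)" for e
  have \<phi>_eq: "\<phi> g = (\<Sum>e\<in>E. a e * g e)" if "g \<in> coord_space E" for g
  proof -
    have "\<phi> g = (\<Sum>e\<in>E. \<phi> (\<lambda>i. g e * (if i = e then 1 else 0)))"
      by (subst coord_space_eq_sum_unit[OF assms(1) that]) (rule P.linear_sum[OF \<phi>(1)])
    also have "\<dots> = (\<Sum>e\<in>E. g e * a e)"
      unfolding a_def using P.linear_scale[OF \<phi>(1)] by simp
    finally show ?thesis by (simp add: mult.commute)
  qed
  have "\<phi> f = 1" using \<phi>(2) by simp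
  then show ?thesis using \<phi>_eq assms(2,4) S0
    by (intro exI[of _ a]) (metis subset_iff zero_neq_one)
qed

lemma common_denominator:
  fixes r :: "'e \<Rightarrow> rat"
  assumes "finite E"
  shows "\<exists>D::int. D > 0 \<and> (\<forall>e\<in>E. \<exists>z::int. of_int D * r e = of_int z)"
  using assms
proof induction
  case (insert e E)
  then obtain D :: int where D: "D > 0" "\<forall>e\<in>E. \<exists>z::int. of_int D * r e = of_int z" by blast
  obtain a b :: int where ab: "r e = of_int a / of_int b" "b > 0"
    by (metis Rat_cases_nonzero Fract_of_int_quotient of_int_0 divide_eq_0_iff zero_less_one)
  show ?case
  proof (rule exI[of _ "D * b"], intro conjI ballI)
    fix e' assume "e' \<in> insert e E"
    then consider "e' = e" | "e' \<in> E" by blast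
    then show "\<exists>z::int. of_int (D * b) * r e' = of_int z"
    proof cases
      case 1 then show ?thesis using ab by (intro exI[of _ "D * a"]) auto
    next
      case 2
      then obtain z :: int where "of_int D * r e' = of_int z" using D(2) by blast
      then have "of_int (D * b) * r e' = of_int (b * z)" by (simp add: algebra_simps)
      then show ?thesis by blast
    qed
  qed (use D(1) ab(2) in auto)
qed (auto intro: exI[of _ 1])

text \<open>The complex kernel of an integer matrix is spanned by integer vectors: expand the coordinates
  of a kernel vector in a basis of the complex numbers over the rationals.\<close>

lemma incidence_image_criterion:
  fixes f :: "'v set \<Rightarrow> complex"
  assumes fin: "finite E" "\<And>e. e \<in> E \<Longrightarrow> finite e" and f: "f \<in> coord_space E"
    and ker: "\<And>a :: 'v set \<Rightarrow> int. (\<And>v. (\<Sum>e | e \<in> E \<and> v \<in> e. a e) = 0) \<Longrightarrow> (\<Sum>e\<in>E. of_int (a e) * f e) = 0"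
  shows "\<exists>s. \<forall>e\<in>E. f e = (\<Sum>v\<in>e. s v)"
proof (rule ccontr)
  assume contr: "\<not> ?thesis"
  define S where "S = {f \<in> coord_space E. \<exists>s. \<forall>e\<in>E. f e = (\<Sum>v\<in>e. s v :: complex)}"
  have "complex_fun.subspace S"
    unfolding complex_fun.subspace_def
  proof (intro conjI ballI allI)
    show "0 \<in> S" by (auto simp: S_def coord_space_def intro!: exI[of _ "\<lambda>_. 0"])
  next
    fix x y assume "x \<in> S" "y \<in> S"
    then obtain s t where "\<forall>e\<in>E. x e = (\<Sum>v\<in>e. s v)" "\<forall>e\<in>E. y e = (\<Sum>v\<in>e. t v)"
      unfolding S_def by blast
    then show "x + y \<in> S" using \<open>x \<in> S\<close> \<open>y \<in> S\<close>
      by (auto simp: S_def coord_space_def sum.distrib intro!: exI[of _ "\<lambda>v. s v + t v"])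
  next
    fix c x assume "x \<in> S"
    then obtain s where "\<forall>e\<in>E. x e = (\<Sum>v\<in>e. s v)" unfolding S_def by blast
    then show "(\<lambda>i. c * x i) \<in> S" using \<open>x \<in> S\<close>
      by (auto simp: S_def coord_space_def sum_distrib_left intro!: exI[of _ "\<lambda>v. c * s v"])
  qed
  moreover have "f \<notin> S" using contr unfolding S_def by blast
  moreover have "S \<subseteq> coord_space E" unfolding S_def by blast
  ultimately obtain a where a: "\<forall>g\<in>S. (\<Sum>e\<in>E. a e * g e) = 0" "(\<Sum>e\<in>E. a e * f e) \<noteq> 0"
    using subspace_separation[OF fin(1) _ _ f] by blast
  have a0: "(\<Sum>e | e \<in> E \<and> v \<in> e. a e) = 0" for v
  proof -
    \<comment> \<open>This is the image of the unit vector at \<open>v\<close>; that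
      \<open>a\<close> annihilates it says that \<open>a\<close> lies in the kernel of the incidence
      matrix.\<close>
    have "(\<lambda>e. if e \<in> E \<and> v \<in> e then 1 else 0) \<in> S"
      unfolding S_def using fin(2)
      by (auto simp: coord_space_def intro!: exI[of _ "\<lambda>u. if u = v then 1 else 0"])
    then have "(\<Sum>e\<in>E. a e * (if e \<in> E \<and> v \<in> e then 1 else 0)) = 0" by (rule bspec[OF a(1)])
    then show ?thesis using fin(1)
      by (simp add: sum.inter_filter[symmetric] if_distrib[of "(*) _"] cong: if_cong)
  qed
  interpret Q: vector_space "\<lambda>(q::rat) (c::complex). of_rat q * c"
    by unfold_locales (auto simp: algebra_simps of_rat_add of_rat_mult)
  define B where "B = Q.extend_basis {}"
  have B: "Q.independent B" "Q.span B = UNIV"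
    unfolding B_def using Q.independent_extend_basis Q.span_extend_basis Q.independent_empty by blast+
  define r where "r b e = Q.representation B (a e) b" for b e
  define B' where "B' = (\<Union>e\<in>E. {b. Q.representation B (a e) b \<noteq> 0})"
  have finB': "finite B'"
    unfolding B'_def using fin(1) Q.finite_representation by auto
  have a_eq: "a e = (\<Sum>b\<in>B'. of_rat (r b e) * b)" if "e \<in> E" for e
  proof -
    have "a e = (\<Sum>b | Q.representation B (a e) b \<noteq> 0. of_rat (Q.representation B (a e) b) * b)"
      using Q.sum_nonzero_representation_eq[OF B(1), of "a e"] B(2) by simp
    also have "\<dots> = (\<Sum>b\<in>B'. of_rat (r b e) * b)"
      unfolding r_def using that finB' by (intro sum.mono_neutral_left) (auto simp: B'_def)
    finally show ?thesis .
  qed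
  \<comment> \<open>Coordinates in the basis \<open>B\<close> are linear over the rationals, so each
    coordinate vector of \<open>a\<close> inherits the kernel relations.\<close>
  have r0: "(\<Sum>e | e \<in> E \<and> v \<in> e. r b e) = 0" for v b
  proof -
    have "(\<Sum>e | e \<in> E \<and> v \<in> e. r b e) = Q.representation B (\<Sum>e | e \<in> E \<and> v \<in> e. a e) b"
      unfolding r_def using B by (subst Q.representation_sum) auto
    then show ?thesis using a0 by (simp add: Q.representation_zero)
  qed
  have "(\<Sum>e\<in>E. a e * f e) = (\<Sum>e\<in>E. \<Sum>b\<in>B'. b * (of_rat (r b e) * f e))"
    by (intro sum.cong refl) (simp add: a_eq sum_distrib_right sum_distrib_left mult_ac)
  also have "\<dots> = (\<Sum>b\<in>B'. b * (\<Sum>e\<in>E. of_rat (r b e) * f e))"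
    by (subst sum.swap) (simp add: sum_distrib_left)
  finally have "\<exists>b\<in>B'. (\<Sum>e\<in>E. of_rat (r b e) * f e) \<noteq> 0"
    using a(2) by (metis (no_types, lifting) mult_zero_right sum.neutral)
  then obtain b where b: "(\<Sum>e\<in>E. of_rat (r b e) * f e) \<noteq> 0" by blast
  obtain D :: int where D: "D > 0" "\<forall>e\<in>E. \<exists>z::int. of_int D * r b e = of_int z"
    using common_denominator[OF fin(1), of "r b"] by blast
  then obtain z :: "'v set \<Rightarrow> int" where z: "\<And>e. e \<in> E \<Longrightarrow> of_int D * r b e = of_int (z e)" by metis
  have "(\<Sum>e | e \<in> E \<and> v \<in> e. z e) = 0" for v
  proof -
    have "(of_int (\<Sum>e | e \<in> E \<and> v \<in> e. z e) :: rat) = of_int D * (\<Sum>e | e \<in> E \<and> v \<in> e. r b e)"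
      by (simp add: z sum_distrib_left)
    then show ?thesis by (simp only: r0 mult_zero_right of_int_eq_0_iff)
  qed
  then have "(\<Sum>e\<in>E. of_int (z e) * f e) = 0" by (rule ker)
  moreover have "(\<Sum>e\<in>E. of_int (z e) * f e) = of_int D * (\<Sum>e\<in>E. of_rat (r b e) * f e)"
  proof -
    have "of_int (z e) = (of_int D * of_rat (r b e) :: complex)" if "e \<in> E" for e
      using arg_cong[OF z[OF that], of "of_rat :: rat \<Rightarrow> complex"] by (simp add: of_rat_mult)
    then show ?thesis by (simp add: sum_distrib_left mult.assoc)
  qed
  ultimately show False using b D(1) by simp
qed

section \<open>The torus action on a monomial variety and its tangent vectors\<close>

definition monomial_map :: "'v set set \<Rightarrow> ('v \<Rightarrow> complex) \<Rightarrow> 'v set \<Rightarrow> complex" where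
  "monomial_map G p = (\<lambda>e. if e \<in> G then \<Prod>v\<in>e. p v else 0)"

definition monomial_variety :: "'v set set \<Rightarrow> ('v set \<Rightarrow> complex) set" where
  "monomial_variety G = zariski G closure_of range (monomial_map G)"

text \<open>The velocity at scale 1 of the torus action that multiplies all edges at
  \<open>v\<close> by a common factor.\<close>

definition star_part :: "'v \<Rightarrow> ('v set \<Rightarrow> complex) \<Rightarrow> 'v set \<Rightarrow> complex" where
  "star_part v y = (\<lambda>e. if v \<in> e then y e else 0)"

lemma monomial_map_in: "monomial_map G p \<in> coord_space G"
  by (simp add: monomial_map_def coord_space_def)

lemma monomial_variety_iff:
  "y \<in> monomial_variety G \<longleftrightarrow> y \<in> coord_space G \<and>
     (\<forall>F\<in>poly_functions G. (\<forall>p. F (monomial_map G p) = 0) \<longrightarrow> F y = 0)"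
  unfolding monomial_variety_def
  by (subst closure_of_zariski) (auto simp: monomial_map_in)

lemma monomial_map_in_variety: "monomial_map G p \<in> monomial_variety G"
  unfolding monomial_variety_iff by (simp add: monomial_map_in)

text \<open>The torus action maps the image of the parametrisation into itself. Substituting it into
  an equation of the image gives another equation of the image, so the closure is preserved as
  well.\<close>

lemma monomial_variety_rescale:
  assumes y: "y \<in> monomial_variety G" and "\<And>e. e \<in> G \<Longrightarrow> finite e"
    and c: "\<And>e. e \<in> G \<Longrightarrow> c e = (\<Prod>v\<in>e. q v)"
  shows "(\<lambda>e. c e * y e) \<in> monomial_variety G"
  unfolding monomial_variety_iff
proof (intro conjI ballI impI)
  show "(\<lambda>e. c e * y e) \<in> coord_space G"
    using y by (simp add: monomial_variety_iff coord_space_def)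
  fix F assume F: "F \<in> poly_functions G" "\<forall>p. F (monomial_map G p) = 0"
  have "(\<lambda>y. F (\<lambda>e. c e * y e)) \<in> poly_functions G"
    by (rule poly_functions_subst[OF F(1)]) (intro poly_functions_cmult poly_functions.coord)
  moreover have "F (\<lambda>e. c e * monomial_map G p e) = 0" for p
  proof -
    have "(\<lambda>e. c e * monomial_map G p e) = monomial_map G (\<lambda>v. q v * p v)"
      by (auto simp: monomial_map_def c prod.distrib)
    then have "F (\<lambda>e. c e * monomial_map G p e) = F (monomial_map G (\<lambda>v. q v * p v))"
      by (rule arg_cong)
    then show ?thesis using spec[OF F(2)] by (rule trans)
  qed
  ultimately show "F (\<lambda>e. c e * y e) = 0"
    using y[unfolded monomial_variety_iff, THEN conjunct2, THEN bspec, of "\<lambda>y. F (\<lambda>e. c e * y e)"]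
    by blast
qed

text \<open>Scaling the edges at \<open>v\<close> by \<open>s\<close> keeps the point in the
  variety. Along this curve the Hadamard expansion of an equation \<open>F\<close> is
  \<open>s - 1\<close> times a polynomial in \<open>s\<close>; that polynomial vanishes for
  \<open>s \<noteq> 1\<close>, hence also at 1, where it is the differential of \<open>F\<close>.
  The argument covers every point of the variety, singular ones included.\<close>

lemma star_part_tangent:
  assumes fin: "finite G" "\<And>e. e \<in> G \<Longrightarrow> finite e" and y: "y \<in> monomial_variety G"
  shows "star_part v y \<in> tangent_space G (monomial_variety G) y"
  unfolding tangent_space_def
proof (intro CollectI conjI ballI)
  show "star_part v y \<in> coord_space G"
    using y by (auto simp: star_part_def monomial_variety_iff coord_space_def)
  fix F assume F: "F \<in> vanishing_ideal G (monomial_variety G)"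
  then have FG: "F \<in> poly_functions G" by (simp add: vanishing_ideal_def)
  let ?c = "\<lambda>s e. if v \<in> e then s else (1::complex)"
  \<comment> \<open>Univariate polynomials are encoded over the one-element index type
    \<open>unit\<close>, so that the Hadamard expansion applies to the curve.\<close>
  let ?g = "\<lambda>e z. (if v \<in> e then z () else 1) * y e"
  let ?h = "\<lambda>e z. y e :: complex"
  obtain M where M: "\<And>e. e \<in> G \<Longrightarrow> M e \<in> poly_functions (UNIV :: unit set)"
    "\<And>z. F (\<lambda>e. ?g e z) - F (\<lambda>e. ?h e z) = (\<Sum>e\<in>G. M e z * (?g e z - ?h e z))"
    "\<And>z e. e \<in> G \<Longrightarrow> (\<And>e. ?g e z = ?h e z) \<Longrightarrow> M e z = partial_deriv e F (\<lambda>e. ?g e z)"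
  proof (rule poly_functions_hadamard[OF FG fin(1), of ?g UNIV ?h])
    show "?g e \<in> poly_functions UNIV" for e
      by (cases "v \<in> e") (auto intro!: poly_functions.intros)
    show "?h e \<in> poly_functions UNIV" for e by (rule poly_functions.const)
  next
    fix M assume M: "\<And>e. e \<in> G \<Longrightarrow> M e \<in> poly_functions (UNIV :: unit set)"
      "\<And>z. F (\<lambda>e. ?g e z) - F (\<lambda>e. ?h e z) = (\<Sum>e\<in>G. M e z * (?g e z - ?h e z))"
      "\<And>z e. e \<in> G \<Longrightarrow> (\<And>e. ?g e z = ?h e z) \<Longrightarrow> M e z = partial_deriv e F (\<lambda>e. ?g e z)"
    show thesis by (rule that[of M, OF M])
  qed
  define N where "N z = (\<Sum>e\<in>G. M e z * star_part v y e)" for z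
  have "N \<in> poly_functions UNIV"
    unfolding N_def by (intro poly_functions_sum poly_functions.mult M poly_functions.const)
  then have "\<exists>q. \<forall>s. N (\<lambda>_. s) = poly q s"
    by (rule poly_functions_curve) (auto intro: exI[of _ "[:0,1:]"])
  then obtain q where q: "\<And>s. N (\<lambda>_. s) = poly q s" by (elim exE) (rule that, simp)
  have "poly q s = 0" if "s \<notin> {1}" for s
  proof -
    have "(\<lambda>e. ?c s e * y e) \<in> monomial_variety G"
      by (rule monomial_variety_rescale[where q = "\<lambda>u. if u = v then s else 1"])
         (use y fin in auto)
    then have "F (\<lambda>e. ?g e (\<lambda>_. s)) = 0" "F y = 0"
      using F y by (auto simp: vanishing_ideal_def)
    then have "(\<Sum>e\<in>G. M e (\<lambda>_. s) * (?g e (\<lambda>_. s) - y e)) = 0"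
      using M(2)[of "\<lambda>_. s"] by simp
    also have "(\<Sum>e\<in>G. M e (\<lambda>_. s) * (?g e (\<lambda>_. s) - y e)) = (s - 1) * N (\<lambda>_. s)"
      unfolding N_def sum_distrib_left by (intro sum.cong) (auto simp: star_part_def algebra_simps)
    finally show ?thesis using that q by simp
  qed
  then have "q = 0" by (intro poly_eq_0_cofinite[of "{1}"]) auto
  then have "N (\<lambda>_. 1) = 0" using q[of 1] by simp
  moreover have "N (\<lambda>_. 1) = (\<Sum>e\<in>G. partial_deriv e F y * star_part v y e)"
    unfolding N_def using M(3)[of _ "\<lambda>_. 1"] by (intro sum.cong) auto
  ultimately show "(\<Sum>e\<in>G. partial_deriv e F y * star_part v y e) = 0" by simp
qed

text \<open>Dividing by \<open>x e\<close> instead of lowering the exponent treats the case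
  \<open>a e = 0\<close> uniformly.\<close>

lemma partial_deriv_prod_power:
  assumes "finite G" "e \<in> G" "x e \<noteq> 0"
  shows "partial_deriv e (\<lambda>y. \<Prod>j\<in>G. y j ^ a j) x = of_nat (a e) * (\<Prod>j\<in>G. x j ^ a j) / x e"
proof -
  let ?C = "\<Prod>j\<in>G - {e}. x j ^ a j"
  have eq: "(\<lambda>z. \<Prod>j\<in>G. (x(e := z)) j ^ a j) = (\<lambda>z. z ^ a e * ?C)"
  proof
    fix z
    have "(\<Prod>j\<in>G. (x(e := z)) j ^ a j) = (x(e := z)) e ^ a e * (\<Prod>j\<in>G - {e}. (x(e := z)) j ^ a j)"
      using assms by (intro prod.remove) auto
    also have "(\<Prod>j\<in>G - {e}. (x(e := z)) j ^ a j) = ?C" by (intro prod.cong) auto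
    finally show "(\<Prod>j\<in>G. (x(e := z)) j ^ a j) = z ^ a e * ?C" by simp
  qed
  have "((\<lambda>z. z ^ a e * ?C) has_field_derivative of_nat (a e) * x e ^ (a e - 1) * ?C) (at (x e))"
    by (auto intro!: derivative_eq_intros)
  then have "partial_deriv e (\<lambda>y. \<Prod>j\<in>G. y j ^ a j) x = of_nat (a e) * x e ^ (a e - 1) * ?C"
    unfolding partial_deriv_def eq by (rule DERIV_imp_deriv)
  also have "\<dots> = of_nat (a e) * (x e ^ a e * ?C) / x e"
    using assms(3) by (cases "a e") auto
  also have "x e ^ a e * ?C = (\<Prod>j\<in>G. x j ^ a j)"
    using assms by (simp add: prod.remove)
  finally show ?thesis .
qed

text \<open>An integer vector \<open>a\<close> in the kernel of the incidence matrix gives a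
  binomial equation of the variety, whose two exponents are the positive and the negative part of
  \<open>a\<close>. Its differential at a point with nonzero coordinates says that \<open>a\<close>
  annihilates \<open>w / x\<close>, and the integral criterion then places \<open>w / x\<close> in
  the image of the incidence map.\<close>

lemma tangent_space_monomial:
  assumes fin: "finite G" "\<And>e. e \<in> G \<Longrightarrow> finite e" and p: "\<And>e v. e \<in> G \<Longrightarrow> v \<in> e \<Longrightarrow> p v \<noteq> 0"
    and w: "w \<in> tangent_space G (monomial_variety G) (monomial_map G p)"
  shows "\<exists>s. \<forall>e\<in>G. w e = monomial_map G p e * (\<Sum>v\<in>e. s v)"
proof -
  define x where "x = monomial_map G p"
  have x0: "x e \<noteq> 0" if "e \<in> G" for e
    using that fin p by (simp add: monomial_map_def x_def)
  have "\<exists>s. \<forall>e\<in>G. (if e \<in> G then w e / x e else 0) = (\<Sum>v\<in>e. s v)"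
  proof (rule incidence_image_criterion)
    fix a :: "'a set \<Rightarrow> int" assume a: "\<And>v. (\<Sum>e | e \<in> G \<and> v \<in> e. a e) = 0"
    define F where "F b y = (\<Prod>e\<in>G. y e ^ b e)" for b and y :: "'a set \<Rightarrow> complex"
    define b1 b2 where "b1 e = nat (a e)" and "b2 e = nat (- a e)" for e
    have FG: "F b \<in> poly_functions G" for b
      unfolding F_def by (intro poly_functions_prod poly_functions_power poly_functions.coord)
    have F_map: "F b (monomial_map G q) = (\<Prod>v\<in>\<Union>G. q v ^ (\<Sum>e | e \<in> G \<and> v \<in> e. b e))" for b q
    proof -
      have "F b (monomial_map G q) = (\<Prod>e\<in>G. \<Prod>v\<in>e. q v ^ b e)"
        unfolding F_def monomial_map_def by (intro prod.cong) (auto simp: prod_power_distrib)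
      also have "\<dots> = (\<Prod>e\<in>G. \<Prod>v\<in>\<Union>G. if v \<in> e then q v ^ b e else 1)"
        using fin by (intro prod.cong refl prod.mono_neutral_cong_left) auto
      also have "\<dots> = (\<Prod>v\<in>\<Union>G. \<Prod>e\<in>G. if v \<in> e then q v ^ b e else 1)" by (rule prod.swap)
      also have "\<dots> = (\<Prod>v\<in>\<Union>G. \<Prod>e | e \<in> G \<and> v \<in> e. q v ^ b e)"
        by (rule prod.cong[OF refl]) (simp only: prod.inter_filter[OF fin(1)])
      finally show ?thesis by (simp add: power_sum)
    qed
    have b12: "(\<Sum>e | e \<in> G \<and> v \<in> e. b1 e) = (\<Sum>e | e \<in> G \<and> v \<in> e. b2 e)" for v
    proof -
      have "int (\<Sum>e | e \<in> G \<and> v \<in> e. b1 e) - int (\<Sum>e | e \<in> G \<and> v \<in> e. b2 e)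
        = (\<Sum>e | e \<in> G \<and> v \<in> e. a e)"
        unfolding of_nat_sum sum_subtractf[symmetric] by (intro sum.cong) (auto simp: b1_def b2_def)
      then show ?thesis unfolding a by linarith
    qed
    have eq: "F b1 (monomial_map G q) = F b2 (monomial_map G q)" for q
      unfolding F_map b12 ..
    let ?F = "\<lambda>y. F b1 y + (-1) * F b2 y"
    have FI: "?F \<in> vanishing_ideal G (monomial_variety G)"
    proof -
      have FG': "?F \<in> poly_functions G" by (intro poly_functions.add poly_functions_cmult FG)
      have "?F y = 0" if "y \<in> monomial_variety G" for y
      proof -
        have "\<forall>q. ?F (monomial_map G q) = 0" using eq by simp
        then show ?thesis
          using that[unfolded monomial_variety_iff, THEN conjunct2, THEN bspec, of ?F] FG' by blast
      qed
      with FG' show ?thesis unfolding vanishing_ideal_def by blast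
    qed
    have "partial_deriv e ?F x = of_int (a e) * F b1 x / x e" if "e \<in> G" for e
    proof -
      have "partial_deriv e ?F x = partial_deriv e (F b1) x + (-1) * partial_deriv e (F b2) x"
        by (subst partial_deriv_add[OF FG poly_functions_cmult[OF FG]],
            subst partial_deriv_mult[OF poly_functions.const FG])
           (simp add: partial_deriv_const)
      also have "\<dots> = (of_nat (b1 e) - of_nat (b2 e)) * F b1 x / x e"
        using eq[of p] partial_deriv_prod_power[of G e x b1, OF fin(1) that]
          partial_deriv_prod_power[of G e x b2, OF fin(1) that] x0[OF that]
        unfolding F_def x_def[symmetric] by (simp add: diff_divide_distrib algebra_simps)
      also have "of_nat (b1 e) - of_nat (b2 e) = (of_int (a e) :: complex)"
        unfolding b1_def b2_def by (cases "a e \<ge> 0") auto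
      finally show ?thesis .
    qed
    then have "(\<Sum>e\<in>G. (of_int (a e) * F b1 x / x e) * w e) = (\<Sum>e\<in>G. partial_deriv e ?F x * w e)"
      by (intro sum.cong) auto
    also have "\<dots> = 0"
      using w FI unfolding tangent_space_def x_def[symmetric] by blast
    finally have "(\<Sum>e\<in>G. (of_int (a e) * F b1 x / x e) * w e) = 0" .
    then have "F b1 x * (\<Sum>e\<in>G. of_int (a e) * (if e \<in> G then w e / x e else 0)) = 0"
      by (simp add: sum_distrib_left algebra_simps)
    moreover have "F b1 x \<noteq> 0" unfolding F_def using fin x0 by simp
    ultimately show "(\<Sum>e\<in>G. of_int (a e) * (if e \<in> G then w e / x e else 0)) = 0" by simp
  qed (use fin in \<open>auto simp: coord_space_def\<close>)
  then obtain s where "\<forall>e\<in>G. w e / x e = (\<Sum>v\<in>e. s v)" by auto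
  then show ?thesis using x0 unfolding x_def[symmetric]
    by (intro exI[of _ s]) (auto simp: field_simps)
qed

section \<open>Dimension of the contact locus\<close>

lemma closedin_zariski_finite:
  assumes "finite A" "A \<subseteq> coord_space E"
  shows "closedin (zariski E) A"
  using assms
proof (induction A)
  case (insert a A)
  have "{a} = zero_locus E ((\<lambda>e x. x e - a e) ` E)"
    using insert.prems by (auto simp: zero_locus_def coord_space_def fun_eq_iff) metis
  moreover have "(\<lambda>e x. x e - a e) ` E \<subseteq> poly_functions E"
    by (auto intro!: poly_functions_diff poly_functions.intros)
  ultimately have "closedin (zariski E) {a}" unfolding closedin_zariski by blast
  moreover have "closedin (zariski E) A" using insert by blast
  ultimately have "closedin (zariski E) ({a} \<union> A)" by (rule closedin_Un)
  then show ?case by simp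
qed simp

lemma irreducible_in_zariski_finite:
  assumes "irreducible_in (zariski E) A" "finite A"
  shows "\<exists>a. A = {a}"
proof -
  obtain a where a: "a \<in> A" using assms(1) unfolding irreducible_in_def by blast
  have sub: "A \<subseteq> coord_space E" using assms(1) unfolding irreducible_in_def by simp
  then have "closedin (zariski E) {a}" "closedin (zariski E) (A - {a})"
    using assms(2) a by (auto intro!: closedin_zariski_finite)
  moreover have "A \<subseteq> {a} \<union> (A - {a})" by blast
  ultimately have "A \<subseteq> {a} \<or> A \<subseteq> A - {a}"
    using assms(1) unfolding irreducible_in_def by blast
  then show ?thesis using a by blast
qed

text \<open>In a chain \<open>C 0 \<subset> C 1 \<subset> C 2\<close> some polynomial vanishes on
  \<open>C 1\<close> but not on \<open>C 2\<close>. On the line it is a nonzero univariate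
  polynomial, so \<open>C 1\<close> is finite and irreducible, hence a single point, and no room is
  left for \<open>C 0\<close>.\<close>

lemma krull_dim_line:
  assumes Z: "\<And>y. y \<in> Z \<Longrightarrow> \<exists>c. y = (\<lambda>e. c * x e)"
  shows "\<not> krull_dim (zariski E) Z \<ge> 2"
proof
  assume "krull_dim (zariski E) Z \<ge> 2"
  then have "\<not> krull_dim (zariski E) Z \<le> enat 1"
    by (metis enat_ord_simps(1) numeral_eq_enat not_less_eq_eq order_trans numeral_2_eq_2 One_nat_def order_refl)
  then obtain n C where n: "\<not> enat n \<le> enat 1"
      and C: "\<forall>i\<le>n. closedin (subtopology (zariski E) Z) (C i) \<and> irreducible_in (zariski E) (C i)"
        "\<forall>i<n. C i \<subset> C (Suc i)"
    unfolding krull_dim_def Sup_le_iff by auto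
  have n2: "n \<ge> 2" using n by simp
  have C12: "C 1 \<subset> C 2" using C(2)[rule_format, of 1] n2 by (simp add: numeral_2_eq_2)
  have C01: "C 0 \<subset> C 1" using C(2)[rule_format, of 0] n2 by simp
  have c1: "closedin (subtopology (zariski E) Z) (C 1)" "irreducible_in (zariski E) (C 1)"
    and c2: "closedin (subtopology (zariski E) Z) (C 2)" "irreducible_in (zariski E) (C 2)"
    and c0: "irreducible_in (zariski E) (C 0)"
    using C(1) n2 by auto
  obtain T where T: "closedin (zariski E) T" "C 1 = T \<inter> Z"
    using c1(1) unfolding closedin_subtopology by blast
  obtain P where P: "P \<subseteq> poly_functions E" "T = zero_locus E P"
    using T(1) unfolding closedin_zariski by (elim exE conjE) (rule that)
  obtain y where y: "y \<in> C 2" "y \<notin> C 1" using C12 by blast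
  have "C 2 \<subseteq> Z" using closedin_subset[OF c2(1)] by simp
  then have "y \<in> Z" using y by blast
  moreover have "y \<in> coord_space E" using c2(2) y(1) unfolding irreducible_in_def by auto
  ultimately obtain F where F: "F \<in> P" "F y \<noteq> 0"
    using y(2) unfolding T(2) P(2) zero_locus_def by blast
  have FE: "F \<in> poly_functions E" using F(1) P(1) by (rule rev_subsetD)
  have "\<exists>q. \<forall>s. F (\<lambda>e. s * x e) = poly q s"
    by (rule poly_functions_curve[OF FE]) (auto intro: exI[of _ "[:0, x _:]"])
  then obtain q where q: "\<And>s. F (\<lambda>e. s * x e) = poly q s" by (elim exE) (rule that, simp)
  have "q \<noteq> 0"
  proof
    assume "q = 0"
    obtain c where "y = (\<lambda>e. c * x e)" using Z[OF \<open>y \<in> Z\<close>] by (rule exE)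
    then have "F y = 0" using q[of c] \<open>q = 0\<close> by simp
    with F(2) show False ..
  qed
  have "C 1 \<subseteq> (\<lambda>s e. s * x e) ` {s. poly q s = 0}"
  proof
    fix w assume w: "w \<in> C 1"
    then have "w \<in> Z" "w \<in> T" using T(2) by auto
    obtain c where c: "w = (\<lambda>e. c * x e)" using Z[OF \<open>w \<in> Z\<close>] by (rule exE)
    have "F w = 0" using \<open>w \<in> T\<close> F(1) unfolding P(2) zero_locus_def by blast
    then have "poly q c = 0" using q[of c] c by simp
    then show "w \<in> (\<lambda>s e. s * x e) ` {s. poly q s = 0}" using c by blast
  qed
  then have "finite (C 1)"
    using poly_roots_finite[OF \<open>q \<noteq> 0\<close>] finite_subset by blast
  then obtain a where "C 1 = {a}" using irreducible_in_zariski_finite[OF c1(2)] by blast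
  then have "C 0 = {}" using C01 by auto
  then show False using c0 unfolding irreducible_in_def by blast
qed

text \<open>The span of the tangent spaces at \<open>x 0, \<dots>, x (d - 1)\<close>, provided all coordinates of these points
  are nonzero.\<close>

definition tangent_sum :: "'v set set \<Rightarrow> nat \<Rightarrow> (nat \<Rightarrow> 'v set \<Rightarrow> complex) \<Rightarrow> ('v set \<Rightarrow> complex) set" where
  "tangent_sum G d x = {f \<in> coord_space G. \<exists>s. \<forall>e\<in>G. f e = (\<Sum>i<d. x i e * (\<Sum>v\<in>e. s i v))}"

lemma subspace_tangent_sum: "complex_fun.subspace (tangent_sum G d x)"
  unfolding complex_fun.subspace_def
proof (intro conjI ballI allI)
  show "0 \<in> tangent_sum G d x"
    by (auto simp: tangent_sum_def coord_space_def intro!: exI[of _ "\<lambda>_ _. 0"])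
next
  fix y z assume y: "y \<in> tangent_sum G d x" and z: "z \<in> tangent_sum G d x"
  obtain s where s: "\<forall>e\<in>G. y e = (\<Sum>i<d. x i e * (\<Sum>v\<in>e. s i v))"
    using y unfolding tangent_sum_def by blast
  obtain t where t: "\<forall>e\<in>G. z e = (\<Sum>i<d. x i e * (\<Sum>v\<in>e. t i v))"
    using z unfolding tangent_sum_def by blast
  have "\<forall>e\<in>G. (y + z) e = (\<Sum>i<d. x i e * (\<Sum>v\<in>e. s i v + t i v))"
    using s t by (simp add: sum.distrib distrib_left)
  moreover have "y + z \<in> coord_space G"
    using y z by (auto simp: tangent_sum_def coord_space_def)
  ultimately show "y + z \<in> tangent_sum G d x"
    unfolding tangent_sum_def by (auto intro: exI[of _ "\<lambda>i v. s i v + t i v"])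
next
  fix c y assume y: "y \<in> tangent_sum G d x"
  obtain s where s: "\<forall>e\<in>G. y e = (\<Sum>i<d. x i e * (\<Sum>v\<in>e. s i v))"
    using y unfolding tangent_sum_def by blast
  have "\<forall>e\<in>G. c * y e = (\<Sum>i<d. x i e * (\<Sum>v\<in>e. c * s i v))"
    using s by (simp add: sum_distrib_left mult_ac)
  moreover have "(\<lambda>i. c * y i) \<in> coord_space G"
    using y by (auto simp: tangent_sum_def coord_space_def)
  ultimately show "(\<lambda>i. c * y i) \<in> tangent_sum G d x"
    unfolding tangent_sum_def by (auto intro: exI[of _ "\<lambda>i v. c * s i v"])
qed

lemma tangent_spaces_span_subset:
  assumes fin: "finite G" "\<And>e. e \<in> G \<Longrightarrow> finite e"
    and p: "\<And>i e v. i < d \<Longrightarrow> e \<in> G \<Longrightarrow> v \<in> e \<Longrightarrow> p i v \<noteq> 0"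
  shows "complex_fun.span (\<Union>i<d. tangent_space G (monomial_variety G) (monomial_map G (p i)))
    \<subseteq> tangent_sum G d (\<lambda>i. monomial_map G (p i))"
proof (rule complex_fun.span_minimal[OF _ subspace_tangent_sum], rule UN_least)
  fix i assume i: "i \<in> {..<d}"
  show "tangent_space G (monomial_variety G) (monomial_map G (p i))
    \<subseteq> tangent_sum G d (\<lambda>i. monomial_map G (p i))"
  proof
    fix w assume w: "w \<in> tangent_space G (monomial_variety G) (monomial_map G (p i))"
    have "\<exists>s. \<forall>e\<in>G. w e = monomial_map G (p i) e * (\<Sum>v\<in>e. s v)"
      by (rule tangent_space_monomial[OF fin _ w]) (use p i in auto)
    then obtain s where s: "\<forall>e\<in>G. w e = monomial_map G (p i) e * (\<Sum>v\<in>e. s v)" by (rule exE)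
    have "\<forall>e\<in>G. w e = (\<Sum>j<d. monomial_map G (p j) e * (\<Sum>v\<in>e. if j = i then s v else 0))"
    proof
      fix e assume "e \<in> G"
      have "(\<Sum>j<d. monomial_map G (p j) e * (\<Sum>v\<in>e. if j = i then s v else 0))
        = (\<Sum>j<d. if j = i then monomial_map G (p i) e * (\<Sum>v\<in>e. s v) else 0)"
        by (intro sum.cong) auto
      also have "\<dots> = monomial_map G (p i) e * (\<Sum>v\<in>e. s v)" using i by simp
      finally show "w e = (\<Sum>j<d. monomial_map G (p j) e * (\<Sum>v\<in>e. if j = i then s v else 0))"
        using s \<open>e \<in> G\<close> by simp
    qed
    then show "w \<in> tangent_sum G d (\<lambda>i. monomial_map G (p i))"
      using w unfolding tangent_sum_def tangent_space_def
      by (auto intro: exI[of _ "\<lambda>j v. if j = i then s v else 0"])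
  qed
qed

text \<open>The linear conditions below cut out, inside the variety, a closed set containing the contact
  locus; at the chosen point its Zariski tangent space is a line by assumption. Clearing
  denominators in the linear algebra shows that a whole Zariski neighbourhood is contained in the line.\<close>

lemma contact_locus_component_dim:
  fixes p :: "nat \<Rightarrow> 'v \<Rightarrow> complex"
  assumes fin: "finite G" "\<And>e. e \<in> G \<Longrightarrow> finite e" and W: "\<And>e. e \<in> G \<Longrightarrow> card (e \<inter> W) = 1"
    and p: "\<And>i e v. i < d \<Longrightarrow> e \<in> G \<Longrightarrow> v \<in> e \<Longrightarrow> p i v \<noteq> 0" and i0: "i0 < d"
    and x_eq: "\<And>i. i < d \<Longrightarrow> x i = monomial_map G (p i)"
    and good: "\<And>s. (\<And>v. star_part v (\<lambda>e. if e \<in> G then x i0 e * (\<Sum>v\<in>e. s v) else 0) \<in> tangent_sum G d x)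
      \<Longrightarrow> \<exists>c. \<forall>e\<in>G. (\<Sum>v\<in>e. s v) = c"
    and Z: "irreducible_component_of (zariski G) (contact_locus G (monomial_variety G) d x) Z"
    and xZ: "x i0 \<in> Z"
  shows "\<not> krull_dim (zariski G) Z \<ge> 2"
proof -
  let ?V = "monomial_variety G"
  \<comment> \<open>Through the annihilator, containment in \<open>tangent_sum\<close> becomes the
    vanishing of linear forms in the point.\<close>
  define A where "A = {a. \<forall>g\<in>tangent_sum G d x. (\<Sum>e\<in>G. a e * g e) = 0}"
  have x_i0: "x i0 = monomial_map G (p i0)" using x_eq i0 .
  have span: "complex_fun.span (\<Union>i<d. tangent_space G ?V (x i)) \<subseteq> tangent_sum G d x"
  proof -
    have "complex_fun.span (\<Union>i<d. tangent_space G ?V (monomial_map G (p i)))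
      \<subseteq> tangent_sum G d (\<lambda>i. monomial_map G (p i))"
      by (rule tangent_spaces_span_subset[OF fin]) (use p in auto)
    moreover have "(\<Union>i<d. tangent_space G ?V (x i)) = (\<Union>i<d. tangent_space G ?V (monomial_map G (p i)))"
      by (intro SUP_cong) (auto simp: x_eq)
    moreover have "tangent_sum G d x = tangent_sum G d (\<lambda>i. monomial_map G (p i))"
      unfolding tangent_sum_def by (simp add: x_eq)
    ultimately show ?thesis by simp
  qed
  have tsub: "tangent_sum G d x \<subseteq> coord_space G" unfolding tangent_sum_def by blast
  have A_iff: "f \<in> tangent_sum G d x" if "f \<in> coord_space G" "\<And>a. a \<in> A \<Longrightarrow> (\<Sum>e\<in>G. a e * f e) = 0" for f
  proof (rule ccontr)
    assume "f \<notin> tangent_sum G d x"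
    from subspace_separation[OF fin(1) tsub subspace_tangent_sum that(1) this]
    obtain a where "\<forall>g\<in>tangent_sum G d x. (\<Sum>e\<in>G. a e * g e) = 0" "(\<Sum>e\<in>G. a e * f e) \<noteq> 0"
      by (elim exE conjE) (rule that)
    then show False using that(2)[of a] unfolding A_def by blast
  qed
  define Q where "Q = (\<lambda>(a, v) y. \<Sum>e\<in>G. a e * star_part v y e) ` (A \<times> UNIV)"
  have Q: "Q \<subseteq> poly_functions G"
  proof
    fix q assume "q \<in> Q"
    then obtain a v where q: "q = (\<lambda>y. \<Sum>e\<in>G. a e * star_part v y e)" unfolding Q_def by auto
    have "(\<lambda>y. star_part v y e) \<in> poly_functions G" if "e \<in> G" for e
      using that by (cases "v \<in> e") (auto simp: star_part_def intro: poly_functions.intros)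
    then show "q \<in> poly_functions G"
      unfolding q by (intro poly_functions_sum poly_functions_cmult)
  qed
  define L where "L = ?V \<inter> zero_locus G Q"
  have L: "(\<Sum>e\<in>G. a e * star_part v y e) = 0" if "y \<in> L" "a \<in> A" for a v y
    using that unfolding L_def zero_locus_def Q_def by auto
  have closedV: "closedin (zariski G) ?V" unfolding monomial_variety_def by simp
  have closedL: "closedin (zariski G) L"
    unfolding L_def using Q by (intro closedin_Int closedV) (auto simp: closedin_zariski)
  have "contact_locus G ?V d x \<subseteq> L"
    unfolding contact_locus_def
  proof (rule closure_of_minimal[OF _ closedL], rule subsetI)
    fix y assume y: "y \<in> {y \<in> ?V. tangent_space G ?V y \<subseteq> complex_fun.span (\<Union>i<d. tangent_space G ?V (x i))}"
    have "star_part v y \<in> tangent_sum G d x" for v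
    proof -
      have "star_part v y \<in> tangent_space G ?V y" using star_part_tangent[OF fin] y by blast
      then have "star_part v y \<in> complex_fun.span (\<Union>i<d. tangent_space G ?V (x i))" using y by blast
      then show ?thesis using span by blast
    qed
    then have "q y = 0" if "q \<in> Q" for q using that unfolding Q_def A_def by auto
    then show "y \<in> L" unfolding L_def zero_locus_def using y by (auto simp: monomial_variety_iff)
  qed
  moreover have "Z \<subseteq> contact_locus G ?V d x"
    using Z unfolding irreducible_component_of_def by blast
  ultimately have ZL: "Z \<subseteq> L" by blast
  have irr: "irreducible_in (zariski G) Z" using Z unfolding irreducible_component_of_def by blast
  show ?thesis
  proof (cases "G = {}")
    case True
    have "\<exists>c. y = (\<lambda>e. c * 0)" if "y \<in> Z" for y
    proof -
      have "y \<in> coord_space G" using irr that unfolding irreducible_in_def by auto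
      then show ?thesis using True by (auto simp: coord_space_def)
    qed
    then show ?thesis by (rule krull_dim_line)
  next
    case False
    then obtain e0 where e0: "e0 \<in> G" by blast
    \<comment> \<open>A point \<open>y\<close> of \<open>coord_space G\<close> lies on the line
      through \<open>x i0\<close> exactly when \<open>c * y e = y e0 * x i0 e\<close> for all
      \<open>e\<close>. This form involves no division by \<open>y e0\<close>.\<close>
    define c where "c = x i0 e0"
    have x0: "x i0 e \<noteq> 0" if "e \<in> G" for e
      using that fin p i0 by (simp add: x_i0 monomial_map_def)
    have c0: "c \<noteq> 0" unfolding c_def using x0 e0 .
    have xV: "x i0 \<in> ?V" unfolding x_i0 by (rule monomial_map_in_variety)
    have prodW: "(\<Prod>v\<in>e. if v \<in> W then r else 1) = r" if "e \<in> G" for e and r :: complex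
    proof -
      have "(\<Prod>v\<in>e. if v \<in> W then r else 1) = (\<Prod>v\<in>e \<inter> W. r)"
        using fin(2)[OF that] by (rule prod.inter_restrict[symmetric])
      then show ?thesis using W[OF that] by simp
    qed
    have cone: "(\<lambda>e. r * y e) \<in> ?V" if "y \<in> ?V" for r y
      by (rule monomial_variety_rescale[where q = "\<lambda>v. if v \<in> W then r else 1"])
         (use that fin prodW in auto)
    define I where "I = vanishing_ideal G ?V"
    \<comment> \<open>Both multiples compared here lie in the variety by \<open>cone\<close>. An
      equation \<open>F\<close> thus gives a linear relation on their difference, with coefficients
      polynomial in \<open>y\<close> that at \<open>x i0\<close> are the partial derivatives of
      \<open>F\<close> at the point \<open>c * x i0\<close>.\<close>
    define H where "H F M \<longleftrightarrow> (\<forall>e\<in>G. M e \<in> poly_functions G) \<and>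
      (\<forall>y. F (\<lambda>e. c * y e) - F (\<lambda>e. y e0 * x i0 e) = (\<Sum>e\<in>G. M e y * (c * y e - y e0 * x i0 e))) \<and>
      (\<forall>e\<in>G. M e (x i0) = partial_deriv e F (\<lambda>e. c * x i0 e))" for F M
    have "\<exists>M. H F M" if "F \<in> I" for F
    proof -
      have FG: "F \<in> poly_functions G" using that unfolding I_def vanishing_ideal_def by blast
      obtain M where M: "\<And>e. e \<in> G \<Longrightarrow> M e \<in> poly_functions G"
        "\<And>y. F (\<lambda>e. c * y e) - F (\<lambda>e. y e0 * x i0 e) = (\<Sum>e\<in>G. M e y * (c * y e - y e0 * x i0 e))"
        "\<And>y e. e \<in> G \<Longrightarrow> (\<And>e. c * y e = y e0 * x i0 e) \<Longrightarrow> M e y = partial_deriv e F (\<lambda>e. c * y e)"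
      proof (rule poly_functions_hadamard[OF FG fin(1), of "\<lambda>e y. c * y e" G "\<lambda>e y. y e0 * x i0 e"])
        show "(\<lambda>y. c * y e) \<in> poly_functions G" if "e \<in> G" for e
          using that by (intro poly_functions_cmult poly_functions.coord)
        show "(\<lambda>y. y e0 * x i0 e) \<in> poly_functions G" for e
          by (intro poly_functions.mult poly_functions.const poly_functions.coord e0)
      next
        fix M assume M: "\<And>e. e \<in> G \<Longrightarrow> M e \<in> poly_functions G"
        "\<And>y. F (\<lambda>e. c * y e) - F (\<lambda>e. y e0 * x i0 e) = (\<Sum>e\<in>G. M e y * (c * y e - y e0 * x i0 e))"
        "\<And>y e. e \<in> G \<Longrightarrow> (\<And>e. c * y e = y e0 * x i0 e) \<Longrightarrow> M e y = partial_deriv e F (\<lambda>e. c * y e)"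
        show thesis by (rule that[of M, OF M])
      qed
      then have "H F M" unfolding H_def by (auto simp: c_def)
      then show ?thesis by (intro exI[of _ M]) simp
    qed
    then have "\<forall>F\<in>I. \<exists>M. H F M" by blast
    from bchoice[OF this] obtain M where MH: "\<forall>F\<in>I. H F (M F)" by (rule exE)
    have M: "\<And>F e. F \<in> I \<Longrightarrow> e \<in> G \<Longrightarrow> M F e \<in> poly_functions G"
      "\<And>F y. F \<in> I \<Longrightarrow> F (\<lambda>e. c * y e) - F (\<lambda>e. y e0 * x i0 e) = (\<Sum>e\<in>G. M F e y * (c * y e - y e0 * x i0 e))"
      "\<And>F e. F \<in> I \<Longrightarrow> e \<in> G \<Longrightarrow> M F e (x i0) = partial_deriv e F (\<lambda>e. c * x i0 e)"
      using MH unfolding H_def by simp_all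
    \<comment> \<open>The rows say that a vector is tangent to the variety, vanishes at
      \<open>e0\<close> and satisfies the contact conditions. There may be infinitely many rows, but
      elimination extracts one polynomial \<open>h\<close> that serves them all.\<close>
    define R where "R = M ` I \<union> {\<lambda>e _. if e = e0 then 1 else 0} \<union>
      (\<lambda>(a, v) e _. if v \<in> e then a e else 0) ` (A \<times> (UNIV :: 'v set))"
    have R_iff: "(\<forall>N\<in>R. (\<Sum>e\<in>G. N e y * t e) = 0) \<longleftrightarrow>
      (\<forall>F\<in>I. (\<Sum>e\<in>G. M F e y * t e) = 0) \<and> t e0 = 0 \<and> (\<forall>a\<in>A. \<forall>v. (\<Sum>e\<in>G. a e * star_part v t e) = 0)" for y t
    proof -
      have "(\<Sum>e\<in>G. (if e = e0 then 1 else 0) * t e) = t e0"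
        using fin(1) e0 by (simp add: if_distrib[of "\<lambda>z. z * _"] cong: if_cong)
      moreover have "(\<Sum>e\<in>G. (if v \<in> e then a e else 0) * t e) = (\<Sum>e\<in>G. a e * star_part v t e)" for a v
        by (intro sum.cong) (auto simp: star_part_def)
      ultimately show ?thesis unfolding R_def by (simp add: ball_Un split_beta) blast
    qed
    have elim: "\<exists>h\<in>poly_functions G. h (x i0) \<noteq> 0 \<and>
      (\<forall>y t. (\<forall>N\<in>R. (\<Sum>e\<in>G. N e y * t e) = 0) \<longrightarrow> (\<forall>e\<in>G. h y * t e = 0))"
    proof (rule poly_kernel_elimination[OF fin(1)])
      fix N e assume "N \<in> R" "e \<in> G"
      then show "N e \<in> poly_functions G"
        unfolding R_def using M(1) by (auto intro: poly_functions.const)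
    next
      fix t assume "\<And>N. N \<in> R \<Longrightarrow> (\<Sum>e\<in>G. N e (x i0) * t e) = 0"
      then have t: "\<And>F. F \<in> I \<Longrightarrow> (\<Sum>e\<in>G. M F e (x i0) * t e) = 0" "t e0 = 0"
        "\<And>a v. a \<in> A \<Longrightarrow> (\<Sum>e\<in>G. a e * star_part v t e) = 0"
        using R_iff[of "x i0" t] by blast+
      define w where "w e = (if e \<in> G then t e else 0)" for e
      have wG: "w \<in> coord_space G" by (simp add: w_def coord_space_def)
      \<comment> \<open>Scaling the vertices of \<open>W\<close>, one in each edge, turns a
        parameter of \<open>x i0\<close> into one of \<open>c * x i0\<close>, the point at which
        tangency is known.\<close>
      define p' where "p' v = (if v \<in> W then c else 1) * p i0 v" for v
      have p'_eq: "monomial_map G p' = (\<lambda>e. c * x i0 e)"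
        unfolding x_i0 p'_def monomial_map_def using prodW by (auto simp: prod.distrib)
      have "w \<in> tangent_space G ?V (\<lambda>e. c * x i0 e)"
        unfolding tangent_space_def
      proof (intro CollectI conjI wG ballI)
        fix F assume "F \<in> vanishing_ideal G ?V"
        then have F: "F \<in> I" unfolding I_def .
        have "(\<Sum>e\<in>G. partial_deriv e F (\<lambda>e. c * x i0 e) * w e) = (\<Sum>e\<in>G. M F e (x i0) * t e)"
          by (intro sum.cong) (auto simp: w_def M(3)[OF F])
        then show "(\<Sum>e\<in>G. partial_deriv e F (\<lambda>e. c * x i0 e) * w e) = 0" using t(1)[OF F] by simp
      qed
      then have "w \<in> tangent_space G ?V (monomial_map G p')" using p'_eq by simp
      then have "\<exists>s. \<forall>e\<in>G. w e = monomial_map G p' e * (\<Sum>v\<in>e. s v)"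
        using p i0 c0 by (intro tangent_space_monomial[OF fin]) (auto simp: p'_def)
      then obtain s where s: "\<forall>e\<in>G. w e = c * x i0 e * (\<Sum>v\<in>e. s v)"
        unfolding p'_eq by (rule exE)
      have w_eq: "w = (\<lambda>e. if e \<in> G then x i0 e * (\<Sum>v\<in>e. c * s v) else 0)"
      proof
        fix e
        show "w e = (if e \<in> G then x i0 e * (\<Sum>v\<in>e. c * s v) else 0)"
        proof (cases "e \<in> G")
          case True
          then show ?thesis using bspec[OF s True] by (simp add: sum_distrib_left[symmetric] mult_ac)
        qed (simp add: w_def)
      qed
      have "star_part v w \<in> tangent_sum G d x" for v
      proof (rule A_iff)
        show "star_part v w \<in> coord_space G" using wG by (simp add: star_part_def coord_space_def)
        fix a assume "a \<in> A"
        have "(\<Sum>e\<in>G. a e * star_part v w e) = (\<Sum>e\<in>G. a e * star_part v t e)"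
          by (intro sum.cong) (auto simp: star_part_def w_def)
        then show "(\<Sum>e\<in>G. a e * star_part v w e) = 0" using t(3)[OF \<open>a \<in> A\<close>] by simp
      qed
      then have "\<exists>b. \<forall>e\<in>G. (\<Sum>v\<in>e. c * s v) = b"
        unfolding w_eq by (rule good)
      then obtain b where b: "\<forall>e\<in>G. (\<Sum>v\<in>e. c * s v) = b" by (rule exE)
      have "w e0 = x i0 e0 * b" unfolding w_eq using e0 b by simp
      moreover have "w e0 = 0" using t(2) e0 by (simp add: w_def)
      ultimately have "b = 0" using x0[OF e0] by simp
      show "\<forall>e\<in>G. t e = 0"
      proof
        fix e assume e: "e \<in> G"
        have "t e = x i0 e * (\<Sum>v\<in>e. c * s v)"
          using fun_cong[OF w_eq, of e] e by (simp only: w_def if_True)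
        then show "t e = 0" using bspec[OF b e] \<open>b = 0\<close> by (simp only: mult_zero_right)
      qed
    qed
    obtain h where h: "h \<in> poly_functions G" "h (x i0) \<noteq> 0"
      "\<forall>y t. (\<forall>N\<in>R. (\<Sum>e\<in>G. N e y * t e) = 0) \<longrightarrow> (\<forall>e\<in>G. h y * t e = 0)"
      using elim by (elim bexE conjE) (rule that)
    \<comment> \<open>Outside the zeros of \<open>h\<close> the conditions force \<open>y\<close>
      onto the line. Irreducibility of \<open>Z\<close> then leaves two alternatives, and
      \<open>h (x i0) \<noteq> 0\<close> excludes the one where \<open>h\<close> vanishes on
      \<open>Z\<close>.\<close>
    have main: "h y * (c * y e - y e0 * x i0 e) = 0" if "y \<in> L" "e \<in> G" for y e
    proof -
      let ?z = "\<lambda>e. c * y e - y e0 * x i0 e"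
      have yV: "y \<in> ?V" using that(1) unfolding L_def by blast
      have "(\<Sum>e\<in>G. M F e y * ?z e) = 0" if "F \<in> I" for F
      proof -
        have "F (\<lambda>e. c * y e) = 0" "F (\<lambda>e. y e0 * x i0 e) = 0"
          using that cone[OF yV] cone[OF xV] unfolding I_def vanishing_ideal_def by blast+
        then show ?thesis using M(2)[OF that, of y] by simp
      qed
      moreover have "?z e0 = 0" by (simp add: c_def)
      moreover have "(\<Sum>e\<in>G. a e * star_part v ?z e) = 0" if "a \<in> A" for a v
      proof -
        have "(\<Sum>e\<in>G. a e * star_part v ?z e)
          = c * (\<Sum>e\<in>G. a e * star_part v y e) - y e0 * (\<Sum>e\<in>G. a e * star_part v (x i0) e)"
          unfolding sum_distrib_left sum_subtractf[symmetric]
          by (intro sum.cong) (auto simp: star_part_def algebra_simps)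
        also have "\<dots> = 0" using L[OF \<open>y \<in> L\<close> that] L[OF _ that] xZ ZL by auto
        finally show ?thesis .
      qed
      ultimately have "\<forall>N\<in>R. (\<Sum>e\<in>G. N e y * ?z e) = 0" unfolding R_iff by blast
      then show ?thesis using h(3)[rule_format, of y ?z] that(2) by blast
    qed
    define P1 where "P1 = (\<lambda>e y. c * y e - y e0 * x i0 e) ` G"
    have P1: "P1 \<subseteq> poly_functions G"
      unfolding P1_def using e0
      by (auto intro!: poly_functions_diff poly_functions_cmult poly_functions.mult poly_functions.const poly_functions.coord)
    have "closedin (zariski G) (zero_locus G {h})" "closedin (zariski G) (zero_locus G P1)"
      using h(1) P1 unfolding closedin_zariski by blast+
    moreover have "Z \<subseteq> zero_locus G {h} \<union> zero_locus G P1"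
    proof
      fix y assume "y \<in> Z"
      then have "y \<in> L" "y \<in> coord_space G" using ZL irr unfolding irreducible_in_def by auto
      then show "y \<in> zero_locus G {h} \<union> zero_locus G P1"
        using main[OF \<open>y \<in> L\<close>] unfolding zero_locus_def P1_def by (cases "h y = 0") auto
    qed
    ultimately have "Z \<subseteq> zero_locus G {h} \<or> Z \<subseteq> zero_locus G P1"
      using irr unfolding irreducible_in_def by blast
    then have ZP: "Z \<subseteq> zero_locus G P1"
      using xZ h(2) unfolding zero_locus_def by auto
    have "\<exists>b. y = (\<lambda>e. b * x i0 e)" if "y \<in> Z" for y
    proof (intro exI[of _ "y e0 / c"] ext)
      fix e
      have y: "y \<in> coord_space G" "\<And>e. e \<in> G \<Longrightarrow> c * y e = y e0 * x i0 e"
        using that ZP unfolding zero_locus_def P1_def by auto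
      show "y e = y e0 / c * x i0 e"
      proof (cases "e \<in> G")
        case True then show ?thesis using y(2)[OF True] c0 by (simp add: field_simps)
      next
        case False then show ?thesis using y(1) by (simp add: coord_space_def x_i0 monomial_map_def)
      qed
    qed
    then show ?thesis by (rule krull_dim_line)
  qed
qed

section \<open>Rigidity and its extension to further vertices\<close>

lemma mem_vertices: "v \<in> vertices k n \<longleftrightarrow> fst v < k \<and> snd v < n"
  by (cases v) (auto simp: vertices_def vertex_class_def)

lemma finite_vertices [simp]: "finite (vertices k n)"
  unfolding vertices_def vertex_class_def by auto

lemma complete_edges_iff:
  "e \<in> complete_edges k n \<longleftrightarrow> e \<subseteq> vertices k n \<and> bij_betw fst e {..<k}"
proof
  assume e: "e \<in> complete_edges k n"
  have sub: "e \<subseteq> vertices k n" and c: "\<And>i. i < k \<Longrightarrow> card (e \<inter> vertex_class n i) = 1"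
    using e unfolding complete_edges_def by auto
  have memV: "fst x < k" "snd x < n" if "x \<in> e" for x
    using subsetD[OF sub that] unfolding mem_vertices by auto
  have mem: "x \<in> e \<inter> vertex_class n (fst x)" if "x \<in> e" for x
    using that memV[OF that] by (cases x) (auto simp: vertex_class_def)
  have "inj_on fst e"
  proof (rule inj_onI)
    fix x y assume xy: "x \<in> e" "y \<in> e" "fst x = fst y"
    have "fst x < k" using memV(1)[OF xy(1)] .
    then obtain z where "e \<inter> vertex_class n (fst x) = {z}" by (rule card_1_singletonE[OF c])
    then show "x = y" using mem[OF xy(1)] mem[OF xy(2)] xy(3) by simp
  qed
  moreover have "fst ` e = {..<k}"
  proof
    show "fst ` e \<subseteq> {..<k}" using memV(1) by auto
    show "{..<k} \<subseteq> fst ` e"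
    proof
      fix i assume "i \<in> {..<k}"
      then have "i < k" by simp
      then obtain z where "e \<inter> vertex_class n i = {z}" by (rule card_1_singletonE[OF c])
      then have "z \<in> e \<inter> vertex_class n i" by blast
      then have "z \<in> e" "fst z = i" by (auto simp: vertex_class_def)
      then show "i \<in> fst ` e" by force
    qed
  qed
  ultimately show "e \<subseteq> vertices k n \<and> bij_betw fst e {..<k}" using sub by (simp add: bij_betw_def)
next
  assume e: "e \<subseteq> vertices k n \<and> bij_betw fst e {..<k}"
  have "card (e \<inter> vertex_class n i) = 1" if i: "i < k" for i
  proof -
    have "i \<in> fst ` e" using e i by (simp add: bij_betw_def)
    then obtain z where z: "z \<in> e" "fst z = i" by auto
    have "e \<inter> vertex_class n i = {z}"
    proof (intro set_eqI iffI)
      fix x assume "x \<in> e \<inter> vertex_class n i"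
      then have "x \<in> e" "fst x = i" by (auto simp: vertex_class_def)
      then show "x \<in> {z}" using e z by (auto simp: bij_betw_def inj_on_def)
    next
      fix x assume "x \<in> {z}"
      then show "x \<in> e \<inter> vertex_class n i"
        using z subsetD[OF conjunct1[OF e] z(1)] by (cases z) (auto simp: vertex_class_def mem_vertices)
    qed
    then show ?thesis by simp
  qed
  then show "e \<in> complete_edges k n" using e unfolding complete_edges_def by auto
qed

lemma edge_bij: "e \<in> complete_edges k n \<Longrightarrow> bij_betw fst e {..<k}"
  by (simp add: complete_edges_iff)

lemma edge_subset: "e \<in> complete_edges k n \<Longrightarrow> e \<subseteq> vertices k n"
  by (simp add: complete_edges_iff)

lemma edge_finite: "e \<in> complete_edges k n \<Longrightarrow> finite e"
  by (rule finite_subset[OF edge_subset finite_vertices])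

lemma edge_card: "e \<in> complete_edges k n \<Longrightarrow> card e = k"
  using bij_betw_same_card[OF edge_bij] by simp

lemma edge_inj: "e \<in> complete_edges k n \<Longrightarrow> u \<in> e \<Longrightarrow> v \<in> e \<Longrightarrow> fst u = fst v \<Longrightarrow> u = v"
  using edge_bij[of e] by (auto simp: bij_betw_def inj_on_def)

lemma edge_vertex_ex:
  assumes "e \<in> complete_edges k n" "c < k"
  obtains v where "v \<in> e" "fst v = c"
proof -
  have "c \<in> fst ` e" using edge_bij[OF assms(1)] assms(2) by (simp add: bij_betw_def)
  then show ?thesis using that by auto
qed

lemma finite_complete_edges [simp]: "finite (complete_edges k n)"
  by (rule finite_subset[of _ "Pow (vertices k n)"]) (auto dest: edge_subset)

lemma edge_sum_class:
  assumes "e \<in> complete_edges k n" "\<And>v. v \<in> e \<Longrightarrow> s v = f (fst v)"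
  shows "(\<Sum>v\<in>e. s v) = (\<Sum>c<k. f c)"
proof -
  have "(\<Sum>v\<in>e. s v) = (\<Sum>v\<in>e. f (fst v))" using assms(2) by (intro sum.cong) auto
  also have "\<dots> = (\<Sum>c<k. f c)" by (rule sum.reindex_bij_betw[OF edge_bij[OF assms(1)]])
  finally show ?thesis .
qed

lemma edge_swap:
  assumes "e \<in> complete_edges k n" "v \<in> e" "u \<in> vertices k n" "fst u = fst v"
  shows "insert u (e - {v}) \<in> complete_edges k n"
proof -
  have inj: "inj_on fst e" and img: "fst ` e = {..<k}"
    using edge_bij[OF assms(1)] by (auto simp: bij_betw_def)
  have nv: "fst v \<notin> fst ` (e - {v})" using inj assms(2) by (auto simp: inj_on_def)
  have "inj_on fst (insert u (e - {v}))"
    unfolding inj_on_insert using inj_on_subset[OF inj, of "e - {v}"] nv assms(4) by auto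
  moreover have "fst ` insert u (e - {v}) = fst ` e"
    using insert_Diff[OF assms(2)] assms(4) by (metis image_insert)
  ultimately show ?thesis
    using edge_subset[OF assms(1)] assms(3) img unfolding complete_edges_iff bij_betw_def by auto
qed

lemma edge_not_subset:
  assumes "e \<in> complete_edges k n" "e' \<in> complete_edges k n" "e \<noteq> e'"
  shows "\<exists>u\<in>e. u \<notin> e'"
proof (rule ccontr)
  assume "\<not> ?thesis"
  then have "e \<subseteq> e'" by blast
  then have "e = e'"
    using card_subset_eq[OF edge_finite[OF assms(2)]] edge_card[OF assms(1)] edge_card[OF assms(2)] by simp
  with assms(3) show False ..
qed

section \<open>Rigidity, the Hessian condition and extension by one vertex\<close>

abbreviation seg :: "(nat \<times> vertex \<Rightarrow> complex) \<Rightarrow> nat \<Rightarrow> vertex set \<Rightarrow> complex" where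
  "seg p i e \<equiv> \<Prod>v\<in>e. p (i, v)"

text \<open>The edges of \<open>G\<close> inside \<open>X\<close> admit only trivial relations between the tangent spaces. Quantifying
  the conclusion over all edges of the complete graph is what makes the induction over \<open>X\<close> work.\<close>

definition rigid_on where
  "rigid_on k n d G X p \<longleftrightarrow> (\<forall>s. (\<forall>e\<in>G. e \<subseteq> X \<longrightarrow> (\<Sum>i<d. seg p i e * (\<Sum>v\<in>e. s i v)) = 0) \<longrightarrow>
     (\<forall>i<d. \<forall>e\<in>complete_edges k n. e \<subseteq> X \<longrightarrow> (\<Sum>v\<in>e. s i v) = 0))"

text \<open>Tangent directions \<open>s\<close> at the point of index \<open>i0\<close> along which the tangent space stays, to first
  order, in the span of all \<open>d\<close> tangent spaces.\<close>

definition hessian_kernel where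
  "hessian_kernel d G p i0 s \<longleftrightarrow> (\<forall>v. \<exists>t. \<forall>e\<in>G.
     (if v \<in> e then seg p i0 e * (\<Sum>u\<in>e. s u) else 0) = (\<Sum>i<d. seg p i e * (\<Sum>u\<in>e. t i u)))"

text \<open>A constant edge sum cannot be excluded: it is the direction of the point itself along
  the cone. For \<open>i0 < d\<close> it satisfies \<open>hessian_kernel\<close>, with
  \<open>t i0\<close> supported at \<open>v\<close>.\<close>

definition hessian_rigid_on where
  "hessian_rigid_on k n d G X p i0 \<longleftrightarrow> (\<forall>s. hessian_kernel d G p i0 s \<longrightarrow>
     (\<exists>c. \<forall>e\<in>complete_edges k n. e \<subseteq> X \<longrightarrow> (\<Sum>v\<in>e. s v) = c))"

text \<open>A square matrix of size \<open>d + 1\<close> is required to be invertible; its columns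
  are the \<open>d\<close> points, read at the chosen edges, and the point of index
  \<open>i0\<close> masked by incidence with \<open>u\<close>. Edges with and without
  \<open>u\<close> are demanded because otherwise the masked column is zero or repeats the column of
  \<open>i0\<close>.\<close>

definition separating where
  "separating k n d p i0 \<longleftrightarrow> (\<forall>E'\<in>Pow (complete_edges k n). \<forall>u\<in>vertices k n. card E' = d + 1 \<and>
     (\<exists>e\<in>E'. u \<in> e) \<and> (\<exists>e\<in>E'. u \<notin> e) \<longrightarrow>
     (\<forall>b0 b. (\<forall>e\<in>E'. b0 * (if u \<in> e then seg p i0 e else 0) + (\<Sum>i<d. b i * seg p i e) = 0) \<longrightarrow>
       b0 = 0 \<and> (\<forall>i<d. b i = 0)))"

text \<open>Exchanging \<open>v\<close> for \<open>u0\<close>, which lies in the same class, gives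
  an edge inside \<open>X\<close>, so all edges from \<open>v\<close> into \<open>X\<close> have the
  same sum. The exchanged edge need not belong to the graph.\<close>

lemma star_sum_constant:
  assumes s: "\<And>e. e \<in> complete_edges k n \<Longrightarrow> e \<subseteq> X \<Longrightarrow> (\<Sum>v\<in>e. s v) = (c :: complex)"
    and X: "X \<subseteq> vertices k n" and u0: "u0 \<in> X" "fst u0 = fst v" "v \<notin> X"
    and e: "e \<in> complete_edges k n" "v \<in> e" "e - {v} \<subseteq> X"
  shows "(\<Sum>u\<in>e. s u) = c + s v - s u0"
proof -
  have "insert u0 (e - {v}) \<in> complete_edges k n" using edge_swap[OF e(1,2)] u0 X by blast
  then have "(\<Sum>u\<in>insert u0 (e - {v}). s u) = c" using s u0 e(3) by simp
  moreover have "u0 \<notin> e - {v}" using edge_inj[OF e(1) _ e(2), of u0] u0 by auto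
  moreover have "(\<Sum>u\<in>e. s u) = s v + (\<Sum>u\<in>e - {v}. s u)"
    using edge_finite[OF e(1)] e(2) by (rule sum.remove)
  ultimately show ?thesis using edge_finite[OF e(1)] by (simp add: algebra_simps)
qed

text \<open>By \<open>star_sum_constant\<close> the new vertex contributes only the unknowns
  \<open>s i v - s i u0\<close>, one per index, and for the Hessian condition also
  \<open>s v - s u0\<close>. The \<open>d + 1\<close> edges into \<open>X\<close> supply as many
  equations, with the matrix of \<open>separating\<close>.\<close>

lemma rigidity_extension:
  assumes G: "G \<subseteq> complete_edges k n" and X: "X \<subseteq> vertices k n" and v: "v \<in> vertices k n - X"
    and cl: "\<And>c. c < k \<Longrightarrow> \<exists>u\<in>X. fst u = c" and d: "d \<ge> 1" and i0: "i0 < d"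
    and deg: "card {e \<in> G. v \<in> e \<and> e - {v} \<subseteq> X} \<ge> d + 1"
    and sep: "separating k n d p i0"
    and rig: "rigid_on k n d G X p" and hes: "hessian_rigid_on k n d G X p i0"
  shows "rigid_on k n d G (insert v X) p \<and> hessian_rigid_on k n d G (insert v X) p i0"
proof -
  let ?K = "complete_edges k n"
  obtain E' where E': "E' \<subseteq> {e \<in> G. v \<in> e \<and> e - {v} \<subseteq> X}" "card E' = d + 1"
    by (rule obtain_subset_with_card_n[OF deg])
  have E'K: "E' \<subseteq> ?K" using E'(1) G by blast
  have E'v: "v \<in> e" "e - {v} \<subseteq> X" "e \<in> G" if "e \<in> E'" for e using E'(1) that by auto
  have "\<exists>e1 e2. e1 \<in> E' \<and> e2 \<in> E' \<and> e1 \<noteq> e2"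
  proof (rule ccontr)
    assume "\<not> ?thesis"
    then have "card E' \<le> 1" by (metis One_nat_def card_eq_0_iff card_le_Suc0_iff_eq le0)
    then show False using E'(2) d by simp
  qed
  then obtain e1 e2 where e12: "e1 \<in> E'" "e2 \<in> E'" "e1 \<noteq> e2" by blast
  \<comment> \<open>The Hessian equation will be used at a vertex that distinguishes two of the
    chosen edges, as \<open>separating\<close> demands.\<close>
  obtain u where u: "u \<in> e1" "u \<notin> e2" using edge_not_subset[of e1 k n e2] e12 E'K by blast
  have uv: "u \<noteq> v" using u(2) E'v(1)[OF e12(2)] by blast
  have uX: "u \<in> X" using u(1) uv E'v(2)[OF e12(1)] by blast
  have uV: "u \<in> vertices k n" using uX X by blast
  have sep': "b0 = 0 \<and> (\<forall>i<d. b i = 0)"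
    if "\<And>e. e \<in> E' \<Longrightarrow> b0 * (if u \<in> e then seg p i0 e else 0) + (\<Sum>i<d. b i * seg p i e) = 0" for b0 b
    using sep[unfolded separating_def] E'K E'(2) uV u e12 that by blast
  have "fst v < k" using v by (simp add: mem_vertices)
  then obtain u0 where u0: "u0 \<in> X" "fst u0 = fst v" using cl by blast
  have star: "(\<Sum>u\<in>e. s u) = c + s v - s u0"
    if "\<And>e. e \<in> ?K \<Longrightarrow> e \<subseteq> X \<Longrightarrow> (\<Sum>v\<in>e. s v) = c" "e \<in> ?K" "v \<in> e" "e - {v} \<subseteq> X" for s e and c :: complex
    by (rule star_sum_constant[OF that(1) X u0 _ that(2-4)]) (use v in auto)
  have rig': "(\<Sum>v\<in>e. s i v) = 0"
    if "\<And>e. e \<in> G \<Longrightarrow> e \<subseteq> X \<Longrightarrow> (\<Sum>i<d. seg p i e * (\<Sum>v\<in>e. s i v)) = 0" "i < d" "e \<in> ?K" "e \<subseteq> X" for s i e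
  proof -
    have "\<forall>e\<in>G. e \<subseteq> X \<longrightarrow> (\<Sum>i<d. seg p i e * (\<Sum>v\<in>e. s i v)) = 0" using that(1) by simp
    from mp[OF spec[OF rig[unfolded rigid_on_def], of s] this] show ?thesis using that(2-4) by simp
  qed
  have sub: "e \<subseteq> X \<or> (v \<in> e \<and> e - {v} \<subseteq> X)" if "e \<subseteq> insert v X" for e using that by blast
  have "rigid_on k n d G (insert v X) p"
    unfolding rigid_on_def
  proof (intro allI impI ballI)
    fix s i e
    assume s: "\<forall>e\<in>G. e \<subseteq> insert v X \<longrightarrow> (\<Sum>i<d. seg p i e * (\<Sum>v\<in>e. s i v)) = 0"
      and i: "i < d" and e: "e \<in> ?K" "e \<subseteq> insert v X"
    have sG: "(\<Sum>i<d. seg p i e * (\<Sum>v\<in>e. s i v)) = 0" if "e \<in> G" "e \<subseteq> insert v X" for e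
      using mp[OF bspec[OF s that(1)] that(2)] .
    have sX: "(\<Sum>v\<in>e. s i v) = 0" if "i < d" "e \<in> ?K" "e \<subseteq> X" for i e
      by (rule rig'[OF _ that]) (rule sG, auto)
    have *: "(\<Sum>u\<in>e. s i u) = 0 + s i v - s i u0" if "i < d" "e \<in> ?K" "v \<in> e" "e - {v} \<subseteq> X" for i e
      by (rule star[OF sX[OF that(1)] that(2-4)])
    \<comment> \<open>The first-order system has only \<open>d\<close> unknowns; the masked column
      gets coefficient 0.\<close>
    have "0 = (0::complex) \<and> (\<forall>i<d. s i v - s i u0 = 0)"
    proof (rule sep')
      fix e assume e: "e \<in> E'"
      have "(\<Sum>i<d. (s i v - s i u0) * seg p i e) = (\<Sum>i<d. seg p i e * (\<Sum>v\<in>e. s i v))"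
        using *[of _ e] E'v[OF e] e E'K by (intro sum.cong) auto
      also have "\<dots> = 0" by (rule sG) (use E'v[OF e] in auto)
      finally show "0 * (if u \<in> e then seg p i0 e else 0) + (\<Sum>i<d. (s i v - s i u0) * seg p i e) = 0" by simp
    qed
    then have b: "s i v - s i u0 = 0" using i by blast
    from sub[OF e(2)] show "(\<Sum>v\<in>e. s i v) = 0"
    proof
      assume "v \<in> e \<and> e - {v} \<subseteq> X"
      then show ?thesis using *[OF i e(1)] b by simp
    qed (rule sX[OF i e(1)])
  qed
  moreover have "hessian_rigid_on k n d G (insert v X) p i0"
    unfolding hessian_rigid_on_def
  proof (intro allI impI)
    fix s assume s: "hessian_kernel d G p i0 s"
    obtain c where "\<forall>e\<in>?K. e \<subseteq> X \<longrightarrow> (\<Sum>v\<in>e. s v) = c"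
      using mp[OF spec[OF hes[unfolded hessian_rigid_on_def]] s] by (rule exE)
    then have c: "\<And>e. e \<in> ?K \<Longrightarrow> e \<subseteq> X \<Longrightarrow> (\<Sum>v\<in>e. s v) = c" by simp
    have starc: "(\<Sum>u\<in>e. s u) = c + s v - s u0" if "e \<in> ?K" "v \<in> e" "e - {v} \<subseteq> X" for e
      by (rule star[OF c that])
    obtain t where "\<forall>e\<in>G.
      (if u \<in> e then seg p i0 e * (\<Sum>u\<in>e. s u) else 0) = (\<Sum>i<d. seg p i e * (\<Sum>u\<in>e. t i u))"
      using spec[OF s[unfolded hessian_kernel_def], of u] by (rule exE)
    then have t: "\<And>e. e \<in> G \<Longrightarrow>
      (if u \<in> e then seg p i0 e * (\<Sum>u\<in>e. s u) else 0) = (\<Sum>i<d. seg p i e * (\<Sum>u\<in>e. t i u))"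
      by (rule bspec)
    \<comment> \<open>Inside \<open>X\<close> the edge sums of \<open>s\<close> equal
      \<open>c\<close>. Subtracting \<open>c\<close> at \<open>u\<close> in the direction of index
      \<open>i0\<close> makes the relation homogeneous there, so that rigidity on \<open>X\<close>
      applies to \<open>t'\<close>.\<close>
    define t' where "t' i w = t i w - (if i = i0 \<and> w = u then c else 0)" for i w
    have t': "(\<Sum>i<d. seg p i e * (\<Sum>w\<in>e. t' i w)) =
      (if u \<in> e then seg p i0 e * ((\<Sum>u\<in>e. s u) - c) else 0)" if e: "e \<in> G" for e
    proof -
      have fin: "finite e" using e G edge_finite by blast
      have t'_sum: "(\<Sum>w\<in>e. t' i w) = (\<Sum>w\<in>e. t i w) - (if i = i0 \<and> u \<in> e then c else 0)" for i
      proof -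
        have "(\<Sum>w\<in>e. if i = i0 \<and> w = u then c else 0) = (if i = i0 \<and> u \<in> e then c else 0)"
          using fin by (cases "i = i0") (auto simp: sum.delta)
        then show ?thesis by (simp add: t'_def sum_subtractf)
      qed
      have "(\<Sum>i<d. seg p i e * (\<Sum>w\<in>e. t' i w)) =
        (\<Sum>i<d. seg p i e * (\<Sum>w\<in>e. t i w)) - (\<Sum>i<d. if i = i0 then (if u \<in> e then seg p i0 e * c else 0) else 0)"
        unfolding sum_subtractf[symmetric] by (intro sum.cong refl) (auto simp: t'_sum right_diff_distrib)
      also have "\<dots> = (if u \<in> e then seg p i0 e * (\<Sum>u\<in>e. s u) else 0) - (if u \<in> e then seg p i0 e * c else 0)"
        unfolding t[OF e, symmetric] using i0 by simp
      finally show ?thesis by (cases "u \<in> e") (simp_all add: right_diff_distrib)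
    qed
    have t'X: "(\<Sum>v\<in>e. t' i v) = 0" if "i < d" "e \<in> ?K" "e \<subseteq> X" for i e
    proof -
      have "(\<Sum>i<d. seg p i e * (\<Sum>w\<in>e. t' i w)) = 0" if "e \<in> G" "e \<subseteq> X" for e
        using t'[OF that(1)] c[of e] that G by auto
      then show ?thesis by (rule rig'[OF _ that])
    qed
    have *: "(\<Sum>u\<in>e. t' i u) = 0 + t' i v - t' i u0" if "i < d" "e \<in> ?K" "v \<in> e" "e - {v} \<subseteq> X" for i e
      by (rule star[OF t'X[OF that(1)] that(2-4)])
    have "- (s v - s u0) = 0 \<and> (\<forall>i<d. t' i v - t' i u0 = 0)"
    proof (rule sep')
      fix e assume e: "e \<in> E'"
      have "(\<Sum>i<d. (t' i v - t' i u0) * seg p i e) = (\<Sum>i<d. seg p i e * (\<Sum>v\<in>e. t' i v))"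
        using *[of _ e] E'v[OF e] e E'K by (intro sum.cong) auto
      also have "\<dots> = (if u \<in> e then seg p i0 e * (s v - s u0) else 0)"
        using t'[OF E'v(3)[OF e]] starc[of e] E'v[OF e] e E'K by auto
      finally have eq: "(\<Sum>i<d. (t' i v - t' i u0) * seg p i e) = (if u \<in> e then seg p i0 e * (s v - s u0) else 0)" .
      show "- (s v - s u0) * (if u \<in> e then seg p i0 e else 0) +
        (\<Sum>i<d. (t' i v - t' i u0) * seg p i e) = 0" unfolding eq by (simp add: algebra_simps)
    qed
    then have "s v = s u0" by simp
    then have "\<forall>e\<in>?K. e \<subseteq> insert v X \<longrightarrow> (\<Sum>v\<in>e. s v) = c"
      using sub c starc by force
    then show "\<exists>c. \<forall>e\<in>?K. e \<subseteq> insert v X \<longrightarrow> (\<Sum>v\<in>e. s v) = c" by blast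
  qed
  ultimately show ?thesis ..
qed

lemma rigidity_percolation:
  assumes G: "G \<subseteq> complete_edges k n" and X: "X \<subseteq> vertices k n"
    and cl: "\<And>c. c < k \<Longrightarrow> \<exists>u\<in>X. fst u = c" and d: "d \<ge> 1" and i0: "i0 < d"
    and sep: "separating k n d p i0"
    and rig: "rigid_on k n d G X p" and hes: "hessian_rigid_on k n d G X p i0"
    and perc: "\<And>Y. X \<subseteq> Y \<Longrightarrow> Y \<subset> vertices k n \<Longrightarrow>
      \<exists>v\<in>vertices k n - Y. card {e \<in> G. v \<in> e \<and> e - {v} \<subseteq> Y} \<ge> d + 1"
  shows "rigid_on k n d G (vertices k n) p \<and> hessian_rigid_on k n d G (vertices k n) p i0"
proof -
  define \<Y> where "\<Y> = {Y. X \<subseteq> Y \<and> Y \<subseteq> vertices k n \<and>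
    rigid_on k n d G Y p \<and> hessian_rigid_on k n d G Y p i0}"
  have "finite \<Y>" unfolding \<Y>_def by (rule finite_subset[of _ "Pow (vertices k n)"]) auto
  moreover have "X \<in> \<Y>" unfolding \<Y>_def using X rig hes by blast
  ultimately obtain Y where Y: "Y \<in> \<Y>" "\<And>Z. Z \<in> \<Y> \<Longrightarrow> Y \<subseteq> Z \<Longrightarrow> Y = Z"
    using finite_has_maximal[of \<Y>] by blast
  have "Y = vertices k n"
  proof (rule ccontr)
    assume "Y \<noteq> vertices k n"
    then have "Y \<subset> vertices k n" "X \<subseteq> Y" using Y(1) unfolding \<Y>_def by auto
    then obtain v where v: "v \<in> vertices k n - Y" "card {e \<in> G. v \<in> e \<and> e - {v} \<subseteq> Y} \<ge> d + 1"
      using perc by blast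
    have "rigid_on k n d G (insert v Y) p \<and> hessian_rigid_on k n d G (insert v Y) p i0"
    proof (rule rigidity_extension[OF G _ v(1) _ d i0 v(2) sep])
      show "\<exists>u\<in>Y. fst u = c" if "c < k" for c using cl[OF that] \<open>X \<subseteq> Y\<close> by blast
    qed (use Y(1) in \<open>auto simp: \<Y>_def\<close>)
    then have "insert v Y \<in> \<Y>" using Y(1) v(1) unfolding \<Y>_def by blast
    then show False using Y(2)[of "insert v Y"] v(1) by blast
  qed
  then show ?thesis using Y(1) unfolding \<Y>_def by blast
qed

lemma poly_functions_seg:
  assumes "i < d" "e \<subseteq> vertices k n"
  shows "(\<lambda>p. seg p i e) \<in> poly_functions ({..<d} \<times> vertices k n)"
  using assms by (intro poly_functions_prod poly_functions.coord) auto

text \<open>The point witnessing genericity: all-ones at the index \<open>i0\<close>, indicator vectors of the remaining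
  edges at the other indices.\<close>

lemma generic_separating:
  assumes i0: "i0 < d"
  shows "generic_point ({..<d} \<times> vertices k n) (\<lambda>p. separating k n d p i0)"
proof -
  let ?K = "complete_edges k n" and ?I = "{..<d} \<times> vertices k n"
  let ?P = "\<lambda>E' u p. card E' = d + 1 \<and> (\<exists>e\<in>E'. u \<in> e) \<and> (\<exists>e\<in>E'. u \<notin> e) \<longrightarrow>
     (\<forall>b0 b. (\<forall>e\<in>E'. b0 * (if u \<in> e then seg p i0 e else 0) + (\<Sum>i<d. b i * seg p i e) = 0) \<longrightarrow>
       b0 = 0 \<and> (\<forall>i<d. b i = 0))"
  have "generic_point ?I (?P E' u)" if E': "E' \<subseteq> ?K" for E' u
  proof (cases "card E' = d + 1 \<and> (\<exists>e\<in>E'. u \<in> e) \<and> (\<exists>e\<in>E'. u \<notin> e)")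
    case False
    have "generic_point ?I (\<lambda>p. (1::complex) \<noteq> 0)"
      by (rule generic_point_poly[where h = "\<lambda>_. 1"]) (auto intro: poly_functions.const)
    then show ?thesis by (rule generic_point_mono) (use False in blast)
  next
    case True
    then obtain e1 e2 where e: "e1 \<in> E'" "u \<in> e1" "e2 \<in> E'" "u \<notin> e2" by blast
    have finE: "finite E'" using True by (simp add: card_ge_0_finite)
    have "e1 \<noteq> e2" using e by blast
    then have "card (E' - {e1, e2}) = card ({..<d} - {i0})"
      using True e i0 finE by (simp add: card_Diff_subset)
    \<comment> \<open>The edges \<open>e1\<close> and \<open>e2\<close>, which differ in incidence
      with \<open>u\<close>, will determine the masked column and the column of \<open>i0\<close>;
      the other \<open>d - 1\<close> edges are matched with the other indices.\<close>
    then obtain f where f: "bij_betw f ({..<d} - {i0}) (E' - {e1, e2})"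
      using finE by (metis bij_betw_iff_card finite_Diff finite_lessThan)
    define p0 :: "nat \<times> vertex \<Rightarrow> complex" where
      "p0 = (\<lambda>(i, v). if i = i0 \<or> v \<in> f i then 1 else 0)"
    have p0_i0: "seg p0 i0 e = 1" for e by (simp add: p0_def)
    have p0_i: "seg p0 i e = (if e = f i then 1 else 0)" if "i < d" "i \<noteq> i0" "e \<in> E'" for i e
    proof (cases "e = f i")
      case False
      have "f i \<in> E'" using bij_betwE[OF f] that by blast
      then have "e \<in> ?K" "f i \<in> ?K" using that E' by auto
      then obtain w where "w \<in> e" "w \<notin> f i" using edge_not_subset[of e k n "f i"] False by blast
      then have "p0 (i, w) = 0" using that(2) by (simp add: p0_def)
      moreover have "finite e" using that E' edge_finite by blast
      ultimately show ?thesis using False \<open>w \<in> e\<close> by (auto simp: prod_zero_iff)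
    qed (simp add: p0_def)
    define M where "M e j p = (case j of None \<Rightarrow> if u \<in> e then seg p i0 e else 0 | Some i \<Rightarrow> seg p i e)"
      for e j and p :: "nat \<times> vertex \<Rightarrow> complex"
    define J where "J = insert None (Some ` {..<d})"
    have sumJ: "(\<Sum>j\<in>J. M e j p * t j) = (if u \<in> e then seg p i0 e else 0) * t None + (\<Sum>i<d. seg p i e * t (Some i))" for e p t
      unfolding J_def M_def by (simp add: sum.reindex)
    have "generic_point ?I (\<lambda>p. \<forall>t. (\<forall>N\<in>M ` E'. (\<Sum>j\<in>J. N j p * t j) = 0) \<longrightarrow> (\<forall>j\<in>J. t j = 0))"
    proof (rule generic_point_injective[where ?p0.0 = p0])
      show "finite J" unfolding J_def by simp
    next
      fix N j assume "N \<in> M ` E'" "j \<in> J"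
      then obtain e where e: "e \<in> E'" "N = M e" by blast
      then have "e \<subseteq> vertices k n" using E' edge_subset by blast
      then have "(\<lambda>p. seg p i e) \<in> poly_functions ?I" if "i < d" for i using that by (rule poly_functions_seg[rotated])
      then show "N j \<in> poly_functions ?I"
        using \<open>j \<in> J\<close> i0 unfolding e(2) M_def J_def by (cases "u \<in> e") (auto intro: poly_functions.const)
    next
      fix t assume t: "\<And>N. N \<in> M ` E' \<Longrightarrow> (\<Sum>j\<in>J. N j p0 * t j) = 0"
      have t': "(if u \<in> e then 1 else 0) * t None + (\<Sum>i<d. seg p0 i e * t (Some i)) = 0" if "e \<in> E'" for e
        using t[of "M e"] that unfolding sumJ p0_i0 by blast
      have sum_eq: "(\<Sum>i<d. seg p0 i e * t (Some i)) = t (Some i0) + (\<Sum>i\<in>{..<d} - {i0}. if e = f i then t (Some i) else 0)"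
        if "e \<in> E'" for e
      proof -
        have "(\<Sum>i<d. seg p0 i e * t (Some i)) = seg p0 i0 e * t (Some i0) + (\<Sum>i\<in>{..<d} - {i0}. seg p0 i e * t (Some i))"
          using i0 by (intro sum.remove) auto
        also have "(\<Sum>i\<in>{..<d} - {i0}. seg p0 i e * t (Some i)) = (\<Sum>i\<in>{..<d} - {i0}. if e = f i then t (Some i) else 0)"
          by (rule sum.cong[OF refl]) (use p0_i that in auto)
        finally show ?thesis by (simp add: p0_i0)
      qed
      have nf: "f i \<noteq> e1" "f i \<noteq> e2" "f i \<in> E'" if "i \<in> {..<d} - {i0}" for i
        using bij_betwE[OF f] that by blast+
      have z: "(\<Sum>i\<in>{..<d} - {i0}. if e = f i then t (Some i) else 0) = 0" if "e = e1 \<or> e = e2" for e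
        by (rule sum.neutral) (use nf that in auto)
      have ti0: "t (Some i0) = 0" using t'[OF e(3), unfolded sum_eq[OF e(3)] z[OF disjI2[OF refl]]] e(4) by simp
      have tN: "t None = 0" using t'[OF e(1), unfolded sum_eq[OF e(1)] z[OF disjI1[OF refl]]] e(2) ti0 by simp
      have ti: "t (Some i) = 0" if i: "i \<in> {..<d} - {i0}" for i
      proof -
        have "(\<Sum>j\<in>{..<d} - {i0}. if f i = f j then t (Some j) else 0) = (\<Sum>j\<in>{..<d} - {i0}. if j = i then t (Some j) else 0)"
          by (rule sum.cong[OF refl]) (use inj_on_eq_iff[OF bij_betw_imp_inj_on[OF f]] i in auto)
        also have "\<dots> = t (Some i)" using i by (subst sum.delta) auto
        finally have eq: "(\<Sum>j\<in>{..<d} - {i0}. if f i = f j then t (Some j) else 0) = t (Some i)" .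
        show ?thesis using t'[OF nf(3)[OF i], unfolded sum_eq[OF nf(3)[OF i]] eq] tN ti0 by simp
      qed
      show "\<forall>j\<in>J. t j = 0" unfolding J_def using tN ti0 ti by auto
    qed
    then show ?thesis
    proof (rule generic_point_mono, intro impI allI)
      fix p b0 b
      assume p: "\<forall>t. (\<forall>N\<in>M ` E'. (\<Sum>j\<in>J. N j p * t j) = 0) \<longrightarrow> (\<forall>j\<in>J. t j = 0)"
        and b: "\<forall>e\<in>E'. b0 * (if u \<in> e then seg p i0 e else 0) + (\<Sum>i<d. b i * seg p i e) = 0"
      let ?t = "\<lambda>j. case j of None \<Rightarrow> b0 | Some i \<Rightarrow> b i"
      have "\<forall>N\<in>M ` E'. (\<Sum>j\<in>J. N j p * ?t j) = 0"
        using b by (auto simp: sumJ mult.commute)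
      then have "\<forall>j\<in>J. ?t j = 0" using p by blast
      then show "b0 = 0 \<and> (\<forall>i<d. b i = 0)" unfolding J_def by auto
    qed
  qed
  then show ?thesis
    unfolding separating_def by (intro generic_point_ball) auto
qed

section \<open>Cores and the decoupled linear systems\<close>

text \<open>Derivative of the Segre coordinate \<open>e\<close> at \<open>p (i, _)\<close> in direction \<open>t\<close>, and the mixed second derivative
  in direction \<open>t\<close> and along the coordinate \<open>w\<close>. Unlike \<open>seg\<close> times a vertex sum, they make sense
  at points with vanishing coordinates.\<close>

definition dseg :: "(nat \<times> vertex \<Rightarrow> complex) \<Rightarrow> nat \<Rightarrow> (vertex \<Rightarrow> complex) \<Rightarrow> vertex set \<Rightarrow> complex" where
  "dseg p i t e = (\<Sum>u\<in>e. t u * (\<Prod>x\<in>e - {u}. p (i, x)))"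

definition d2seg :: "(nat \<times> vertex \<Rightarrow> complex) \<Rightarrow> nat \<Rightarrow> (vertex \<Rightarrow> complex) \<Rightarrow> vertex \<Rightarrow> vertex set \<Rightarrow> complex" where
  "d2seg p i t w e = (if w \<in> e then dseg p i t (e - {w}) else 0)"

lemma dseg_cong: "(\<And>u. u \<in> e \<Longrightarrow> t u = t' u) \<Longrightarrow> dseg p i t e = dseg p i t' e"
  unfolding dseg_def by (intro sum.cong) auto

lemma dseg_scaled:
  assumes "finite e"
  shows "dseg p i (\<lambda>u. p (i, u) * s u) e = seg p i e * (\<Sum>u\<in>e. s u)"
  unfolding dseg_def sum_distrib_left
proof (rule sum.cong[OF refl])
  fix u assume "u \<in> e"
  then have "seg p i e = p (i, u) * (\<Prod>x\<in>e - {u}. p (i, x))" using assms by (simp add: prod.remove)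
  then show "p (i, u) * s u * (\<Prod>x\<in>e - {u}. p (i, x)) = seg p i e * s u" by simp
qed

lemma dseg_cdiv: "dseg p i (\<lambda>u. t u / c) e = dseg p i t e / c"
  unfolding dseg_def by (simp add: sum_divide_distrib)

text \<open>The mixed derivative misses the term \<open>s w\<close> of the truncated tangent vector;
  \<open>generic_core\<close> absorbs the difference into the direction of index
  \<open>i0\<close>.\<close>

lemma d2seg_scaled:
  assumes "finite e"
  shows "p (i, w) * d2seg p i (\<lambda>u. p (i, u) * s u) w e =
    (if w \<in> e then seg p i e * ((\<Sum>u\<in>e. s u) - s w) else 0)"
proof (cases "w \<in> e")
  case True
  then have "seg p i e = p (i, w) * seg p i (e - {w})" "(\<Sum>u\<in>e. s u) = s w + (\<Sum>u\<in>e - {w}. s u)"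
    using assms by (auto simp: prod.remove sum.remove)
  then show ?thesis using True assms by (simp add: d2seg_def dseg_scaled)
qed (simp add: d2seg_def)

section \<open>Derivatives at indicator points of blocks\<close>

definition block_point :: "(vertex \<Rightarrow> nat) \<Rightarrow> nat \<times> vertex \<Rightarrow> complex" where
  "block_point block = (\<lambda>(i, v). if block v = Suc i then 1 else 0)"

text \<open>At an indicator point the product over \<open>e - {u}\<close> survives only if all the
  other vertices lie in the block. The number of vertices of \<open>e\<close> outside the block,
  none, one or more, distinguishes this lemma and the next two.\<close>

lemma dseg_block_all:
  assumes "\<And>u. u \<in> e \<Longrightarrow> block u = Suc i"
  shows "dseg (block_point block) i t e = (\<Sum>u\<in>e. t u)"
  unfolding dseg_def by (intro sum.cong refl) (use assms in \<open>auto simp: block_point_def intro!: prod.neutral\<close>)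

lemma dseg_block_but_one:
  assumes "finite e" "v \<in> e" "block v \<noteq> Suc i" "\<And>u. u \<in> e - {v} \<Longrightarrow> block u = Suc i"
  shows "dseg (block_point block) i t e = t v"
proof -
  have "(\<Prod>x\<in>e - {u}. block_point block (i, x)) = (if u = v then 1 else 0)" if "u \<in> e" for u
  proof (cases "u = v")
    case True
    then show ?thesis using assms(4) by (auto simp: block_point_def intro!: prod.neutral)
  next
    case False
    then have "v \<in> e - {u}" "block_point block (i, v) = 0" using assms by (auto simp: block_point_def)
    then show ?thesis using False assms(1) by (simp add: prod_zero_iff) blast
  qed
  then have "dseg (block_point block) i t e = (\<Sum>u\<in>e. t u * (if u = v then 1 else 0))"
    unfolding dseg_def by (intro sum.cong) auto
  also have "\<dots> = t v" using assms(1,2) by (simp add: if_distrib[of "(*) _"] cong: if_cong)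
  finally show ?thesis .
qed

lemma dseg_block_zero:
  assumes "finite e" "x \<in> e" "y \<in> e" "x \<noteq> y" "block x \<noteq> Suc i" "block y \<noteq> Suc i"
  shows "dseg (block_point block) i t e = 0"
  unfolding dseg_def
proof (rule sum.neutral, rule ballI)
  fix u assume "u \<in> e"
  have "\<exists>z\<in>e - {u}. block_point block (i, z) = 0"
    using assms by (cases "x = u") (auto simp: block_point_def)
  then have "(\<Prod>x\<in>e - {u}. block_point block (i, x)) = 0" using assms(1) by (simp add: prod_zero_iff)
  then show "t u * (\<Prod>x\<in>e - {u}. block_point block (i, x)) = 0" by simp
qed

text \<open>Adding a constant on each class leaves all edge sums unchanged if the constants sum to
  zero. This freedom of dimension \<open>k - 1\<close> is used up by prescribing the value 0 at one
  vertex in each class but class 0.\<close>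

lemma normalize_class_sums:
  fixes s :: "vertex \<Rightarrow> complex"
  assumes k: "k > 0" and b: "\<And>c. c < k \<Longrightarrow> fst (b c) = c"
  shows "\<exists>s'. (\<forall>e\<in>complete_edges k n. (\<Sum>u\<in>e. s' u) = (\<Sum>u\<in>e. s u)) \<and> (\<forall>c. 0 < c \<and> c < k \<longrightarrow> s' (b c) = 0)"
proof -
  define a where "a c = (if c = 0 then - (\<Sum>c\<in>{0<..<k}. s (b c)) else s (b c))" for c
  have "{..<k} = insert 0 {0<..<k}" using k by auto
  then have "(\<Sum>c<k. a c) = a 0 + (\<Sum>c\<in>{0<..<k}. a c)" by simp
  also have "(\<Sum>c\<in>{0<..<k}. a c) = (\<Sum>c\<in>{0<..<k}. s (b c))" by (intro sum.cong) (auto simp: a_def)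
  finally have a0: "(\<Sum>c<k. a c) = 0" by (simp add: a_def)
  show ?thesis
  proof (intro exI[of _ "\<lambda>u. s u - a (fst u)"] conjI ballI allI impI)
    fix e assume "e \<in> complete_edges k n"
    then have "(\<Sum>u\<in>e. a (fst u)) = (\<Sum>c<k. a c)" by (rule edge_sum_class) simp
    then show "(\<Sum>u\<in>e. s u - a (fst u)) = (\<Sum>u\<in>e. s u)" using a0 by (simp add: sum_subtractf)
  next
    fix c assume "0 < c \<and> c < k"
    then show "s (b c) - a (fst (b c)) = 0" using b by (simp add: a_def)
  qed
qed

text \<open>Block \<open>Suc i\<close> is the support of the witness point of index \<open>i\<close>; block \<open>0\<close> lies in none of them.\<close>

locale rigid_core =
  fixes k n d :: nat and G :: "vertex set set" and X :: "vertex set" and block :: "vertex \<Rightarrow> nat"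
  assumes k3: "k \<ge> 3" and GK: "G \<subseteq> complete_edges k n" and XV: "X \<subseteq> vertices k n"
    and kernel: "\<And>\<pi> (\<theta> :: vertex \<Rightarrow> complex) u u'. (\<And>c. \<pi> c \<le> d) \<Longrightarrow>
      (\<And>e. e \<in> G \<Longrightarrow> e \<subseteq> X \<Longrightarrow> (\<And>u. u \<in> e \<Longrightarrow> block u = \<pi> (fst u)) \<Longrightarrow> (\<Sum>u\<in>e. \<theta> u) = 0) \<Longrightarrow>
      u \<in> X \<Longrightarrow> u' \<in> X \<Longrightarrow> fst u = fst u' \<Longrightarrow> block u = \<pi> (fst u) \<Longrightarrow> block u' = \<pi> (fst u) \<Longrightarrow> \<theta> u = \<theta> u'"
    and two_edges: "\<And>\<pi> v. v \<in> X \<Longrightarrow> (\<And>c. \<pi> c \<le> d) \<Longrightarrow> \<exists>e\<in>G. \<exists>e'\<in>G. e \<noteq> e' \<and> v \<in> e \<and> v \<in> e' \<and>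
      e - {v} \<subseteq> X \<and> e' - {v} \<subseteq> X \<and> (\<forall>u\<in>e - {v}. block u = \<pi> (fst u)) \<and> (\<forall>u\<in>e' - {v}. block u = \<pi> (fst u))"
    and base: "\<And>c j. c < k \<Longrightarrow> j \<le> d \<Longrightarrow> \<exists>v\<in>X. fst v = c \<and> block v = j"
begin

abbreviation "p0 \<equiv> block_point block"

lemma edgeD: assumes "e \<in> G" shows "e \<in> complete_edges k n" "finite e" "card e = k"
  using assms GK edge_finite edge_card by auto

lemma class_less: "w \<in> X \<Longrightarrow> fst w < k"
  using subsetD[OF XV] by (simp add: mem_vertices)

text \<open>Since \<open>k \<ge> 3\<close>, an edge with all but one vertex in the block of index \<open>i\<close> has two vertices
  outside any other block, so at the indicator point the equations for different indices decouple.\<close>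

lemma decouple:
  assumes e: "e \<in> G" "v \<in> e" "\<And>u. u \<in> e - {v} \<Longrightarrow> block u = Suc i" and i: "i < d"
  shows "(\<Sum>j<d. dseg p0 j (t j) e) = dseg p0 i (t i) e"
proof -
  have "card (e - {v}) \<ge> 2" using edgeD[OF e(1)] e(2) k3 by simp
  then obtain x y where xy: "x \<in> e - {v}" "y \<in> e - {v}" "x \<noteq> y"
    by (meson card_2_iff' obtain_subset_with_card_n subsetD)
  have "dseg p0 j (t j) e = 0" if "j \<noteq> i" for j
    by (rule dseg_block_zero[of e x y]) (use xy edgeD(2)[OF e(1)] e(3)[OF xy(1)] e(3)[OF xy(2)] that in auto)
  then have "(\<Sum>j<d. dseg p0 j (t j) e) = (\<Sum>j<d. if j = i then dseg p0 i (t i) e else 0)"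
    by (intro sum.cong) auto
  then show ?thesis using i by simp
qed

text \<open>Edges inside block \<open>Suc i\<close> see the sum of \<open>t i\<close>, so
  \<open>kernel\<close> makes \<open>t i\<close> constant on each class of the block. The base
  values kill all classes but class 0, and one more edge kills that one. An edge whose only vertex
  outside the block is \<open>u\<close> sees \<open>t i u\<close> alone.\<close>

lemma rigid_at_block_point:
  assumes b: "\<And>i c. i < d \<Longrightarrow> c < k \<Longrightarrow> b i c \<in> X \<and> fst (b i c) = c \<and> block (b i c) = Suc i"
    and t: "\<And>e. e \<in> G \<Longrightarrow> e \<subseteq> X \<Longrightarrow> (\<Sum>i<d. dseg p0 i (t i) e) = 0"
    and t0: "\<And>i c. i < d \<Longrightarrow> 0 < c \<Longrightarrow> c < k \<Longrightarrow> t i (b i c) = 0"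
    and i: "i < d" and u: "u \<in> X"
  shows "t i u = 0"
proof -
  have eq: "dseg p0 i (t i) e = 0" if "e \<in> G" "v \<in> e" "e \<subseteq> X" "\<And>u. u \<in> e - {v} \<Longrightarrow> block u = Suc i" for e v
    using decouple[OF that(1,2,4) i, of t] t[OF that(1,3)] by simp
  have sum0: "(\<Sum>u\<in>e. t i u) = 0" if e: "e \<in> G" "e \<subseteq> X" "\<And>u. u \<in> e \<Longrightarrow> block u = Suc i" for e
  proof -
    have "e \<noteq> {}" using edgeD(3)[OF e(1)] k3 by auto
    then obtain v where "v \<in> e" by blast
    then show ?thesis using eq[OF e(1) _ e(2), of v] dseg_block_all[of e block i "t i"] e(3) by simp
  qed
  have pos: "t i w = 0" if "w \<in> X" "block w = Suc i" "fst w \<noteq> 0" for w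
  proof -
    have c: "fst w < k" using class_less that(1) .
    have "t i w = t i (b i (fst w))"
      by (rule kernel[of "\<lambda>_. Suc i"]) (use i sum0 that b[OF i c] in auto)
    then show ?thesis using t0[OF i _ c] that(3) by simp
  qed
  obtain e where e: "e \<in> G" "u \<in> e" "e - {u} \<subseteq> X" "\<And>w. w \<in> e - {u} \<Longrightarrow> block w = Suc i"
    using two_edges[OF u, of "\<lambda>_. Suc i"] i by auto
  have eX: "e \<subseteq> X" using e(3) u by blast
  show ?thesis
  proof (cases "block u = Suc i")
    case False
    then show ?thesis
      using eq[OF e(1,2) eX e(4)] dseg_block_but_one[of e u block i "t i", OF edgeD(2)[OF e(1)] e(2) False e(4)] by simp
  next
    case True
    show ?thesis
    proof (cases "fst u = 0")
      case True
      have "t i w = 0" if w: "w \<in> e - {u}" for w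
      proof (rule pos)
        show "fst w \<noteq> 0" using edge_inj[OF edgeD(1)[OF e(1)] _ e(2), of w] w True by auto
      qed (use w e in auto)
      then have "(\<Sum>w\<in>e. t i w) = t i u" using edgeD(2)[OF e(1)] e(2) by (simp add: sum.remove)
      moreover have "(\<Sum>w\<in>e. t i w) = 0" by (rule sum0) (use e eX \<open>block u = Suc i\<close> in auto)
      ultimately show ?thesis by simp
    qed (use pos u True in auto)
  qed
qed

text \<open>For \<open>u\<close> in the block, take edges whose only vertex \<open>w\<close> outside
  the block lies in a fixed other class: they equate the sum of \<open>\<tau>\<close> over
  \<open>e - {w}\<close> with \<open>t w i0 w\<close>, which depends on \<open>w\<close> only. So
  \<open>\<tau>\<close>, replaced by \<open>- t w i0 w\<close> on that class, is a kernel vector and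
  hence constant on the class of \<open>u\<close>. For \<open>u\<close> outside the block, of two
  edges at \<open>u\<close> that differ at \<open>w\<close> the one without \<open>w\<close> gives
  \<open>t w i0 u = 0\<close> and the other \<open>t w i0 u = \<tau> u\<close>.\<close>

lemma hessian_at_block_point:
  assumes b: "\<And>i c. i < d \<Longrightarrow> c < k \<Longrightarrow> b i c \<in> X \<and> fst (b i c) = c \<and> block (b i c) = Suc i"
    and i0: "i0 < d"
    and eq: "\<And>w e. w \<in> X \<Longrightarrow> e \<in> G \<Longrightarrow> e \<subseteq> X \<Longrightarrow> d2seg p0 i0 \<tau> w e = (\<Sum>i<d. dseg p0 i (t w i) e)"
    and \<tau>0: "\<And>c. c < k \<Longrightarrow> \<tau> (b i0 c) = 0" and u: "u \<in> X"
  shows "\<tau> u = 0"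
proof (cases "block u = Suc i0")
  case True
  define c where "c = (if fst u = 0 then 1 else 0 :: nat)"
  have c: "c < k" "c \<noteq> fst u" using k3 by (auto simp: c_def)
  have uk: "fst u < k" using class_less u .
  \<comment> \<open>Block 0 provides vertices off the support of the point even when
    \<open>d = 1\<close>.\<close>
  define \<pi> where "\<pi> = (\<lambda>_. Suc i0)(c := 0)"
  define \<theta> where "\<theta> w = (if fst w = c then - t w i0 w else \<tau> w)" for w
  have "\<theta> u = \<theta> (b i0 (fst u))"
  proof (rule kernel[of \<pi>])
    show "\<pi> c \<le> d" for c using i0 by (simp add: \<pi>_def)
    fix e assume e: "e \<in> G" "e \<subseteq> X" "\<And>w. w \<in> e \<Longrightarrow> block w = \<pi> (fst w)"
    obtain w where w: "w \<in> e" "fst w = c" using edge_vertex_ex[OF edgeD(1)[OF e(1)] c(1)] by blast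
    have nc: "fst x \<noteq> c" if "x \<in> e - {w}" for x
      using edge_inj[OF edgeD(1)[OF e(1)] _ w(1), of x] that w(2) by auto
    have pw: "block w \<noteq> Suc i0" using e(3)[OF w(1)] w(2) by (simp add: \<pi>_def)
    have px: "block x = Suc i0" if "x \<in> e - {w}" for x using e(3)[of x] nc[OF that] that by (simp add: \<pi>_def)
    have "(\<Sum>x\<in>e - {w}. \<tau> x) = d2seg p0 i0 \<tau> w e"
      using w(1) dseg_block_all[of "e - {w}" block i0 \<tau>, OF px] by (simp add: d2seg_def)
    also have "\<dots> = dseg p0 i0 (t w i0) e"
      using eq[of w e] decouple[OF e(1) w(1) px i0, of "t w"] e w by auto
    also have "\<dots> = t w i0 w" by (rule dseg_block_but_one[of e w block i0, OF edgeD(2)[OF e(1)] w(1) pw px])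
    finally have "(\<Sum>x\<in>e - {w}. \<tau> x) = t w i0 w" .
    moreover have "(\<Sum>x\<in>e - {w}. \<theta> x) = (\<Sum>x\<in>e - {w}. \<tau> x)"
      by (intro sum.cong) (use nc in \<open>auto simp: \<theta>_def\<close>)
    moreover have "(\<Sum>x\<in>e. \<theta> x) = \<theta> w + (\<Sum>x\<in>e - {w}. \<theta> x)"
      using edgeD(2)[OF e(1)] w(1) by (rule sum.remove)
    ultimately show "(\<Sum>x\<in>e. \<theta> x) = 0" using w(2) by (simp add: \<theta>_def)
  qed (use u b[OF i0 uk] c True in \<open>auto simp: \<pi>_def\<close>)
  then show ?thesis using c(2) b[OF i0 uk] \<tau>0[OF uk] by (simp add: \<theta>_def split: if_splits)
next
  case False
  obtain e e' where e: "e \<in> G" "e' \<in> G" "e \<noteq> e'" "u \<in> e" "u \<in> e'" "e - {u} \<subseteq> X" "e' - {u} \<subseteq> X"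
    "\<And>w. w \<in> e - {u} \<Longrightarrow> block w = Suc i0" "\<And>w. w \<in> e' - {u} \<Longrightarrow> block w = Suc i0"
    using two_edges[OF u, of "\<lambda>_. Suc i0", OF Suc_leI[OF i0]] by blast
  obtain w where w: "w \<in> e" "w \<notin> e'"
    using edge_not_subset[OF edgeD(1)[OF e(1)] edgeD(1)[OF e(2)] e(3)] by blast
  have wX: "w \<in> X" "w \<noteq> u" "e \<subseteq> X" "e' \<subseteq> X" using w e u by auto
  have t1: "dseg p0 i0 (t w i0) f = t w i0 u" if "f = e \<or> f = e'" for f
    by (rule dseg_block_but_one[where v = u and block = block and i = i0, OF _ _ False]) (use that e edgeD in auto)
  have "t w i0 u = d2seg p0 i0 \<tau> w e'"
    using eq[OF wX(1) e(2) wX(4)] decouple[OF e(2,5) e(9) i0, of "t w"] t1 by auto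
  then have "t w i0 u = 0" using w(2) by (simp add: d2seg_def)
  moreover have "t w i0 u = d2seg p0 i0 \<tau> w e"
    using eq[OF wX(1) e(1) wX(3)] decouple[OF e(1,4) e(8) i0, of "t w"] t1 by auto
  moreover have "d2seg p0 i0 \<tau> w e = dseg p0 i0 \<tau> (e - {w})" using w(1) by (simp add: d2seg_def)
  moreover have "dseg p0 i0 \<tau> (e - {w}) = \<tau> u"
    by (rule dseg_block_but_one[where v = u and block = block and i = i0, OF _ _ False]) (use e(4,8) wX(2) edgeD(2)[OF e(1)] in auto)
  ultimately show ?thesis by simp
qed

text \<open>The equations for all \<open>w\<close> form one polynomial matrix, injective at the
  block point by the two preceding lemmas. The normalised coordinates are left out of the index set
  \<open>J\<close>, since with them the class constants would lie in the kernel.\<close>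

lemma generic_core_system:
  assumes b: "\<And>i c. i < d \<Longrightarrow> c < k \<Longrightarrow> b i c \<in> X \<and> fst (b i c) = c \<and> block (b i c) = Suc i"
    and i0: "i0 < d"
  shows "generic_point ({..<d} \<times> vertices k n) (\<lambda>p. \<forall>\<tau> t.
    (\<forall>c<k. \<tau> (b i0 c) = 0) \<and> (\<forall>w. \<forall>i<d. \<forall>c. 0 < c \<and> c < k \<longrightarrow> t w i (b i c) = 0) \<and>
    (\<forall>w\<in>X. \<forall>e\<in>G. e \<subseteq> X \<longrightarrow> d2seg p i0 \<tau> w e = (\<Sum>i<d. dseg p i (t w i) e)) \<longrightarrow>
    (\<forall>u\<in>X. \<tau> u = 0) \<and> (\<forall>w\<in>X. \<forall>i<d. \<forall>u\<in>X. t w i u = 0))"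
proof -
  define J1 where "J1 = X - b i0 ` {..<k}"
  define J2 where "J2 = {(w, i, u). w \<in> X \<and> i < d \<and> u \<in> X \<and> u \<notin> b i ` {0<..<k}}"
  define J where "J = J1 <+> J2"
  define M where "M e w j p = (case j of
      Inl u \<Rightarrow> if w \<in> e \<and> u \<in> e - {w} then \<Prod>x\<in>e - {w} - {u}. p (i0, x) else 0
    | Inr (w', i, u) \<Rightarrow> if w' = w \<and> u \<in> e then - (\<Prod>x\<in>e - {u}. p (i, x)) else 0)"
    for e w and j :: "vertex + vertex \<times> nat \<times> vertex" and p :: "nat \<times> vertex \<Rightarrow> complex"
  define R where "R = (\<lambda>(e, w). M e w) ` ({e \<in> G. e \<subseteq> X} \<times> X)"
  have finX: "finite X" using XV finite_vertices by (rule finite_subset)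
  have J2sub: "J2 \<subseteq> X \<times> {..<d} \<times> X" unfolding J2_def by auto
  have finJ: "finite J1" "finite J2"
    using finX finite_subset[OF J2sub] unfolding J1_def by auto
  have sumJ: "(\<Sum>j\<in>J. M e w j p * t j) = d2seg p i0 (\<lambda>u. t (Inl u)) w e - (\<Sum>i<d. dseg p i (\<lambda>u. t (Inr (w, i, u))) e)"
    if e: "e \<in> G" "e \<subseteq> X" "w \<in> X" and t: "\<And>j. j \<notin> J \<Longrightarrow> t j = 0" for e w p t
  proof -
    have "(\<Sum>j\<in>J. M e w j p * t j) = (\<Sum>j\<in>X <+> (X \<times> {..<d} \<times> X). M e w j p * t j)"
      by (rule sum.mono_neutral_left) (use finX J2sub t in \<open>auto simp: J_def J1_def\<close>)
    also have "\<dots> = (\<Sum>u\<in>X. M e w (Inl u) p * t (Inl u)) + (\<Sum>(w', i, u)\<in>X \<times> {..<d} \<times> X. M e w (Inr (w', i, u)) p * t (Inr (w', i, u)))"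
      using finX by (subst sum.Plus) (auto simp: split_beta)
    also have "(\<Sum>u\<in>X. M e w (Inl u) p * t (Inl u)) = d2seg p i0 (\<lambda>u. t (Inl u)) w e"
    proof (cases "w \<in> e")
      case True
      have "(\<Sum>u\<in>X. M e w (Inl u) p * t (Inl u)) = (\<Sum>u\<in>e - {w}. M e w (Inl u) p * t (Inl u))"
        by (rule sum.mono_neutral_right) (use finX e in \<open>auto simp: M_def\<close>)
      also have "\<dots> = dseg p i0 (\<lambda>u. t (Inl u)) (e - {w})"
        unfolding dseg_def by (intro sum.cong refl) (use True in \<open>auto simp: M_def\<close>)
      finally show ?thesis using True by (simp add: d2seg_def)
    qed (simp add: M_def d2seg_def)
    also have "(\<Sum>(w', i, u)\<in>X \<times> {..<d} \<times> X. M e w (Inr (w', i, u)) p * t (Inr (w', i, u)))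
      = (\<Sum>w'\<in>X. \<Sum>i<d. \<Sum>u\<in>X. M e w (Inr (w', i, u)) p * t (Inr (w', i, u)))"
      by (simp add: sum.cartesian_product split_beta)
    also have "\<dots> = (\<Sum>w'\<in>X. if w' = w then (\<Sum>i<d. \<Sum>u\<in>X. M e w (Inr (w, i, u)) p * t (Inr (w, i, u))) else 0)"
      by (intro sum.cong refl) (auto simp: M_def)
    also have "\<dots> = (\<Sum>i<d. \<Sum>u\<in>X. M e w (Inr (w, i, u)) p * t (Inr (w, i, u)))"
      using finX e(3) by simp
    also have "\<dots> = (\<Sum>i<d. - dseg p i (\<lambda>u. t (Inr (w, i, u))) e)"
    proof (rule sum.cong[OF refl])
      fix i
      have "(\<Sum>u\<in>X. M e w (Inr (w, i, u)) p * t (Inr (w, i, u))) = (\<Sum>u\<in>e. M e w (Inr (w, i, u)) p * t (Inr (w, i, u)))"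
        by (rule sum.mono_neutral_right) (use finX e in \<open>auto simp: M_def\<close>)
      also have "\<dots> = - dseg p i (\<lambda>u. t (Inr (w, i, u))) e"
        unfolding dseg_def sum_negf[symmetric] by (intro sum.cong refl) (auto simp: M_def)
      finally show "(\<Sum>u\<in>X. M e w (Inr (w, i, u)) p * t (Inr (w, i, u))) = - dseg p i (\<lambda>u. t (Inr (w, i, u))) e" .
    qed
    finally show ?thesis by (simp add: sum_negf)
  qed
  have gen: "generic_point ({..<d} \<times> vertices k n) (\<lambda>p. \<forall>t. (\<forall>N\<in>R. (\<Sum>j\<in>J. N j p * t j) = 0) \<longrightarrow> (\<forall>j\<in>J. t j = 0))"
  proof (rule generic_point_injective[where ?p0.0 = p0])
    show "finite J" unfolding J_def using finJ by simp
  next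
    fix N j assume "N \<in> R" "j \<in> J"
    then obtain e w where N: "N = M e w" "e \<in> G" "e \<subseteq> X" "w \<in> X" unfolding R_def by auto
    have P: "(\<lambda>p. \<Prod>x\<in>f. p (i, x)) \<in> poly_functions ({..<d} \<times> vertices k n)" if "f \<subseteq> X" "i < d" for f i
      using that XV by (intro poly_functions_seg) auto
    show "N j \<in> poly_functions ({..<d} \<times> vertices k n)"
    proof (cases j)
      case (Inl u)
      have "(\<lambda>p. \<Prod>x\<in>e - {w} - {u}. p (i0, x)) \<in> poly_functions ({..<d} \<times> vertices k n)"
        by (rule P) (use N i0 in auto)
      then show ?thesis unfolding N(1) M_def Inl by (cases "w \<in> e \<and> u \<in> e - {w}") (auto intro: poly_functions.const)
    next
      case (Inr j')
      obtain w' i u where j': "j' = (w', i, u)" by (cases j')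
      have "i < d" using \<open>j \<in> J\<close> unfolding Inr j' J_def J2_def by auto
      then have "(\<lambda>p. (-1) * (\<Prod>x\<in>e - {u}. p (i, x))) \<in> poly_functions ({..<d} \<times> vertices k n)"
        using N by (intro poly_functions_cmult P) auto
      then show ?thesis unfolding N(1) M_def Inr j' by (cases "w' = w \<and> u \<in> e") (auto intro: poly_functions.const)
    qed
  next
    fix t0 assume t0: "\<And>N. N \<in> R \<Longrightarrow> (\<Sum>j\<in>J. N j p0 * t0 j) = 0"
    define t where "t j = (if j \<in> J then t0 j else 0)" for j
    have eq: "d2seg p0 i0 (\<lambda>u. t (Inl u)) w e = (\<Sum>i<d. dseg p0 i (\<lambda>u. t (Inr (w, i, u))) e)"
      if "w \<in> X" "e \<in> G" "e \<subseteq> X" for w e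
    proof -
      have "M e w \<in> R" unfolding R_def using that by auto
      then have "(\<Sum>j\<in>J. M e w j p0 * t0 j) = 0" by (rule t0)
      moreover have "(\<Sum>j\<in>J. M e w j p0 * t0 j) = (\<Sum>j\<in>J. M e w j p0 * t j)"
        by (intro sum.cong) (auto simp: t_def)
      moreover have "(\<Sum>j\<in>J. M e w j p0 * t j) =
        d2seg p0 i0 (\<lambda>u. t (Inl u)) w e - (\<Sum>i<d. dseg p0 i (\<lambda>u. t (Inr (w, i, u))) e)"
        by (rule sumJ) (use that in \<open>auto simp: t_def\<close>)
      ultimately show ?thesis by simp
    qed
    have tl: "t (Inl u) = 0" if "u \<in> X" for u
    proof (rule hessian_at_block_point[OF b i0, where \<tau> = "\<lambda>u. t (Inl u)" and t = "\<lambda>w i u. t (Inr (w, i, u))"])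
      show "t (Inl (b i0 c)) = 0" if "c < k" for c
      proof -
        have "b i0 c \<in> b i0 ` {..<k}" using that by blast
        then show ?thesis by (auto simp: t_def J_def J1_def)
      qed
    qed (use eq that in auto)
    have tr: "t (Inr (w, i, u)) = 0" if "w \<in> X" "i < d" "u \<in> X" for w i u
    proof (rule rigid_at_block_point[OF b, where t = "\<lambda>i u. t (Inr (w, i, u))"])
      show "(\<Sum>i<d. dseg p0 i (\<lambda>u. t (Inr (w, i, u))) e) = 0" if e: "e \<in> G" "e \<subseteq> X" for e
      proof -
        have "dseg p0 i0 (\<lambda>u. t (Inl u)) (e - {w}) = dseg p0 i0 (\<lambda>_. 0) (e - {w})"
          using tl e(2) by (intro dseg_cong) auto
        also have "\<dots> = 0" by (simp add: dseg_def)
        finally have "d2seg p0 i0 (\<lambda>u. t (Inl u)) w e = 0" by (simp add: d2seg_def)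
        then show ?thesis using eq[OF \<open>w \<in> X\<close> e] by simp
      qed
      show "t (Inr (w, i, b i c)) = 0" if "0 < c" "c < k" for i c
      proof -
        have "b i c \<in> b i ` {0<..<k}" using that by auto
        then show ?thesis by (auto simp: t_def J_def J2_def)
      qed
    qed (use that in auto)
    show "\<forall>j\<in>J. t0 j = 0"
    proof
      fix j assume j: "j \<in> J"
      then have "t j = 0" unfolding J_def J1_def J2_def using tl tr by auto
      then show "t0 j = 0" using j by (simp add: t_def)
    qed
  qed
  then show ?thesis
  proof (rule generic_point_mono, intro allI impI)
    fix p \<tau> t
    assume inj: "\<forall>t. (\<forall>N\<in>R. (\<Sum>j\<in>J. N j p * t j) = 0) \<longrightarrow> (\<forall>j\<in>J. t j = 0)"
    assume A: "(\<forall>c<k. \<tau> (b i0 c) = 0) \<and> (\<forall>w. \<forall>i<d. \<forall>c. 0 < c \<and> c < k \<longrightarrow> t w i (b i c) = 0) \<and>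
      (\<forall>w\<in>X. \<forall>e\<in>G. e \<subseteq> X \<longrightarrow> d2seg p i0 \<tau> w e = (\<Sum>i<d. dseg p i (t w i) e))"
    define T where "T j = (if j \<in> J then (case j of Inl u \<Rightarrow> \<tau> u | Inr (w, i, u) \<Rightarrow> t w i u) else 0)" for j
    have T1: "T (Inl u) = \<tau> u" if "u \<in> X" for u
      using A that by (auto simp: T_def J_def J1_def)
    have A2: "t w i (b i c) = 0" if "i < d" "0 < c" "c < k" for w i c using A that by blast
    have T2: "T (Inr (w, i, u)) = t w i u" if "u \<in> X" "w \<in> X" "i < d" for w i u
    proof (cases "u \<in> b i ` {0<..<k}")
      case True
      then obtain c where "u = b i c" "0 < c" "c < k" by auto
      then have "t w i u = 0" using A2 that by blast
      moreover have "(w, i, u) \<notin> J2" unfolding J2_def using True by simp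
      then have "Inr (w, i, u) \<notin> J" by (auto simp: J_def)
      ultimately show ?thesis by (simp add: T_def)
    next
      case False
      then have "Inr (w, i, u) \<in> J" using that by (auto simp: J_def J2_def)
      then show ?thesis by (simp add: T_def)
    qed
    have "(\<Sum>j\<in>J. N j p * T j) = 0" if "N \<in> R" for N
    proof -
      obtain e w where N: "N = M e w" "e \<in> G" "e \<subseteq> X" "w \<in> X" using \<open>N \<in> R\<close> unfolding R_def by auto
      have "(\<Sum>j\<in>J. N j p * T j) = d2seg p i0 (\<lambda>u. T (Inl u)) w e - (\<Sum>i<d. dseg p i (\<lambda>u. T (Inr (w, i, u))) e)"
        unfolding N(1) by (rule sumJ) (use N in \<open>auto simp: T_def\<close>)
      also have "dseg p i0 (\<lambda>u. T (Inl u)) (e - {w}) = dseg p i0 \<tau> (e - {w})"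
        using T1 N by (intro dseg_cong) auto
      then have "d2seg p i0 (\<lambda>u. T (Inl u)) w e = d2seg p i0 \<tau> w e" by (simp add: d2seg_def)
      also have "(\<Sum>i<d. dseg p i (\<lambda>u. T (Inr (w, i, u))) e) = (\<Sum>i<d. dseg p i (t w i) e)"
        by (rule sum.cong[OF refl], rule dseg_cong, rule T2) (use N in auto)
      finally show ?thesis using A N by simp
    qed
    then have T0: "\<forall>j\<in>J. T j = 0" using spec[OF inj, of T] by blast
    then have "T j = 0" for j by (cases "j \<in> J") (auto simp: T_def)
    then show "(\<forall>u\<in>X. \<tau> u = 0) \<and> (\<forall>w\<in>X. \<forall>i<d. \<forall>u\<in>X. t w i u = 0)" using T1 T2 by metis
  qed
qed

text \<open>Where no coordinate vanishes, \<open>dseg_scaled\<close> and \<open>d2seg_scaled\<close>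
  translate the system back: directions are multiplied by the coordinates of \<open>p\<close>, and
  the equation at \<open>w\<close> is divided by \<open>p (i0, w)\<close>.\<close>

lemma generic_core:
  assumes i0: "i0 < d"
  shows "generic_point ({..<d} \<times> vertices k n) (\<lambda>p. (\<forall>i<d. \<forall>v\<in>vertices k n. p (i, v) \<noteq> 0) \<longrightarrow>
    rigid_on k n d G X p \<and> hessian_rigid_on k n d G X p i0)"
proof -
  have "\<exists>v. v \<in> X \<and> fst v = c \<and> block v = Suc i" if "i < d" "c < k" for i c
    using base[OF that(2), of "Suc i"] that(1) by auto
  then obtain b where b: "\<And>i c. i < d \<Longrightarrow> c < k \<Longrightarrow> b i c \<in> X \<and> fst (b i c) = c \<and> block (b i c) = Suc i" by metis
  have k0: "k > 0" using k3 by simp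
  show ?thesis
  proof (rule generic_point_mono, rule generic_core_system[OF _ i0], rule b, assumption+, intro impI)
    fix p
    assume sys: "\<forall>\<tau> t. (\<forall>c<k. \<tau> (b i0 c) = 0) \<and> (\<forall>w. \<forall>i<d. \<forall>c. 0 < c \<and> c < k \<longrightarrow> t w i (b i c) = 0) \<and>
      (\<forall>w\<in>X. \<forall>e\<in>G. e \<subseteq> X \<longrightarrow> d2seg p i0 \<tau> w e = (\<Sum>i<d. dseg p i (t w i) e)) \<longrightarrow>
      (\<forall>u\<in>X. \<tau> u = 0) \<and> (\<forall>w\<in>X. \<forall>i<d. \<forall>u\<in>X. t w i u = 0)"
    assume p: "\<forall>i<d. \<forall>v\<in>vertices k n. p (i, v) \<noteq> 0"
    have pX: "p (i, v) \<noteq> 0" if "i < d" "v \<in> X" for i v using p that XV by blast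
    have "\<exists>s'. (\<forall>e\<in>complete_edges k n. (\<Sum>u\<in>e. s' u) = (\<Sum>u\<in>e. s u)) \<and> (\<forall>c. 0 < c \<and> c < k \<longrightarrow> s' (b i c) = 0)"
      if "i < d" for i and s :: "vertex \<Rightarrow> complex"
      by (rule normalize_class_sums[OF k0]) (use b[OF that] in auto)
    then obtain nrm where nrm: "\<And>i s e. i < d \<Longrightarrow> e \<in> complete_edges k n \<Longrightarrow> (\<Sum>u\<in>e. nrm i s u) = (\<Sum>u\<in>e. s u :: complex)"
      "\<And>i s c. i < d \<Longrightarrow> 0 < c \<Longrightarrow> c < k \<Longrightarrow> nrm i s (b i c) = 0" by metis
    have nz: "(\<Sum>i<d. dseg p i (\<lambda>u. p (i, u) * nrm i (s i) u) e) = (\<Sum>i<d. seg p i e * (\<Sum>u\<in>e. s i u))" if "e \<in> G" for s e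
      using nrm(1) edgeD[OF that] by (intro sum.cong refl) (simp add: dseg_scaled)
    have "rigid_on k n d G X p"
      unfolding rigid_on_def
    proof (intro allI impI ballI)
      fix s i e
      assume s: "\<forall>e\<in>G. e \<subseteq> X \<longrightarrow> (\<Sum>i<d. seg p i e * (\<Sum>v\<in>e. s i v)) = 0"
        and i: "i < d" and e: "e \<in> complete_edges k n" "e \<subseteq> X"
      \<comment> \<open>Rigidity is the case \<open>\<tau> = 0\<close> of the system, with
        directions that do not depend on \<open>w\<close>.\<close>
      let ?t = "\<lambda>w i u. p (i, u) * nrm i (s i) u"
      have "(\<forall>u\<in>X. 0 = (0 :: complex)) \<and> (\<forall>w\<in>X. \<forall>i<d. \<forall>u\<in>X. ?t w i u = 0)"
      proof (rule sys[rule_format, of "\<lambda>_. 0" ?t], intro conjI allI impI ballI)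
        fix w e assume "w \<in> X" "e \<in> G" "e \<subseteq> X"
        then show "d2seg p i0 (\<lambda>_. 0) w e = (\<Sum>i<d. dseg p i (?t w i) e)"
          using s nz[of e s] by (simp add: d2seg_def dseg_def)
      qed (use nrm(2) in auto)
      then have tu: "?t u i u = 0" if "u \<in> X" for u using i that by blast
      have "nrm i (s i) u = 0" if "u \<in> X" for u using pX[OF i that] tu[OF that] by simp
      then have "(\<Sum>u\<in>e. nrm i (s i) u) = 0" using e(2) by (intro sum.neutral) auto
      then show "(\<Sum>v\<in>e. s i v) = 0" using nrm(1)[OF i e(1)] by simp
    qed
    moreover have "hessian_rigid_on k n d G X p i0"
      unfolding hessian_rigid_on_def
    proof (intro allI impI)
      fix s assume s: "hessian_kernel d G p i0 s"
      \<comment> \<open>All \<open>k\<close> base values are removed here, not only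
        \<open>k - 1\<close> of them. The edge sums then drop by \<open>A\<close>, which becomes the
        constant of the conclusion.\<close>
      define a where "a c = s (b i0 c)" for c
      define A where "A = (\<Sum>c<k. a c)"
      define s' where "s' u = s u - a (fst u)" for u
      have s'e: "(\<Sum>u\<in>e. s' u) = (\<Sum>u\<in>e. s u) - A" if "e \<in> complete_edges k n" for e
        using edge_sum_class[OF that, of "\<lambda>u. a (fst u)" a] by (simp add: s'_def A_def sum_subtractf)
      have "\<forall>w. \<exists>t. \<forall>e\<in>G. (if w \<in> e then seg p i0 e * (\<Sum>u\<in>e. s u) else 0) = (\<Sum>i<d. seg p i e * (\<Sum>u\<in>e. t i u))"
        using s unfolding hessian_kernel_def .
      from choice[OF this] obtain t where t: "\<forall>w. \<forall>e\<in>G.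
        (if w \<in> e then seg p i0 e * (\<Sum>u\<in>e. s u) else 0) = (\<Sum>i<d. seg p i e * (\<Sum>u\<in>e. t w i u))" by (rule exE)
      \<comment> \<open>The correction at \<open>w\<close> accounts for the constant
        \<open>A\<close> and for the term \<open>s' w\<close> that \<open>d2seg\<close>
        omits.\<close>
      define t' where "t' w i u = t w i u - (if i = i0 \<and> u = w then A + s' w else 0)" for w i u
      have t': "(\<Sum>i<d. seg p i e * (\<Sum>u\<in>e. t' w i u)) =
        (if w \<in> e then seg p i0 e * ((\<Sum>u\<in>e. s' u) - s' w) else 0)" if e: "e \<in> G" for w e
      proof -
        have "(\<Sum>u\<in>e. t' w i u) = (\<Sum>u\<in>e. t w i u) - (if i = i0 \<and> w \<in> e then A + s' w else 0)" for i
        proof -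
          have "(\<Sum>u\<in>e. if i = i0 \<and> u = w then A + s' w else 0) = (if i = i0 \<and> w \<in> e then A + s' w else 0)"
            using edgeD(2)[OF e] by (cases "i = i0") (auto simp: sum.delta)
          then show ?thesis by (simp add: t'_def sum_subtractf)
        qed
        then have "(\<Sum>i<d. seg p i e * (\<Sum>u\<in>e. t' w i u)) = (\<Sum>i<d. seg p i e * (\<Sum>u\<in>e. t w i u)) -
          (\<Sum>i<d. if i = i0 then (if w \<in> e then seg p i0 e * (A + s' w) else 0) else 0)"
          unfolding sum_subtractf[symmetric] by (intro sum.cong refl) (auto simp: right_diff_distrib)
        also have "\<dots> = (if w \<in> e then seg p i0 e * (\<Sum>u\<in>e. s u) else 0) - (if w \<in> e then seg p i0 e * (A + s' w) else 0)"
          using bspec[OF spec[OF t] e, of w] i0 by simp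
        finally show ?thesis
          unfolding s'e[OF edgeD(1)[OF e]] by (cases "w \<in> e") (simp_all add: algebra_simps)
      qed
      let ?\<tau> = "\<lambda>u. p (i0, u) * s' u"
      let ?t = "\<lambda>w i u. p (i, u) * nrm i (t' w i) u / p (i0, w)"
      have "(\<forall>u\<in>X. ?\<tau> u = 0) \<and> (\<forall>w\<in>X. \<forall>i<d. \<forall>u\<in>X. ?t w i u = 0)"
      proof (rule sys[rule_format, of ?\<tau> ?t], intro conjI allI impI ballI)
        fix c assume "c < k"
        then show "?\<tau> (b i0 c) = 0" using b[OF i0] by (simp add: s'_def a_def)
      next
        fix w e assume w: "w \<in> X" and e: "e \<in> G" "e \<subseteq> X"
        have S: "p (i0, w) * d2seg p i0 ?\<tau> w e = (\<Sum>i<d. dseg p i (\<lambda>u. p (i, u) * nrm i (t' w i) u) e)"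
          unfolding d2seg_scaled[OF edgeD(2)[OF e(1)]] nz[OF e(1)] t'[OF e(1)] ..
        moreover have "(\<Sum>i<d. dseg p i (?t w i) e) = (\<Sum>i<d. dseg p i (\<lambda>u. p (i, u) * nrm i (t' w i) u) e) / p (i0, w)"
          unfolding dseg_cdiv sum_divide_distrib ..
        moreover have "d2seg p i0 ?\<tau> w e = (\<Sum>i<d. dseg p i (\<lambda>u. p (i, u) * nrm i (t' w i) u) e) / p (i0, w)"
          unfolding S[symmetric] using pX[OF i0 w] by (rule nonzero_mult_div_cancel_left[symmetric])
        ultimately show "d2seg p i0 ?\<tau> w e = (\<Sum>i<d. dseg p i (?t w i) e)" by (simp only:)
      qed (use nrm(2) in auto)
      then have z: "s' u = 0" if "u \<in> X" for u using pX[OF i0] that by auto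
      show "\<exists>c. \<forall>e\<in>complete_edges k n. e \<subseteq> X \<longrightarrow> (\<Sum>v\<in>e. s v) = c"
      proof (intro exI[of _ A] ballI impI)
        fix e assume e: "e \<in> complete_edges k n" "e \<subseteq> X"
        have "(\<Sum>u\<in>e. s' u) = 0" using z e(2) by (intro sum.neutral) auto
        then show "(\<Sum>v\<in>e. s v) = A" using s'e[OF e(1)] by simp
      qed
    qed
    ultimately show "rigid_on k n d G X p \<and> hessian_rigid_on k n d G X p i0" ..
  qed
qed

end

section \<open>Graphs with a percolating core\<close>

lemma graph_variety_eq:
  assumes "G \<subseteq> complete_edges k n"
  shows "graph_variety k n G = monomial_variety G"
proof -
  have "coord_proj G ` segre k n ` coord_space (vertices k n) = range (monomial_map G)"
  proof (intro equalityI subsetI)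
    fix y assume "y \<in> coord_proj G ` segre k n ` coord_space (vertices k n)"
    then obtain x where "y = coord_proj G (segre k n x)" by blast
    then have "y = monomial_map G x"
      using assms by (auto simp: coord_proj_def segre_def monomial_map_def fun_eq_iff)
    then show "y \<in> range (monomial_map G)" by blast
  next
    fix y assume "y \<in> range (monomial_map G)"
    then obtain p where y: "y = monomial_map G p" by blast
    define x where "x v = (if v \<in> vertices k n then p v else 0)" for v
    have "(\<Prod>v\<in>e. x v) = (\<Prod>v\<in>e. p v)" if "e \<in> G" for e
      by (rule prod.cong[OF refl]) (use edge_subset that assms in \<open>auto simp: x_def\<close>)
    then have "y = coord_proj G (segre k n x)"
      using assms unfolding y by (auto simp: coord_proj_def segre_def monomial_map_def fun_eq_iff)
    moreover have "x \<in> coord_space (vertices k n)" by (simp add: x_def coord_space_def)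
    ultimately show "y \<in> coord_proj G ` segre k n ` coord_space (vertices k n)" by blast
  qed
  then show ?thesis unfolding graph_variety_def monomial_variety_def by simp
qed

text \<open>Rows are moved into the image of the parametrisation one at a time. With the other rows
  fixed, \<open>g\<close> is a polynomial on one copy of the variety, and if it vanished on the
  image it would vanish on the closure.\<close>

lemma variety_power_dense:
  assumes g: "g \<in> poly_functions ({..<d} \<times> G)" and z0: "z0 \<in> variety_power G (monomial_variety G) d" "g z0 \<noteq> 0"
  shows "\<exists>p. g (\<lambda>(i, e). if i < d then monomial_map G (p i) e else 0) \<noteq> 0"
proof -
  let ?VP = "variety_power G (monomial_variety G) d"
  have "\<exists>z. z \<in> ?VP \<and> g z \<noteq> 0 \<and> (\<forall>i<j. \<exists>p. (\<lambda>e. z (i, e)) = monomial_map G p)" if "j \<le> d" for j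
    using that
  proof (induction j)
    case 0
    then show ?case using z0 by blast
  next
    case (Suc j)
    then obtain z where z: "z \<in> ?VP" "g z \<noteq> 0" "\<And>i. i < j \<Longrightarrow> \<exists>p. (\<lambda>e. z (i, e)) = monomial_map G p"
      by auto
    have j: "j < d" using Suc.prems by simp
    define S where "S y = (\<lambda>(i, e). if i = j then y e else z (i, e))" for y
    define F where "F y = g (S y)" for y
    have F: "F \<in> poly_functions G"
    proof -
      have "(\<lambda>y. g (\<lambda>ie. S y ie)) \<in> poly_functions G"
      proof (rule poly_functions_subst[OF g])
        fix ie assume "ie \<in> {..<d} \<times> G"
        then obtain i e where ie: "ie = (i, e)" "e \<in> G" by blast
        show "(\<lambda>y. S y ie) \<in> poly_functions G"
          using ie by (cases "i = j") (auto simp: S_def intro: poly_functions.intros)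
      qed
      then show ?thesis by (simp add: F_def[abs_def])
    qed
    have "S (\<lambda>e. z (j, e)) = z" by (auto simp: S_def fun_eq_iff)
    then have "F (\<lambda>e. z (j, e)) \<noteq> 0" using z(2) by (simp add: F_def)
    moreover have "(\<lambda>e. z (j, e)) \<in> monomial_variety G" using z(1) j unfolding variety_power_def by blast
    ultimately have "\<not> (\<forall>p. F (monomial_map G p) = 0)"
      using F unfolding monomial_variety_iff by auto
    then obtain p where p: "F (monomial_map G p) \<noteq> 0" by blast
    let ?z = "S (monomial_map G p)"
    have row: "(\<lambda>e. ?z (i, e)) = (if i = j then monomial_map G p else (\<lambda>e. z (i, e)))" for i
      by (auto simp: S_def)
    have "?z \<in> ?VP"
      unfolding variety_power_def mem_Collect_eq row
    proof (intro conjI allI impI)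
      have "z \<in> coord_space ({..<d} \<times> G)" using z(1) unfolding variety_power_def by blast
      then show "?z \<in> coord_space ({..<d} \<times> G)" using j by (auto simp: S_def coord_space_def monomial_map_def)
      fix i assume "i < d"
      then show "(if i = j then monomial_map G p else (\<lambda>e. z (i, e))) \<in> monomial_variety G"
        using z(1) monomial_map_in_variety unfolding variety_power_def by auto
    qed
    moreover have "g ?z \<noteq> 0" using p by (simp add: F_def)
    moreover have "\<exists>p. (\<lambda>e. ?z (i, e)) = monomial_map G p" if "i < Suc j" for i
      unfolding row using z(3)[of i] that by (cases "i = j") auto
    ultimately show ?case by blast
  qed
  then obtain z where z: "z \<in> ?VP" "g z \<noteq> 0" "\<forall>i<d. \<exists>p. (\<lambda>e. z (i, e)) = monomial_map G p"
    by blast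
  have "\<forall>i. \<exists>p. i < d \<longrightarrow> (\<lambda>e. z (i, e)) = monomial_map G p" using z(3) by blast
  from choice[OF this] obtain p where p: "\<And>i. i < d \<Longrightarrow> (\<lambda>e. z (i, e)) = monomial_map G (p i)" by blast
  have "z = (\<lambda>(i, e). if i < d then monomial_map G (p i) e else 0)"
  proof
    fix ie :: "nat \<times> 'a set"
    obtain i e where ie: "ie = (i, e)" by (cases ie)
    have "z \<in> coord_space ({..<d} \<times> G)" using z(1) unfolding variety_power_def by blast
    then show "z ie = (\<lambda>(i, e). if i < d then monomial_map G (p i) e else 0) ie"
      using fun_cong[OF p, of i e] unfolding ie by (auto simp: coord_space_def)
  qed
  then have "g (\<lambda>(i, e). if i < d then monomial_map G (p i) e else 0) \<noteq> 0" using z(2) by simp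
  then show ?thesis by (rule exI[of _ p])
qed

text \<open>A polynomial certifying that the open set is nonempty pulls back to a nonzero polynomial
  in the parameters. So the open set contains a tuple whose parameter meets all generic conditions
  at once, and there percolation from the core contradicts defectiveness.\<close>

theorem nondefective_of_core:
  assumes core: "rigid_core k n d G X block" and d: "d \<ge> 1"
    and perc: "\<And>Y. X \<subseteq> Y \<Longrightarrow> Y \<subset> vertices k n \<Longrightarrow>
      \<exists>v\<in>vertices k n - Y. card {e \<in> G. v \<in> e \<and> e - {v} \<subseteq> Y} \<ge> d + 1"
  shows "tangentially_weakly_nondefective G (graph_variety k n G) d"
proof -
  interpret rigid_core k n d G X block by (rule core)
  let ?V = "monomial_variety G" and ?I = "{..<d} \<times> vertices k n"
  have finG: "finite G" using GK finite_complete_edges by (rule finite_subset)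
  have "\<not> tangentially_weakly_defective G ?V d"
  proof
    assume "tangentially_weakly_defective G ?V d"
    then obtain U where U: "openin (subtopology (zariski ({..<d} \<times> G)) (variety_power G ?V d)) U" "U \<noteq> {}"
      "\<forall>z\<in>U. \<exists>i<d. \<exists>Z. irreducible_component_of (zariski G) (contact_locus G ?V d (\<lambda>i e. z (i, e))) Z
        \<and> (\<lambda>e. z (i, e)) \<in> Z \<and> krull_dim (zariski G) Z \<ge> 2"
      unfolding tangentially_weakly_defective_def generically_def by (elim exE conjE) (rule that)
    obtain T where T: "openin (zariski ({..<d} \<times> G)) T" "U = T \<inter> variety_power G ?V d"
      using U(1) unfolding openin_subtopology by blast
    obtain P where P: "P \<subseteq> poly_functions ({..<d} \<times> G)"
      "T = coord_space ({..<d} \<times> G) - zero_locus ({..<d} \<times> G) P"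
      using T(1) unfolding openin_zariski by (elim exE conjE) (rule that)
    obtain z0 where z0: "z0 \<in> U" using U(2) by blast
    then have z0V: "z0 \<in> variety_power G ?V d" using T(2) by blast
    obtain g where g: "g \<in> P" "g z0 \<noteq> 0" using z0 unfolding T(2) P(2) zero_locus_def by auto
    have gP: "g \<in> poly_functions ({..<d} \<times> G)" using g(1) P(1) by blast
    define zz where "zz p = (\<lambda>(i, e). if i < d then monomial_map G (\<lambda>v. p (i, v)) e else 0)"
      for p :: "nat \<times> vertex \<Rightarrow> complex"
    have "\<exists>p. g (zz p) \<noteq> 0"
    proof -
      obtain p where "g (\<lambda>(i, e). if i < d then monomial_map G (p i) e else 0) \<noteq> 0"
        using variety_power_dense[OF gP z0V g(2)] by (rule exE)
      then have "g (zz (\<lambda>iv. p (fst iv) (snd iv))) \<noteq> 0" by (simp add: zz_def cong: if_cong)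
      then show ?thesis by (intro exI[of _ "\<lambda>iv. p (fst iv) (snd iv)"]) simp
    qed
    then obtain p1 where p1: "g (zz p1) \<noteq> 0" by (rule exE)
    have gzz: "(\<lambda>p. g (\<lambda>ie. zz p ie)) \<in> poly_functions ?I"
    proof (rule poly_functions_subst[OF gP])
      fix ie assume "ie \<in> {..<d} \<times> G"
      then obtain i e where ie: "ie = (i, e)" "i < d" "e \<in> G" by blast
      have "(\<lambda>p. seg p i e) \<in> poly_functions ?I"
        using ie edge_subset[OF edgeD(1)] by (intro poly_functions_seg)
      then show "(\<lambda>p. zz p ie) \<in> poly_functions ?I" using ie by (simp add: zz_def monomial_map_def)
    qed
    have gen1: "generic_point ?I (\<lambda>p. g (\<lambda>ie. zz p ie) \<noteq> 0)"
      by (rule generic_point_poly[where h = "\<lambda>p. g (\<lambda>ie. zz p ie)" and p = p1, OF gzz]) (use p1 in simp)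
    have gen2: "generic_point ?I (\<lambda>p. \<forall>iv\<in>?I. p iv \<noteq> 0)"
    proof (rule generic_point_ball)
      show "finite ?I" by simp
      fix iv assume "iv \<in> ?I"
      then show "generic_point ?I (\<lambda>p. p iv \<noteq> 0)"
        by (intro generic_point_poly[where h = "\<lambda>p. p iv" and p = "\<lambda>_. 1"] poly_functions.coord) auto
    qed
    \<comment> \<open>The index at which defectiveness shows depends on the point, so the conditions
      are imposed for every index before \<open>p\<close> is chosen.\<close>
    have gen3: "generic_point ?I (\<lambda>p. \<forall>i0\<in>{..<d}. ((\<forall>i<d. \<forall>v\<in>vertices k n. p (i, v) \<noteq> 0) \<longrightarrow>
      rigid_on k n d G X p \<and> hessian_rigid_on k n d G X p i0) \<and> separating k n d p i0)"
      by (intro generic_point_ball generic_point_conj generic_core generic_separating) auto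
    obtain p where p: "g (\<lambda>ie. zz p ie) \<noteq> 0" "\<forall>iv\<in>?I. p iv \<noteq> 0"
      "\<forall>i0\<in>{..<d}. ((\<forall>i<d. \<forall>v\<in>vertices k n. p (i, v) \<noteq> 0) \<longrightarrow>
      rigid_on k n d G X p \<and> hessian_rigid_on k n d G X p i0) \<and> separating k n d p i0"
      using generic_point_ex[OF generic_point_conj[OF gen1 generic_point_conj[OF gen2 gen3]]]
      by (elim exE conjE) (rule that)
    have torus: "\<forall>i<d. \<forall>v\<in>vertices k n. p (i, v) \<noteq> 0" using p(2) by auto
    have "zz p \<in> variety_power G ?V d"
      unfolding variety_power_def
    proof (intro CollectI conjI allI impI)
      show "zz p \<in> coord_space ({..<d} \<times> G)" by (auto simp: zz_def coord_space_def monomial_map_def)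
      fix i assume "i < d"
      then show "(\<lambda>e. zz p (i, e)) \<in> ?V" using monomial_map_in_variety by (simp add: zz_def)
    qed
    then have "zz p \<in> U"
      using g(1) p(1) unfolding T(2) P(2) zero_locus_def variety_power_def by auto
    from bspec[OF U(3) this] obtain i0 Z where i0: "i0 < d"
      and Z: "irreducible_component_of (zariski G) (contact_locus G ?V d (\<lambda>i e. zz p (i, e))) Z"
        "(\<lambda>e. zz p (i0, e)) \<in> Z" "krull_dim (zariski G) Z \<ge> 2" by blast
    have "rigid_on k n d G (vertices k n) p \<and> hessian_rigid_on k n d G (vertices k n) p i0"
    proof (rule rigidity_percolation[OF GK XV _ d i0])
      show "\<exists>u\<in>X. fst u = c" if "c < k" for c using base[OF that, of 0] by blast
      show "separating k n d p i0" "rigid_on k n d G X p" "hessian_rigid_on k n d G X p i0"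
        using p(3) torus i0 by auto
    qed (rule perc)
    then have hes: "hessian_rigid_on k n d G (vertices k n) p i0" ..
    have "\<not> krull_dim (zariski G) Z \<ge> 2"
    proof (rule contact_locus_component_dim[where p = "\<lambda>i v. p (i, v)" and ?i0.0 = i0 and W = "{v. fst v = 0}"])
      show "finite G" by (rule finG)
      show "finite e" if "e \<in> G" for e by (rule edgeD(2)[OF that])
      show "card (e \<inter> {v. fst v = 0}) = 1" if e: "e \<in> G" for e
      proof -
        obtain v where v: "v \<in> e" "fst v = 0" using edge_vertex_ex[OF edgeD(1)[OF e], of 0] k3 by auto
        have "x = v" if "x \<in> e" "fst x = 0" for x
          using edge_inj[OF edgeD(1)[OF e] that(1) v(1)] that(2) v(2) by simp
        then have "e \<inter> {v. fst v = 0} = {v}" using v by blast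
        then show ?thesis by simp
      qed
      show "p (i, v) \<noteq> 0" if "i < d" "e \<in> G" "v \<in> e" for i e v
        using torus that edge_subset[OF edgeD(1)[OF that(2)]] by blast
      show "(\<lambda>e. zz p (i, e)) = monomial_map G (\<lambda>v. p (i, v))" if "i < d" for i
        using that by (simp add: zz_def)
    next
      fix s assume s: "\<And>v. star_part v (\<lambda>e. if e \<in> G then zz p (i0, e) * (\<Sum>v\<in>e. s v) else 0)
        \<in> tangent_sum G d (\<lambda>i e. zz p (i, e))"
      have zz: "zz p (i, e) = seg p i e" if "i < d" "e \<in> G" for i e
        using that by (simp add: zz_def monomial_map_def)
      have "hessian_kernel d G p i0 s"
        unfolding hessian_kernel_def
      proof
        fix v
        obtain t where t: "\<forall>e\<in>G. star_part v (\<lambda>e. if e \<in> G then zz p (i0, e) * (\<Sum>v\<in>e. s v) else 0) e =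
          (\<Sum>i<d. zz p (i, e) * (\<Sum>v\<in>e. t i v))"
          using s[of v] unfolding tangent_sum_def mem_Collect_eq by (elim conjE exE) (rule that)
        have "\<forall>e\<in>G. (if v \<in> e then seg p i0 e * (\<Sum>u\<in>e. s u) else 0) = (\<Sum>i<d. seg p i e * (\<Sum>u\<in>e. t i u))"
        proof
          fix e assume e: "e \<in> G"
          have "(\<Sum>i<d. zz p (i, e) * (\<Sum>v\<in>e. t i v)) = (\<Sum>i<d. seg p i e * (\<Sum>u\<in>e. t i u))"
            using zz e by (intro sum.cong) auto
          then show "(if v \<in> e then seg p i0 e * (\<Sum>u\<in>e. s u) else 0) = (\<Sum>i<d. seg p i e * (\<Sum>u\<in>e. t i u))"
            using bspec[OF t e] zz[OF i0 e] e by (cases "v \<in> e") (simp_all add: star_part_def)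
        qed
        then show "\<exists>t. \<forall>e\<in>G. (if v \<in> e then seg p i0 e * (\<Sum>u\<in>e. s u) else 0) = (\<Sum>i<d. seg p i e * (\<Sum>u\<in>e. t i u))"
          by (rule exI[of _ t])
      qed
      from mp[OF spec[OF hes[unfolded hessian_rigid_on_def]] this]
      obtain c where "\<forall>e\<in>complete_edges k n. e \<subseteq> vertices k n \<longrightarrow> (\<Sum>v\<in>e. s v) = c" by (rule exE)
      then have "\<forall>e\<in>G. (\<Sum>v\<in>e. s v) = c" using edgeD(1) edge_subset by auto
      then show "\<exists>c. \<forall>e\<in>G. (\<Sum>v\<in>e. s v) = c" by (rule exI[of _ c])
    qed (use i0 Z in auto)
    then show False using Z(3) by contradiction
  qed
  then show ?thesis
    unfolding tangentially_weakly_nondefective_def graph_variety_eq[OF GK] .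
qed

section \<open>Cores in graphs with dense boxes\<close>

lemma upper_quantile:
  fixes \<theta> :: "'a \<Rightarrow> real" and m :: real
  assumes Y: "finite Y" "0 < m" "m \<le> card Y"
  shows "\<exists>q. m \<le> card {v \<in> Y. q \<le> \<theta> v} \<and> card {v \<in> Y. q < \<theta> v} < m"
proof -
  define A where "A = {q \<in> \<theta> ` Y. m \<le> card {v \<in> Y. q \<le> \<theta> v}}"
  have ne: "Y \<noteq> {}" using Y by auto
  have fin: "finite A" unfolding A_def using Y by simp
  have "{v \<in> Y. Min (\<theta> ` Y) \<le> \<theta> v} = Y" using Y(1) by auto
  then have "Min (\<theta> ` Y) \<in> A" unfolding A_def using Y ne by simp
  then have A: "Max A \<in> A" using fin Max_in by blast
  define a where "a = Max A"
  define B where "B = {v \<in> Y. a < \<theta> v}"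
  have "card B < m"
  proof (rule ccontr)
    assume *: "\<not> ?thesis"
    have "B \<noteq> {}" using * Y(2) by (intro notI) simp
    moreover have finB: "finite B" unfolding B_def using Y(1) by simp
    ultimately have q: "Min (\<theta> ` B) \<in> \<theta> ` B" by (intro Min_in) auto
    define b where "b = Min (\<theta> ` B)"
    have ab: "a < b" using q unfolding b_def[symmetric] by (auto simp: B_def)
    have "b \<le> \<theta> v" if "v \<in> B" for v unfolding b_def using that finB by simp
    then have "{v \<in> Y. b \<le> \<theta> v} = B" using ab by (auto simp: B_def)
    moreover have "b \<in> \<theta> ` Y" using q unfolding b_def B_def by blast
    ultimately have "b \<in> A" unfolding A_def using * by auto
    then show False using ab Max_ge[OF fin, of b] unfolding a_def by linarith
  qed
  then show ?thesis using A unfolding B_def a_def[symmetric] unfolding A_def by blast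
qed

text \<open>The lower quantile is obtained from the upper one of \<open>- \<theta>\<close>. If it
  exceeded \<open>hi\<close>, every element would lie strictly above \<open>hi\<close> or strictly
  below \<open>lo\<close>, two sets with fewer than \<open>m\<close> elements each.\<close>

lemma quantiles:
  fixes \<theta> :: "'a \<Rightarrow> real" and m :: real
  assumes Y: "finite Y" "0 < m" "2 * m \<le> card Y"
  obtains lo hi where "lo \<le> hi" "m \<le> card {v \<in> Y. hi \<le> \<theta> v}" "card {v \<in> Y. hi < \<theta> v} < m"
    "m \<le> card {v \<in> Y. \<theta> v \<le> lo}" "card {v \<in> Y. \<theta> v < lo} < m"
proof -
  obtain hi where hi: "m \<le> card {v \<in> Y. hi \<le> \<theta> v}" "card {v \<in> Y. hi < \<theta> v} < m"
    using upper_quantile[of Y m \<theta>] Y by auto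
  obtain l where l: "m \<le> card {v \<in> Y. l \<le> - \<theta> v}" "card {v \<in> Y. l < - \<theta> v} < m"
    using upper_quantile[of Y m "\<lambda>v. - \<theta> v"] Y by auto
  have eq: "{v \<in> Y. l \<le> - \<theta> v} = {v \<in> Y. \<theta> v \<le> - l}" "{v \<in> Y. l < - \<theta> v} = {v \<in> Y. \<theta> v < - l}"
    by auto
  have "- l \<le> hi"
  proof (rule ccontr)
    assume "\<not> ?thesis"
    then have "Y \<subseteq> {v \<in> Y. hi < \<theta> v} \<union> {v \<in> Y. \<theta> v < - l}" by auto
    then have "card Y \<le> card ({v \<in> Y. hi < \<theta> v} \<union> {v \<in> Y. \<theta> v < - l})"
      using Y(1) by (intro card_mono) auto
    also have "\<dots> \<le> card {v \<in> Y. hi < \<theta> v} + card {v \<in> Y. \<theta> v < - l}" by (rule card_Un_le)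
    finally show False using hi(2) l(2) Y(3) unfolding eq by linarith
  qed
  then show thesis using that hi l unfolding eq by blast
qed

lemma mult_le_divide: "a * b \<le> 1 \<Longrightarrow> b > 0 \<Longrightarrow> x \<ge> 0 \<Longrightarrow> a * x \<le> x / b" for a b x :: real
  using mult_right_mono[of "a * b" 1 x] by (simp add: pos_le_divide_eq mult_ac)

definition part_of :: "nat \<Rightarrow> vertex \<Rightarrow> nat" where
  "part_of d v = snd v mod (d + 1)"

lemma part_card:
  assumes "c < k" "j \<le> d" "d + 1 \<le> n"
  shows "real n / (2 * (d + 1)) \<le> card {v \<in> vertices k n. fst v = c \<and> part_of d v = j}"
proof -
  let ?m = "n div (d + 1)"
  let ?f = "\<lambda>q. (c, q * (d + 1) + j)"
  have lt: "q * (d + 1) + j < n" if "q < ?m" for q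
  proof -
    have "q * (d + 1) + j < (q + 1) * (d + 1)" using assms(2) by simp
    also have "\<dots> \<le> ?m * (d + 1)" using that by (intro mult_right_mono) auto
    also have "\<dots> \<le> n" by (rule div_times_less_eq_dividend)
    finally show ?thesis .
  qed
  have "inj_on ?f {..<?m}"
  proof (rule inj_onI)
    fix x y assume "?f x = ?f y"
    then have "x * (d + 1) = y * (d + 1)" by simp
    then show "x = y" by (simp only: mult_cancel2) simp
  qed
  then have "card (?f ` {..<?m}) = ?m" by (simp add: card_image)
  moreover have "?f ` {..<?m} \<subseteq> {v \<in> vertices k n. fst v = c \<and> part_of d v = j}"
  proof
    fix v assume "v \<in> ?f ` {..<?m}"
    then obtain q where q: "q < ?m" "v = ?f q" by auto
    have "(q * (d + 1) + j) mod (d + 1) = j mod (d + 1)" by (rule mod_mult_self3)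
    then have "part_of d v = j" using q(2) assms(2) by (simp add: part_of_def)
    moreover have "v \<in> vertices k n" using q(2) lt[OF q(1)] assms(1) by (simp add: mem_vertices)
    ultimately show "v \<in> {v \<in> vertices k n. fst v = c \<and> part_of d v = j}" using q(2) by simp
  qed
  ultimately have 1: "?m \<le> card {v \<in> vertices k n. fst v = c \<and> part_of d v = j}"
    using card_mono[of "{v \<in> vertices k n. fst v = c \<and> part_of d v = j}" "?f ` {..<?m}"] by simp
  have "?m \<ge> 1" using div_le_mono[OF assms(3), of "d + 1"] by simp
  have "n = ?m * (d + 1) + n mod (d + 1)" by (rule div_mult_mod_eq[symmetric])
  also have "\<dots> < ?m * (d + 1) + (d + 1)" by simp
  also have "\<dots> \<le> ?m * (d + 1) + ?m * (d + 1)" using add_left_mono[OF mult_le_mono1[OF \<open>?m \<ge> 1\<close>, of "d + 1"], of "?m * (d + 1)"] by (simp only: mult_1)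
  finally have "n \<le> ?m * (2 * (d + 1))" by (simp add: algebra_simps)
  then have "real n \<le> real (?m * (2 * (d + 1)))" by (simp only: of_nat_le_iff)
  then have "real n / (2 * (d + 1)) \<le> ?m" by (simp add: field_simps)
  also have "\<dots> \<le> card {v \<in> vertices k n. fst v = c \<and> part_of d v = j}" using 1 by simp
  finally show ?thesis .
qed

lemma class_card: "c < k \<Longrightarrow> card {v \<in> vertices k n. fst v = c} = n"
proof -
  assume "c < k"
  then have "{v \<in> vertices k n. fst v = c} = {c} \<times> {..<n}" by (auto simp: mem_vertices)
  then show ?thesis by simp
qed

text \<open>The bound \<open>n\<close> in \<open>box\<close> beats one edge per vertex of a class.
  Assumption \<open>\<delta>1\<close> leaves \<open>2 * \<delta> * n\<close> vertices in each block
  after all deletions permitted in \<open>peeled\<close>, and \<open>n1\<close> makes the deletion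
  of a single vertex admissible in the minimality argument.\<close>

locale dense_boxes =
  fixes k n d :: nat and G :: "vertex set set" and \<delta> :: real
  assumes k3: "k \<ge> 3" and GK: "G \<subseteq> complete_edges k n" and \<delta>0: "\<delta> > 0"
    and box: "\<And>T. (\<And>c. c < k \<Longrightarrow> T c \<subseteq> vertices k n \<and> (\<forall>v\<in>T c. fst v = c) \<and> \<delta> * n \<le> card (T c)) \<Longrightarrow>
      card {e \<in> G. \<forall>v\<in>e. v \<in> T (fst v)} > n"
    and nd: "d + 1 \<le> n" and n1: "2 * k * \<delta> * n \<ge> 1"
    and \<delta>1: "\<delta> * (k * real ((d + 1) ^ k) + 2 * k + 2) * (2 * (d + 1)) \<le> 1"
begin

section \<open>Peeling down to a core\<close>

definition profiles :: "(nat \<Rightarrow> nat) set" where "profiles = {..<k} \<rightarrow>\<^sub>E {..d}"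

definition attached :: "vertex \<Rightarrow> vertex set \<Rightarrow> (nat \<Rightarrow> nat) \<Rightarrow> vertex set set" where
  "attached v X \<pi> = {e \<in> G. v \<in> e \<and> e - {v} \<subseteq> X \<and> (\<forall>u\<in>e - {v}. part_of d u = \<pi> (fst u))}"

text \<open>Includes, as long as they are large, all sets obtained by repeatedly deleting a vertex that has at
  most one edge of some profile into the remaining vertices: further deletions keep this property.\<close>

definition peeled :: "vertex set set" where
  "peeled = {X. X \<subseteq> vertices k n \<and> card (vertices k n - X) \<le> (k * real ((d + 1) ^ k) + 2 * k) * \<delta> * n \<and>
     (\<forall>v\<in>vertices k n - X. \<exists>\<pi>\<in>profiles. card (attached v X \<pi>) \<le> 1)}"

lemma finG: "finite G" using GK finite_complete_edges by (rule finite_subset)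

lemma finite_attached: "finite (attached v X \<pi>)" unfolding attached_def using finG by simp

lemma n0: "n > 0" using nd by simp

lemma finite_profiles: "finite profiles" and card_profiles: "card profiles = (d + 1) ^ k"
  unfolding profiles_def by (simp_all add: finite_PiE card_PiE)

lemma part_in_peeled:
  assumes X: "X \<subseteq> vertices k n" "card (vertices k n - X) \<le> (k * real ((d + 1) ^ k) + 2 * k) * \<delta> * n"
    and c: "c < k" "j \<le> d"
  shows "2 * \<delta> * n \<le> card {v \<in> X. fst v = c \<and> part_of d v = j}"
proof -
  let ?A = "{v \<in> vertices k n. fst v = c \<and> part_of d v = j}" and ?B = "{v \<in> X. fst v = c \<and> part_of d v = j}"
  have finX: "finite X" using X(1) finite_vertices by (rule finite_subset)
  have "?A \<subseteq> ?B \<union> (vertices k n - X)" by auto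
  then have "card ?A \<le> card (?B \<union> (vertices k n - X))" using finX by (intro card_mono) auto
  also have "\<dots> \<le> card ?B + card (vertices k n - X)" by (rule card_Un_le)
  finally have "real (card ?A) \<le> card ?B + real (card (vertices k n - X))" by linarith
  moreover have "real n / (2 * (d + 1)) \<le> card ?A" using c nd by (rule part_card)
  moreover have "\<delta> * (k * real ((d + 1) ^ k) + 2 * k + 2) * n \<le> real n / (2 * (d + 1))"
    by (rule mult_le_divide[OF \<delta>1]) auto
  moreover have "\<delta> * (k * real ((d + 1) ^ k) + 2 * k + 2) * n =
    (k * real ((d + 1) ^ k) + 2 * k) * \<delta> * n + 2 * \<delta> * n" by (simp add: algebra_simps)
  ultimately show ?thesis using X(2) by linarith
qed

text \<open>The weaker bound built into \<open>peeled\<close> improves itself. Otherwise one of the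
  \<open>k * (d + 1) ^ k\<close> pairs of a class and a profile accounts for more than
  \<open>\<delta> * n\<close> removed vertices. Together with the blocks of \<open>X\<close> in the
  other classes they span a box with more than \<open>n\<close> edges, although each of these at
  most \<open>n\<close> vertices has at most one such edge.\<close>

lemma peeled_small:
  assumes "X \<in> peeled"
  shows "card (vertices k n - X) \<le> k * real ((d + 1) ^ k) * \<delta> * n"
proof (rule ccontr)
  assume big: "\<not> ?thesis"
  have X: "X \<subseteq> vertices k n" "card (vertices k n - X) \<le> (k * real ((d + 1) ^ k) + 2 * k) * \<delta> * n"
    "\<And>v. v \<in> vertices k n - X \<Longrightarrow> \<exists>\<pi>\<in>profiles. card (attached v X \<pi>) \<le> 1"
    using assms unfolding peeled_def by auto
  have finX: "finite X" using X(1) finite_vertices by (rule finite_subset)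
  define R where "R = (\<lambda>(c, \<pi>). {v \<in> vertices k n - X. fst v = c \<and> card (attached v X \<pi>) \<le> 1})"
  have cover: "vertices k n - X \<subseteq> (\<Union>x\<in>{..<k} \<times> profiles. R x)"
  proof
    fix v assume v: "v \<in> vertices k n - X"
    obtain \<pi> where "\<pi> \<in> profiles" "card (attached v X \<pi>) \<le> 1" using X(3)[OF v] by blast
    moreover have "fst v < k" using v by (simp add: mem_vertices)
    ultimately show "v \<in> (\<Union>x\<in>{..<k} \<times> profiles. R x)"
      using v by (intro UN_I[of "(fst v, \<pi>)"]) (auto simp: R_def)
  qed
  have "\<exists>x\<in>{..<k} \<times> profiles. \<delta> * n < card (R x)"
  proof (rule ccontr)
    assume *: "\<not> ?thesis"
    have "card (vertices k n - X) \<le> card (\<Union>x\<in>{..<k} \<times> profiles. R x)"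
      using cover finite_profiles by (intro card_mono) (auto simp: R_def)
    also have "\<dots> \<le> (\<Sum>x\<in>{..<k} \<times> profiles. card (R x))"
      by (rule card_UN_le) (simp add: finite_profiles)
    finally have "real (card (vertices k n - X)) \<le> (\<Sum>x\<in>{..<k} \<times> profiles. real (card (R x)))"
      by (simp only: of_nat_sum[symmetric] of_nat_le_iff)
    also have "\<dots> \<le> (\<Sum>x\<in>{..<k} \<times> profiles. \<delta> * n)" using * by (intro sum_mono) (auto simp: not_less)
    also have "\<dots> = k * real ((d + 1) ^ k) * \<delta> * n" by (simp add: card_cartesian_product card_profiles)
    finally show False using big by simp
  qed
  then obtain c \<pi> where c: "c < k" "\<pi> \<in> profiles" "\<delta> * n < card (R (c, \<pi>))" by auto
  define T where "T c' = (if c' = c then R (c, \<pi>) else {v \<in> X. fst v = c' \<and> part_of d v = \<pi> c'})" for c'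
  have "card {e \<in> G. \<forall>v\<in>e. v \<in> T (fst v)} > n"
  proof (rule box)
    fix c' assume c': "c' < k"
    have "\<pi> c' \<le> d" using c(2) c' by (auto simp: profiles_def)
    then have "2 * \<delta> * n \<le> card {v \<in> X. fst v = c' \<and> part_of d v = \<pi> c'}"
      by (rule part_in_peeled[OF X(1,2) c'])
    moreover have "\<delta> * n \<ge> 0" using \<delta>0 by simp
    ultimately have "\<delta> * n \<le> card (T c')" using c(3) by (auto simp: T_def)
    then show "T c' \<subseteq> vertices k n \<and> (\<forall>v\<in>T c'. fst v = c') \<and> \<delta> * n \<le> card (T c')"
      using X(1) by (auto simp: T_def R_def)
  qed
  moreover have "{e \<in> G. \<forall>v\<in>e. v \<in> T (fst v)} \<subseteq> (\<Union>v\<in>R (c, \<pi>). attached v X \<pi>)"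
  proof
    fix e assume e: "e \<in> {e \<in> G. \<forall>v\<in>e. v \<in> T (fst v)}"
    then have eK: "e \<in> complete_edges k n" using GK by blast
    obtain v where v: "v \<in> e" "fst v = c" using edge_vertex_ex[OF eK c(1)] by blast
    have "u \<in> X \<and> part_of d u = \<pi> (fst u)" if "u \<in> e - {v}" for u
    proof -
      have "fst u \<noteq> c" using edge_inj[OF eK _ v(1), of u] that v(2) by auto
      moreover have "u \<in> T (fst u)" using e that by blast
      ultimately show ?thesis by (simp add: T_def)
    qed
    then have "e \<in> attached v X \<pi>" using e v(1) unfolding attached_def by blast
    moreover have "v \<in> R (c, \<pi>)" using e v by (auto simp: T_def)
    ultimately show "e \<in> (\<Union>v\<in>R (c, \<pi>). attached v X \<pi>)" by blast
  qed
  then have "card {e \<in> G. \<forall>v\<in>e. v \<in> T (fst v)} \<le> card (\<Union>v\<in>R (c, \<pi>). attached v X \<pi>)"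
    by (intro card_mono) (auto simp: finite_attached R_def)
  also have "\<dots> \<le> (\<Sum>v\<in>R (c, \<pi>). card (attached v X \<pi>))" by (rule card_UN_le) (simp add: R_def)
  also have "\<dots> \<le> (\<Sum>v\<in>R (c, \<pi>). 1)" by (intro sum_mono) (auto simp: R_def)
  also have "\<dots> \<le> card {v \<in> vertices k n. fst v = c}"
    by (simp, intro card_mono) (auto simp: R_def)
  also have "\<dots> = n" using c(1) by (rule class_card)
  ultimately show False by simp
qed

text \<open>By \<open>peeled_small\<close> there is room for \<open>2 * k * \<delta> * n\<close>
  further deletions. If each vertex of \<open>X - X'\<close> had a profile with at most one attached
  edge, \<open>X'\<close> would be a smaller peeled set.\<close>

lemma minimal_peeled:
  "\<exists>X\<in>peeled. \<forall>X'. X' \<subset> X \<and> card (X - X') \<le> 2 * k * \<delta> * n \<longrightarrow>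
    (\<exists>v\<in>X - X'. \<forall>\<pi>\<in>profiles. card (attached v X' \<pi>) \<ge> 2)"
proof -
  have "vertices k n \<in> peeled" unfolding peeled_def using \<delta>0 by simp
  then obtain X where X: "X \<in> peeled" "\<And>Y. Y \<in> peeled \<Longrightarrow> card X \<le> card Y"
    using ex_has_least_nat[of "\<lambda>X. X \<in> peeled" _ card] by blast
  have XV: "X \<subseteq> vertices k n" using X(1) unfolding peeled_def by blast
  have finX: "finite X" using XV finite_vertices by (rule finite_subset)
  have "\<exists>v\<in>X - X'. \<forall>\<pi>\<in>profiles. card (attached v X' \<pi>) \<ge> 2"
    if X': "X' \<subset> X" "card (X - X') \<le> 2 * k * \<delta> * n" for X'
  proof (rule ccontr)
    assume *: "\<not> ?thesis"
    have "X' \<in> peeled"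
      unfolding peeled_def
    proof (intro CollectI conjI ballI)
      show "X' \<subseteq> vertices k n" using X' XV by blast
      have "vertices k n - X' = (vertices k n - X) \<union> (X - X')" using X' XV by blast
      then have "card (vertices k n - X') \<le> card (vertices k n - X) + card (X - X')"
        using card_Un_le by metis
      then have "real (card (vertices k n - X')) \<le> k * real ((d + 1) ^ k) * \<delta> * n + 2 * k * \<delta> * n"
        using peeled_small[OF X(1)] X'(2) by linarith
      then show "card (vertices k n - X') \<le> (k * real ((d + 1) ^ k) + 2 * k) * \<delta> * n"
        by (simp add: algebra_simps)
      fix v assume v: "v \<in> vertices k n - X'"
      show "\<exists>\<pi>\<in>profiles. card (attached v X' \<pi>) \<le> 1"
      proof (cases "v \<in> X")
        case True
        then show ?thesis using * v by force
      next
        case False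
        then obtain \<pi> where \<pi>: "\<pi> \<in> profiles" "card (attached v X \<pi>) \<le> 1"
          using X(1) v unfolding peeled_def by blast
        have "attached v X' \<pi> \<subseteq> attached v X \<pi>" using X'(1) unfolding attached_def by blast
        then have "card (attached v X' \<pi>) \<le> card (attached v X \<pi>)"
          by (rule card_mono[OF finite_attached])
        then show ?thesis using \<pi> by (meson order_trans)
      qed
    qed
    then have "card X \<le> card X'" by (rule X(2))
    then show False using psubset_card_mono[OF finX X'(1)] by simp
  qed
  then show ?thesis using X(1) by blast
qed

lemma profile_restrict:
  assumes "\<And>c. \<pi> c \<le> d"
  shows "restrict \<pi> {..<k} \<in> profiles" "attached v X (restrict \<pi> {..<k}) = attached v X \<pi>"
proof -
  show "restrict \<pi> {..<k} \<in> profiles" using assms by (auto simp: profiles_def)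
  have r: "restrict \<pi> {..<k} (fst u) = \<pi> (fst u)" if "e \<in> G" "u \<in> e" for e u
  proof -
    have "u \<in> vertices k n" using that GK edge_subset by blast
    then show ?thesis by (simp add: mem_vertices)
  qed
  show "attached v X (restrict \<pi> {..<k}) = attached v X \<pi>"
    unfolding attached_def by (intro Collect_cong conj_cong refl ball_cong) (use r in auto)
qed

text \<open>The order of the real numbers replaces linear algebra here: comparing the upper and the lower
  \<open>\<delta>\<close>-quantiles of the values in each class shows that almost all values in a class agree.\<close>

lemma real_kernel_constant:
  fixes \<theta> :: "vertex \<Rightarrow> real"
  assumes X: "X \<in> peeled" "\<And>X'. X' \<subset> X \<Longrightarrow> card (X - X') \<le> 2 * k * \<delta> * n \<Longrightarrow>
    \<exists>v\<in>X - X'. \<forall>\<pi>\<in>profiles. card (attached v X' \<pi>) \<ge> 2"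
    and \<pi>: "\<And>c. \<pi> c \<le> d"
    and ker: "\<And>e. e \<in> G \<Longrightarrow> e \<subseteq> X \<Longrightarrow> (\<And>u. u \<in> e \<Longrightarrow> part_of d u = \<pi> (fst u)) \<Longrightarrow> (\<Sum>u\<in>e. \<theta> u) = 0"
  shows "\<exists>q. \<forall>u\<in>X. part_of d u = \<pi> (fst u) \<longrightarrow> \<theta> u = q (fst u)"
proof -
  have XV: "X \<subseteq> vertices k n" and Xc: "card (vertices k n - X) \<le> (k * real ((d + 1) ^ k) + 2 * k) * \<delta> * n"
    using X(1) unfolding peeled_def by auto
  have finX: "finite X" using XV finite_vertices by (rule finite_subset)
  define Y where "Y c = {v \<in> X. fst v = c \<and> part_of d v = \<pi> c}" for c
  have m0: "0 < \<delta> * n" using \<delta>0 n0 by simp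
  have finY: "finite (Y c)" for c unfolding Y_def using finX by simp
  define ok where "ok c lo hi \<longleftrightarrow> lo \<le> hi \<and> \<delta> * n \<le> card {v \<in> Y c. hi \<le> \<theta> v} \<and>
      card {v \<in> Y c. hi < \<theta> v} < \<delta> * n \<and> \<delta> * n \<le> card {v \<in> Y c. \<theta> v \<le> lo} \<and>
      card {v \<in> Y c. \<theta> v < lo} < \<delta> * n" for c lo hi
  have "\<exists>lo hi. c < k \<longrightarrow> ok c lo hi" for c
  proof (cases "c < k")
    case True
    have Yc: "2 * (\<delta> * n) \<le> card (Y c)" using part_in_peeled[OF XV Xc True \<pi>[of c]] by (simp add: Y_def)
    obtain l h where "l \<le> h" "\<delta> * n \<le> card {v \<in> Y c. h \<le> \<theta> v}" "card {v \<in> Y c. h < \<theta> v} < \<delta> * n"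
      "\<delta> * n \<le> card {v \<in> Y c. \<theta> v \<le> l}" "card {v \<in> Y c. \<theta> v < l} < \<delta> * n"
      by (rule quantiles[OF finY m0 Yc, of \<theta>])
    then have "ok c l h" unfolding ok_def by blast
    then show ?thesis by blast
  qed simp
  then obtain lo hi where ok: "\<And>c. c < k \<Longrightarrow> ok c (lo c) (hi c)" by metis
  \<comment> \<open>If in every class at least \<open>\<delta> * n\<close> vertices of the profile
    satisfy \<open>P\<close>, they span an edge inside \<open>X\<close>. This is applied to the
    upper and to the lower tails of \<open>\<theta>\<close>.\<close>
  have edge: "\<exists>e\<in>G. e \<subseteq> X \<and> (\<forall>u\<in>e. part_of d u = \<pi> (fst u)) \<and> (\<forall>u\<in>e. P (fst u) u)"
    if P: "\<And>c. c < k \<Longrightarrow> \<delta> * n \<le> card {v \<in> Y c. P c v}" for P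
  proof -
    have "card {e \<in> G. \<forall>v\<in>e. v \<in> {w \<in> Y (fst v). P (fst v) w}} > n"
      by (rule box[of "\<lambda>c. {v \<in> Y c. P c v}"]) (use P XV in \<open>auto simp: Y_def\<close>)
    then have "{e \<in> G. \<forall>v\<in>e. v \<in> {w \<in> Y (fst v). P (fst v) w}} \<noteq> {}"
      by (metis card.empty not_less0)
    then obtain e where "e \<in> G" "\<forall>v\<in>e. v \<in> {w \<in> Y (fst v). P (fst v) w}" by blast
    then show ?thesis unfolding Y_def by (intro bexI[of _ e]) auto
  qed
  obtain e1 where e1: "e1 \<in> G" "e1 \<subseteq> X" "\<forall>u\<in>e1. part_of d u = \<pi> (fst u)" "\<forall>u\<in>e1. hi (fst u) \<le> \<theta> u"
    using edge[of "\<lambda>c v. hi c \<le> \<theta> v"] ok unfolding ok_def by blast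
  obtain e2 where e2: "e2 \<in> G" "e2 \<subseteq> X" "\<forall>u\<in>e2. part_of d u = \<pi> (fst u)" "\<forall>u\<in>e2. \<theta> u \<le> lo (fst u)"
    using edge[of "\<lambda>c v. \<theta> v \<le> lo c"] ok unfolding ok_def by blast
  have eK: "e \<in> complete_edges k n" if "e \<in> G" for e using that GK by blast
  have "(\<Sum>c<k. hi c) = (\<Sum>u\<in>e1. hi (fst u))" using edge_sum_class[OF eK[OF e1(1)], of "\<lambda>u. hi (fst u)"] by simp
  also have "\<dots> \<le> (\<Sum>u\<in>e1. \<theta> u)" using e1(4) by (intro sum_mono) auto
  also have "\<dots> = 0" using ker e1 by blast
  finally have hi0: "(\<Sum>c<k. hi c) \<le> 0" .
  have "0 = (\<Sum>u\<in>e2. \<theta> u)" using ker[OF e2(1,2)] e2(3) by simp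
  also have "\<dots> \<le> (\<Sum>u\<in>e2. lo (fst u))" using e2(4) by (intro sum_mono) auto
  also have "\<dots> = (\<Sum>c<k. lo c)" using edge_sum_class[OF eK[OF e2(1)], of "\<lambda>u. lo (fst u)"] by simp
  finally have lo0: "0 \<le> (\<Sum>c<k. lo c)" .
  \<comment> \<open>The quantiles of the classes are squeezed: the sum of \<open>hi\<close> is at
    most 0, the sum of \<open>lo\<close> at least 0, and \<open>lo c \<le> hi c\<close> for each
    class, so they coincide.\<close>
  have lohi: "lo c \<le> hi c" if "c < k" for c using ok[OF that] unfolding ok_def by blast
  then have "(\<Sum>c<k. hi c - lo c) \<ge> 0" by (intro sum_nonneg) auto
  then have "(\<Sum>c<k. hi c - lo c) = 0" using hi0 lo0 by (simp add: sum_subtractf)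
  then have eq: "lo c = hi c" if "c < k" for c
    using lohi that by (subst (asm) sum_nonneg_eq_0_iff) auto
  have "(\<Sum>c<k. lo c) = (\<Sum>c<k. hi c)" using eq by (intro sum.cong) auto
  then have sum0: "(\<Sum>c<k. hi c) = 0" using hi0 lo0 by linarith
  \<comment> \<open>At most \<open>2 * k * \<delta> * n\<close> vertices deviate from the common
    quantile. Minimality gives one of them an edge into \<open>X'\<close>, and the kernel equation
    of that edge leaves no room for the deviation.\<close>
  define X' where "X' = {v \<in> X. part_of d v = \<pi> (fst v) \<longrightarrow> \<theta> v = hi (fst v)}"
  have "X' = X"
  proof (rule ccontr)
    assume "X' \<noteq> X"
    then have sub: "X' \<subset> X" unfolding X'_def by blast
    have "X - X' \<subseteq> (\<Union>c<k. {v \<in> Y c. hi c < \<theta> v} \<union> {v \<in> Y c. \<theta> v < lo c})"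
    proof
      fix v assume v: "v \<in> X - X'"
      have c: "fst v < k" using v XV mem_vertices by blast
      have "\<theta> v \<noteq> hi (fst v)" "part_of d v = \<pi> (fst v)" using v unfolding X'_def by auto
      then show "v \<in> (\<Union>c<k. {v \<in> Y c. hi c < \<theta> v} \<union> {v \<in> Y c. \<theta> v < lo c})"
        using c eq[OF c] v by (intro UN_I[of "fst v"]) (auto simp: Y_def)
    qed
    then have "card (X - X') \<le> card (\<Union>c<k. {v \<in> Y c. hi c < \<theta> v} \<union> {v \<in> Y c. \<theta> v < lo c})"
      using finY by (intro card_mono) auto
    also have "\<dots> \<le> (\<Sum>c<k. card ({v \<in> Y c. hi c < \<theta> v} \<union> {v \<in> Y c. \<theta> v < lo c}))"
      by (rule card_UN_le) simp
    finally have "real (card (X - X')) \<le> (\<Sum>c<k. real (card ({v \<in> Y c. hi c < \<theta> v} \<union> {v \<in> Y c. \<theta> v < lo c})))"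
      by (simp only: of_nat_sum[symmetric] of_nat_le_iff)
    also have "\<dots> \<le> (\<Sum>c<k. 2 * (\<delta> * n))"
    proof (intro sum_mono)
      fix c assume "c \<in> {..<k}"
      then have "real (card {v \<in> Y c. hi c < \<theta> v}) < \<delta> * n" "real (card {v \<in> Y c. \<theta> v < lo c}) < \<delta> * n"
        using ok[of c] unfolding ok_def by auto
      moreover have "real (card ({v \<in> Y c. hi c < \<theta> v} \<union> {v \<in> Y c. \<theta> v < lo c}))
        \<le> real (card {v \<in> Y c. hi c < \<theta> v}) + real (card {v \<in> Y c. \<theta> v < lo c})"
        using card_Un_le[of "{v \<in> Y c. hi c < \<theta> v}" "{v \<in> Y c. \<theta> v < lo c}"] by linarith
      ultimately show "real (card ({v \<in> Y c. hi c < \<theta> v} \<union> {v \<in> Y c. \<theta> v < lo c})) \<le> 2 * (\<delta> * n)"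
        by linarith
    qed
    also have "\<dots> = 2 * k * \<delta> * n" by simp
    finally obtain v where v: "v \<in> X - X'" "\<forall>\<pi>\<in>profiles. card (attached v X' \<pi>) \<ge> 2"
      using X(2)[OF sub] by blast
    have "card (attached v X' (restrict \<pi> {..<k})) \<ge> 2" using v(2) profile_restrict(1)[of \<pi>] \<pi> by blast
    then have "card (attached v X' \<pi>) \<ge> 2" using profile_restrict(2)[of \<pi>] \<pi> by simp
    then have "attached v X' \<pi> \<noteq> {}" by (intro notI) simp
    then obtain e where e: "e \<in> G" "v \<in> e" "e - {v} \<subseteq> X'" "\<forall>u\<in>e - {v}. part_of d u = \<pi> (fst u)"
      unfolding attached_def by blast
    have pv: "part_of d v = \<pi> (fst v)" "\<theta> v \<noteq> hi (fst v)" "v \<in> X" using v(1) unfolding X'_def by auto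
    have fin: "finite e" using edge_finite[OF eK[OF e(1)]] .
    have "e \<subseteq> X" using e(3) pv(3) unfolding X'_def by blast
    moreover have "part_of d u = \<pi> (fst u)" if "u \<in> e" for u using that e(4) pv(1) by (cases "u = v") auto
    ultimately have "(\<Sum>u\<in>e. \<theta> u) = 0" using ker e(1) by blast
    then have 1: "\<theta> v + (\<Sum>u\<in>e - {v}. \<theta> u) = 0" using fin e(2) by (simp add: sum.remove)
    have "(\<Sum>u\<in>e. hi (fst u)) = 0"
      using edge_sum_class[OF eK[OF e(1)], of "\<lambda>u. hi (fst u)" hi] sum0 by simp
    then have 2: "hi (fst v) + (\<Sum>u\<in>e - {v}. hi (fst u)) = 0" using fin e(2) by (simp add: sum.remove)
    have "(\<Sum>u\<in>e - {v}. \<theta> u) = (\<Sum>u\<in>e - {v}. hi (fst u))"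
      using e(3,4) by (intro sum.cong) (auto simp: X'_def)
    then show False using 1 2 pv(2) by simp
  qed
  then have "\<forall>u\<in>X. part_of d u = \<pi> (fst u) \<longrightarrow> \<theta> u = hi (fst u)" unfolding X'_def by blast
  then show ?thesis by blast
qed

lemma core_exists:
  "\<exists>X. rigid_core k n d G X (part_of d) \<and> card (vertices k n - X) \<le> (k * real ((d + 1) ^ k) + 2 * k) * \<delta> * n"
proof -
  obtain X where X: "X \<in> peeled" "\<And>X'. X' \<subset> X \<Longrightarrow> card (X - X') \<le> 2 * k * \<delta> * n \<Longrightarrow>
    \<exists>v\<in>X - X'. \<forall>\<pi>\<in>profiles. card (attached v X' \<pi>) \<ge> 2" using minimal_peeled by blast
  have XV: "X \<subseteq> vertices k n" and Xc: "card (vertices k n - X) \<le> (k * real ((d + 1) ^ k) + 2 * k) * \<delta> * n"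
    using X(1) unfolding peeled_def by auto
  have "rigid_core k n d G X (part_of d)"
  proof
    show "k \<ge> 3" "G \<subseteq> complete_edges k n" "X \<subseteq> vertices k n" using k3 GK XV by auto
  next
    fix \<pi> :: "nat \<Rightarrow> nat" and \<theta> :: "vertex \<Rightarrow> complex" and u u'
    assume \<pi>: "\<And>c. \<pi> c \<le> d"
      and ker: "\<And>e. e \<in> G \<Longrightarrow> e \<subseteq> X \<Longrightarrow> (\<And>u. u \<in> e \<Longrightarrow> part_of d u = \<pi> (fst u)) \<Longrightarrow> (\<Sum>u\<in>e. \<theta> u) = (0 :: complex)"
      and u: "u \<in> X" "u' \<in> X" "fst u = fst u'" "part_of d u = \<pi> (fst u)" "part_of d u' = \<pi> (fst u)"
    have "(\<Sum>u\<in>e. Re (\<theta> u)) = 0" "(\<Sum>u\<in>e. Im (\<theta> u)) = 0"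
      if "e \<in> G" "e \<subseteq> X" "\<And>u. u \<in> e \<Longrightarrow> part_of d u = \<pi> (fst u)" for e
      using ker[OF that] by (auto simp: Re_sum[symmetric] Im_sum[symmetric])
    then have "\<exists>q. \<forall>u\<in>X. part_of d u = \<pi> (fst u) \<longrightarrow> Re (\<theta> u) = q (fst u)"
      "\<exists>q. \<forall>u\<in>X. part_of d u = \<pi> (fst u) \<longrightarrow> Im (\<theta> u) = q (fst u)"
      by (auto intro!: real_kernel_constant[OF X \<pi>])
    then obtain q r where "\<forall>u\<in>X. part_of d u = \<pi> (fst u) \<longrightarrow> Re (\<theta> u) = q (fst u)"
      "\<forall>u\<in>X. part_of d u = \<pi> (fst u) \<longrightarrow> Im (\<theta> u) = r (fst u)" by blast
    then show "\<theta> u = \<theta> u'" using u by (simp add: complex_eq_iff)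
  next
    fix \<pi> :: "nat \<Rightarrow> nat" and v assume v: "v \<in> X" and \<pi>: "\<And>c. \<pi> c \<le> d"
    \<comment> \<open>Minimality, applied to the deletion of \<open>v\<close> alone, yields both
      edges.\<close>
    have single: "X - (X - {v}) = {v}" using v by blast
    have "\<exists>v'\<in>X - (X - {v}). \<forall>\<pi>\<in>profiles. card (attached v' (X - {v}) \<pi>) \<ge> 2"
    proof (rule X(2))
      show "X - {v} \<subset> X" using v by blast
      show "card (X - (X - {v})) \<le> 2 * k * \<delta> * n" unfolding single using n1 by simp
    qed
    then have "\<forall>\<pi>\<in>profiles. card (attached v (X - {v}) \<pi>) \<ge> 2" unfolding single by blast
    then have "card (attached v (X - {v}) (restrict \<pi> {..<k})) \<ge> 2" using profile_restrict(1)[of \<pi>] \<pi> by blast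
    then have "card (attached v (X - {v}) \<pi>) \<ge> 2" using profile_restrict(2)[of \<pi>] \<pi> by simp
    then obtain A where "A \<subseteq> attached v (X - {v}) \<pi>" "card A = 2" by (rule obtain_subset_with_card_n)
    then obtain e e' where "e \<in> attached v (X - {v}) \<pi>" "e' \<in> attached v (X - {v}) \<pi>" "e \<noteq> e'"
      by (auto simp: card_2_iff)
    then show "\<exists>e\<in>G. \<exists>e'\<in>G. e \<noteq> e' \<and> v \<in> e \<and> v \<in> e' \<and> e - {v} \<subseteq> X \<and> e' - {v} \<subseteq> X \<and>
      (\<forall>u\<in>e - {v}. part_of d u = \<pi> (fst u)) \<and> (\<forall>u\<in>e' - {v}. part_of d u = \<pi> (fst u))"
      unfolding attached_def by (intro bexI[of _ e] bexI[of _ e']) auto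
  next
    fix c j assume "c < k" "j \<le> d"
    then have "2 * \<delta> * n \<le> card {v \<in> X. fst v = c \<and> part_of d v = j}" by (rule part_in_peeled[OF XV Xc])
    moreover have "0 < 2 * \<delta> * n" using \<delta>0 n0 by simp
    ultimately have "{v \<in> X. fst v = c \<and> part_of d v = j} \<noteq> {}" by (intro notI) simp
    then show "\<exists>v\<in>X. fst v = c \<and> part_of d v = j" by blast
  qed
  then show ?thesis using Xc by blast
qed

end

section \<open>Edge orders with good initial segments\<close>

text \<open>Further edges only add equations to the premise of \<open>kernel\<close> and candidates
  for \<open>two_edges\<close>. A core found in the early graph thus survives until the hitting
  time.\<close>

lemma rigid_core_mono:
  assumes "rigid_core k n d G X block" "G \<subseteq> H" "H \<subseteq> complete_edges k n"
  shows "rigid_core k n d H X block"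
proof -
  interpret rigid_core k n d G X block by fact
  show ?thesis
  proof
    show "3 \<le> k" "H \<subseteq> complete_edges k n" "X \<subseteq> vertices k n" using k3 assms XV by auto
  next
    fix \<pi> :: "nat \<Rightarrow> nat" and \<theta> :: "vertex \<Rightarrow> complex" and u u'
    assume \<pi>: "\<And>c. \<pi> c \<le> d"
      and ker: "\<And>e. e \<in> H \<Longrightarrow> e \<subseteq> X \<Longrightarrow> (\<And>u. u \<in> e \<Longrightarrow> block u = \<pi> (fst u)) \<Longrightarrow> (\<Sum>u\<in>e. \<theta> u) = 0"
      and u: "u \<in> X" "u' \<in> X" "fst u = fst u'" "block u = \<pi> (fst u)" "block u' = \<pi> (fst u)"
    show "\<theta> u = \<theta> u'"
    proof (rule kernel[of \<pi> \<theta> u u', OF \<pi> _ u])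
      fix e assume e: "e \<in> G" "e \<subseteq> X" "\<And>u. u \<in> e \<Longrightarrow> block u = \<pi> (fst u)"
      show "(\<Sum>u\<in>e. \<theta> u) = 0" using ker[OF subsetD[OF assms(2) e(1)] e(2,3)] .
    qed
  next
    fix \<pi> :: "nat \<Rightarrow> nat" and v assume "v \<in> X" "\<And>c. \<pi> c \<le> d"
    from two_edges[where v = v and \<pi> = \<pi>, OF this] obtain e e' where e: "e \<in> G" "e' \<in> G" "e \<noteq> e'"
      "v \<in> e" "v \<in> e'" "e - {v} \<subseteq> X" "e' - {v} \<subseteq> X"
      "\<forall>u\<in>e - {v}. block u = \<pi> (fst u)" "\<forall>u\<in>e' - {v}. block u = \<pi> (fst u)"
      by (elim bexE conjE) (rule that)
    show "\<exists>e\<in>H. \<exists>e'\<in>H. e \<noteq> e' \<and> v \<in> e \<and> v \<in> e' \<and> e - {v} \<subseteq> X \<and> e' - {v} \<subseteq> X \<and>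
      (\<forall>u\<in>e - {v}. block u = \<pi> (fst u)) \<and> (\<forall>u\<in>e' - {v}. block u = \<pi> (fst u))"
      by (intro bexI[of _ e] bexI[of _ e'] conjI e subsetD[OF assms(2)])
  next
    fix c j assume "c < k" "j \<le> d"
    then show "\<exists>v\<in>X. fst v = c \<and> block v = j" by (rule base)
  qed
qed

lemma min_degree_ge_iff:
  assumes "k > 0" "n > 0"
  shows "s \<le> min_degree k n G \<longleftrightarrow> (\<forall>v\<in>vertices k n. s \<le> card {e \<in> G. v \<in> e})"
proof -
  have "(0, 0) \<in> vertices k n" using assms by (simp add: mem_vertices)
  then have "vertices k n \<noteq> {}" by blast
  then show ?thesis unfolding min_degree_def vertex_degree_def by (subst Min_ge_iff) auto
qed

text \<open>If the closure of the core under adding vertices with \<open>d + 1\<close> edges into the current set were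
  not everything, its complement \<open>R\<close> would have few edges meeting it exactly once, although its
  vertices are all covered by edges meeting it at least twice.\<close>

lemma nondefective_of_good_order:
  fixes \<delta> :: real
  assumes k3: "k \<ge> 3" and d: "d \<ge> 1" and es: "set es = complete_edges k n"
    and \<delta>0: "\<delta> > 0" and nd: "d + 1 \<le> n" and n1: "2 * k * \<delta> * n \<ge> 1"
    and \<delta>1: "\<delta> * (k * real ((d + 1) ^ k) + 2 * k + 2) * (2 * (d + 1)) \<le> 1"
    and \<delta>2: "(k * real ((d + 1) ^ k) + 2 * k) * \<delta> \<le> 1 / 32"
    and m: "m1 \<le> m2"
    and isolated: "\<exists>v\<in>vertices k n. \<forall>e\<in>set (take m1 es). v \<notin> e"
    and degree: "\<And>v. v \<in> vertices k n \<Longrightarrow> d + 1 \<le> card {e \<in> set (take m2 es). v \<in> e}"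
    and expand: "\<And>R. R \<subseteq> vertices k n \<Longrightarrow> R \<noteq> {} \<Longrightarrow> card R \<le> n / 32 \<Longrightarrow>
      card {e \<in> set (take m1 es). card (e \<inter> R) = 1} \<le> d * card R \<Longrightarrow>
      card R \<le> (\<Sum>e\<in>set (take m2 es). if card (e \<inter> R) \<ge> 2 then card (e \<inter> R) else 0) \<Longrightarrow> False"
    and box: "\<And>T. (\<And>c. c < k \<Longrightarrow> T c \<subseteq> vertices k n \<and> (\<forall>v\<in>T c. fst v = c) \<and> \<delta> * n \<le> card (T c)) \<Longrightarrow>
      card {e \<in> set (take m1 es). \<forall>v\<in>e. v \<in> T (fst v)} > n"
  shows "let G = process_graph es (hitting_time k n (d + 1) es)
    in tangentially_weakly_nondefective G (graph_variety k n G) d"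
proof -
  define M where "M = hitting_time k n (d + 1) es"
  define G where "G = set (take M es)"
  let ?G1 = "set (take m1 es)" and ?G2 = "set (take m2 es)"
  have kn: "k > 0" "n > 0" using k3 nd by auto
  have m2: "d + 1 \<le> min_degree k n (process_graph es m2)"
    unfolding min_degree_ge_iff[OF kn] process_graph_def using degree by blast
  have Mm2: "M \<le> m2" unfolding M_def hitting_time_def by (rule Least_le[where P = "\<lambda>m. d + 1 \<le> min_degree k n (process_graph es m)", OF m2])
  have "d + 1 \<le> min_degree k n (process_graph es M)"
    unfolding M_def hitting_time_def by (rule LeastI[of "\<lambda>m. d + 1 \<le> min_degree k n (process_graph es m)", OF m2])
  then have degM: "d + 1 \<le> card {e \<in> G. v \<in> e}" if "v \<in> vertices k n" for v
    using that unfolding min_degree_ge_iff[OF kn] process_graph_def G_def by blast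
  \<comment> \<open>A vertex isolated after \<open>m1\<close> edges rules out minimum degree
    \<open>d + 1\<close> at any earlier time.\<close>
  have "m1 \<le> M"
  proof (rule ccontr)
    assume "\<not> ?thesis"
    then have sub: "G \<subseteq> ?G1" unfolding G_def by (intro set_take_subset_set_take) simp
    obtain v where v: "v \<in> vertices k n" "\<forall>e\<in>?G1. v \<notin> e" using isolated by blast
    then have "card {e \<in> G. v \<in> e} = card ({} :: vertex set set)" using sub by (intro arg_cong[of _ _ card]) blast
    then show False using degM[OF v(1)] by (simp only: card.empty)
  qed
  then have G1: "?G1 \<subseteq> G" unfolding G_def by (rule set_take_subset_set_take)
  have G2: "G \<subseteq> ?G2" unfolding G_def using Mm2 by (rule set_take_subset_set_take)
  have GK: "G \<subseteq> complete_edges k n" unfolding G_def es[symmetric] by (rule set_take_subset)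
  have fin: "finite G" "finite ?G1" "finite ?G2" unfolding G_def by auto
  have G1K: "?G1 \<subseteq> complete_edges k n" using G1 GK by blast
  have boxes: "dense_boxes k n d ?G1 \<delta>"
  proof
    fix T :: "nat \<Rightarrow> vertex set"
    assume "\<And>c. c < k \<Longrightarrow> T c \<subseteq> vertices k n \<and> (\<forall>v\<in>T c. fst v = c) \<and> \<delta> * n \<le> card (T c)"
    then show "card {e \<in> ?G1. \<forall>v\<in>e. v \<in> T (fst v)} > n" by (rule box)
  qed (use k3 G1K \<delta>0 nd n1 \<delta>1 in \<open>simp_all add: add_ac\<close>)
  obtain X where X: "rigid_core k n d ?G1 X (part_of d)"
    "card (vertices k n - X) \<le> (k * real ((d + 1) ^ k) + 2 * k) * \<delta> * n"
    using dense_boxes.core_exists[OF boxes] by blast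
  have core: "rigid_core k n d G X (part_of d)" using X(1) G1 GK by (rule rigid_core_mono)
  have Xsmall: "card (vertices k n - X) \<le> n / 32"
    using X(2) mult_right_mono[OF \<delta>2, of "real n"] by simp
  have "tangentially_weakly_nondefective G (graph_variety k n G) d"
  proof (rule nondefective_of_core[OF core d])
    fix Y assume Y: "X \<subseteq> Y" "Y \<subset> vertices k n"
    define R where "R = vertices k n - Y"
    have RV: "R \<subseteq> vertices k n" "R \<noteq> {}" unfolding R_def using Y by auto
    have finR: "finite R" using RV(1) finite_vertices by (rule finite_subset)
    have "card R \<le> card (vertices k n - X)" unfolding R_def using Y by (intro card_mono) auto
    then have Rs: "card R \<le> n / 32" using Xsmall by linarith
    show "\<exists>v\<in>vertices k n - Y. d + 1 \<le> card {e \<in> G. v \<in> e \<and> e - {v} \<subseteq> Y}"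
    proof (rule ccontr)
      assume "\<not> ?thesis"
      then have few: "card {e \<in> G. v \<in> e \<and> e - {v} \<subseteq> Y} \<le> d" if "v \<in> R" for v
        using that unfolding R_def by force
      have eV: "e \<subseteq> vertices k n" if "e \<in> G" for e using that GK edge_subset by blast
      \<comment> \<open>An edge meeting \<open>R\<close> exactly once is an extension edge of its
        vertex in \<open>R\<close>, and every vertex of \<open>R\<close> has at most
        \<open>d\<close> of these when the extension is stuck.\<close>
      have "{e \<in> ?G1. card (e \<inter> R) = 1} \<subseteq> (\<Union>v\<in>R. {e \<in> G. v \<in> e \<and> e - {v} \<subseteq> Y})"
      proof
        fix e assume e: "e \<in> {e \<in> ?G1. card (e \<inter> R) = 1}"
        then obtain v where v: "e \<inter> R = {v}" using card_1_singletonE by blast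
        moreover have "e \<in> G" using e G1 by blast
        ultimately have "v \<in> R" "e \<in> G" "v \<in> e" "e - {v} \<subseteq> Y"
          using eV unfolding R_def by blast+
        then show "e \<in> (\<Union>v\<in>R. {e \<in> G. v \<in> e \<and> e - {v} \<subseteq> Y})" by blast
      qed
      then have "card {e \<in> ?G1. card (e \<inter> R) = 1} \<le> card (\<Union>v\<in>R. {e \<in> G. v \<in> e \<and> e - {v} \<subseteq> Y})"
        using fin finR by (intro card_mono) auto
      also have "\<dots> \<le> (\<Sum>v\<in>R. card {e \<in> G. v \<in> e \<and> e - {v} \<subseteq> Y})" by (rule card_UN_le[OF finR])
      also have "\<dots> \<le> (\<Sum>v\<in>R. d)" using few by (intro sum_mono) auto
      finally have 1: "card {e \<in> ?G1. card (e \<inter> R) = 1} \<le> d * card R" by (simp add: mult.commute)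
      define D where "D = {e \<in> ?G2. card (e \<inter> R) \<ge> 2}"
      have "R \<subseteq> (\<Union>e\<in>D. e \<inter> R)"
      proof
        fix v assume v: "v \<in> R"
        \<comment> \<open>At the hitting time \<open>v\<close> has more edges than extension edges,
          so some edge at \<open>v\<close> has a second vertex in \<open>R\<close>.\<close>
        have "\<not> {e \<in> G. v \<in> e} \<subseteq> {e \<in> G. v \<in> e \<and> e - {v} \<subseteq> Y}"
        proof
          assume "{e \<in> G. v \<in> e} \<subseteq> {e \<in> G. v \<in> e \<and> e - {v} \<subseteq> Y}"
          then have "card {e \<in> G. v \<in> e} \<le> card {e \<in> G. v \<in> e \<and> e - {v} \<subseteq> Y}"
            using fin(1) by (intro card_mono) auto
          moreover have "d + 1 \<le> card {e \<in> G. v \<in> e}" using degM v RV(1) by blast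
          ultimately show False using few[OF v] by linarith
        qed
        then obtain e u where e: "e \<in> G" "v \<in> e" "u \<in> e" "u \<noteq> v" "u \<notin> Y" by blast
        then have "u \<in> R" using eV unfolding R_def by blast
        then have "{u, v} \<subseteq> e \<inter> R" using e v by blast
        then have "card {u, v} \<le> card (e \<inter> R)" using finR by (intro card_mono) auto
        then have "e \<in> D" using e G2 unfolding D_def by auto
        then show "v \<in> (\<Union>e\<in>D. e \<inter> R)" using e(2) v by blast
      qed
      then have "card R \<le> card (\<Union>e\<in>D. e \<inter> R)"
        using finR fin by (intro card_mono) (auto simp: D_def)
      also have "\<dots> \<le> (\<Sum>e\<in>D. card (e \<inter> R))" by (rule card_UN_le) (simp add: D_def)
      also have "\<dots> = (\<Sum>e\<in>?G2. if card (e \<inter> R) \<ge> 2 then card (e \<inter> R) else 0)"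
        unfolding D_def by (rule sum.inter_filter) simp
      finally show False using expand[OF RV Rs 1] by blast
    qed
  qed
  then show ?thesis by (simp add: Let_def process_graph_def G_def M_def)
qed

section \<open>Counting lists of edges\<close>

text \<open>Lists may repeat edges: this is the model of \<open>m\<close> independent uniform edges,
  in which product weights factorise. Orders without repetition are reached in
  \<open>prefix_probability\<close> at the cost of a factor 2.\<close>

definition edge_lists :: "nat \<Rightarrow> nat \<Rightarrow> nat \<Rightarrow> vertex set list set" where
  "edge_lists k n m = {l. set l \<subseteq> complete_edges k n \<and> length l = m}"

lemma finite_edge_lists: "finite (edge_lists k n m)"
  unfolding edge_lists_def by (rule finite_lists_length_eq) simp

section \<open>Counting edges by product weights\<close>

lemma edges_bij:
  "bij_betw (\<lambda>g. (\<lambda>c. (c, g c)) ` {..<k}) ({..<k} \<rightarrow>\<^sub>E {..<n}) (complete_edges k n)"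
  unfolding bij_betw_def
proof (intro conjI inj_onI equalityI subsetI)
  fix g h assume g: "g \<in> {..<k} \<rightarrow>\<^sub>E {..<n}" and h: "h \<in> {..<k} \<rightarrow>\<^sub>E {..<n}"
    and eq: "(\<lambda>c. (c, g c)) ` {..<k} = (\<lambda>c. (c, h c)) ` {..<k}"
  show "g = h"
  proof (rule PiE_ext[OF g h])
    fix c assume "c \<in> {..<k}"
    then have "(c, g c) \<in> (\<lambda>c. (c, h c)) ` {..<k}" unfolding eq[symmetric] by blast
    then show "g c = h c" by auto
  qed
next
  fix e assume "e \<in> (\<lambda>g. (\<lambda>c. (c, g c)) ` {..<k}) ` ({..<k} \<rightarrow>\<^sub>E {..<n})"
  then obtain g where g2: "e = (\<lambda>c. (c, g c)) ` {..<k}" and g1: "g \<in> {..<k} \<rightarrow>\<^sub>E {..<n}"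
    by (elim imageE) (rule that)
  have gn: "g c < n" if "c < k" for c using PiE_mem[OF g1, of c] that by simp
  have "e \<subseteq> vertices k n" unfolding g2 using gn by (simp add: image_subset_iff mem_vertices)
  moreover have "fst ` e = {..<k}" unfolding g2 by (simp add: image_image)
  moreover have "inj_on fst e" unfolding g2 by (simp add: inj_on_def)
  ultimately have "e \<subseteq> vertices k n" "bij_betw fst e {..<k}" by (simp_all add: bij_betw_def)
  then show "e \<in> complete_edges k n" by (simp add: complete_edges_iff)
next
  fix e assume e: "e \<in> complete_edges k n"
  have "\<forall>c. \<exists>v. c < k \<longrightarrow> v \<in> e \<and> fst v = c" using edge_vertex_ex[OF e] by metis
  then obtain f where f: "\<And>c. c < k \<Longrightarrow> f c \<in> e \<and> fst (f c) = c" by metis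
  define g where "g = restrict (\<lambda>c. snd (f c)) {..<k}"
  have fg: "f c = (c, g c)" if "c < k" for c using f[OF that] that by (simp add: g_def prod_eq_iff)
  have "g \<in> {..<k} \<rightarrow>\<^sub>E {..<n}"
  proof (rule PiE_I)
    fix c assume c: "c \<in> {..<k}"
    then have "f c \<in> vertices k n" using f edge_subset[OF e] by blast
    then show "g c \<in> {..<n}" using c by (simp add: mem_vertices g_def)
  qed (simp add: g_def)
  moreover have "e = (\<lambda>c. (c, g c)) ` {..<k}"
  proof (intro equalityI subsetI)
    fix v assume v: "v \<in> e"
    then have c: "fst v < k" using edge_subset[OF e] mem_vertices by blast
    have "v = f (fst v)" using edge_inj[OF e v, of "f (fst v)"] f[OF c] by simp
    then have "v = (fst v, g (fst v))" using fg[OF c] by simp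
    then show "v \<in> (\<lambda>c. (c, g c)) ` {..<k}" using c by blast
  next
    fix v assume "v \<in> (\<lambda>c. (c, g c)) ` {..<k}"
    then obtain c where "c < k" "v = (c, g c)" by auto
    then show "v \<in> e" using f[of c] fg[of c] by simp
  qed
  ultimately show "e \<in> (\<lambda>g. (\<lambda>c. (c, g c)) ` {..<k}) ` ({..<k} \<rightarrow>\<^sub>E {..<n})" by blast
qed

text \<open>An edge is a free choice of one vertex per class, so a product weight factorises over
  the classes.\<close>

lemma sum_edges_prod:
  fixes w :: "vertex \<Rightarrow> real"
  shows "(\<Sum>e\<in>complete_edges k n. \<Prod>v\<in>e. w v) = (\<Prod>c<k. \<Sum>a<n. w (c, a))"
proof -
  have "(\<Sum>e\<in>complete_edges k n. \<Prod>v\<in>e. w v)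
    = (\<Sum>g\<in>{..<k} \<rightarrow>\<^sub>E {..<n}. \<Prod>v\<in>(\<lambda>c. (c, g c)) ` {..<k}. w v)"
    by (rule sum.reindex_bij_betw[OF edges_bij, symmetric])
  also have "\<dots> = (\<Sum>g\<in>{..<k} \<rightarrow>\<^sub>E {..<n}. \<Prod>c<k. w (c, g c))"
    by (intro sum.cong refl) (subst prod.reindex, auto simp: inj_on_def)
  also have "\<dots> = (\<Prod>c<k. \<Sum>a<n. w (c, a))" by (rule prod_sum_PiE[symmetric]) auto
  finally show ?thesis .
qed

lemma card_edges_subset:
  "card {e \<in> complete_edges k n. e \<subseteq> S} = (\<Prod>c<k. card {a. a < n \<and> (c, a) \<in> S})"
proof -
  let ?w = "\<lambda>v. if v \<in> S then 1 else 0 :: real"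
  have "(\<Prod>v\<in>e. ?w v) = (if e \<subseteq> S then 1 else 0)" if "e \<in> complete_edges k n" for e
  proof (cases "e \<subseteq> S")
    case True
    then show ?thesis by (auto intro!: prod.neutral)
  next
    case False
    then show ?thesis using edge_finite[OF that] by (auto simp: prod_zero_iff)
  qed
  then have "(\<Sum>e\<in>complete_edges k n. \<Prod>v\<in>e. ?w v) = (\<Sum>e\<in>complete_edges k n. if e \<subseteq> S then 1 else 0)"
    by (intro sum.cong) auto
  also have "\<dots> = real (card {e \<in> complete_edges k n. e \<subseteq> S})"
    by (subst sum.inter_filter[symmetric]) auto
  finally have "real (card {e \<in> complete_edges k n. e \<subseteq> S}) = (\<Prod>c<k. \<Sum>a<n. ?w (c, a))"
    using sum_edges_prod[of ?w k n] by simp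
  also have "\<dots> = (\<Prod>c<k. real (card {a. a < n \<and> (c, a) \<in> S}))"
    by (rule prod.cong[OF refl], subst sum.inter_filter[symmetric]) auto
  finally show ?thesis by (simp only: of_nat_prod[symmetric] of_nat_eq_iff)
qed

lemma card_complete_edges: "card (complete_edges k n) = n ^ k"
  using card_edges_subset[of k n UNIV] by simp

lemma card_edges_vertex:
  assumes v: "v \<in> vertices k n"
  shows "card {e \<in> complete_edges k n. v \<in> e} = n ^ (k - 1)"
proof -
  let ?S = "{w. fst w = fst v \<longrightarrow> w = v}"
  have vk: "fst v < k" "snd v < n" using v by (auto simp: mem_vertices)
  have "e \<subseteq> ?S \<longleftrightarrow> v \<in> e" if e: "e \<in> complete_edges k n" for e
  proof
    assume sub: "e \<subseteq> ?S"
    obtain w where "w \<in> e" "fst w = fst v" using edge_vertex_ex[OF e vk(1)] by blast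
    then show "v \<in> e" using sub by blast
  next
    assume "v \<in> e"
    then show "e \<subseteq> ?S" using edge_inj[OF e] by blast
  qed
  then have "{e \<in> complete_edges k n. v \<in> e} = {e \<in> complete_edges k n. e \<subseteq> ?S}" by blast
  then have "card {e \<in> complete_edges k n. v \<in> e} = (\<Prod>c<k. card {a. a < n \<and> (c, a) \<in> ?S})"
    by (simp only: card_edges_subset)
  also have "\<dots> = (\<Prod>c<k. if c = fst v then 1 else n)"
  proof (rule prod.cong[OF refl])
    fix c
    have "{a. a < n \<and> (c, a) \<in> ?S} = (if c = fst v then {snd v} else {..<n})"
      using vk by (cases v) auto
    then show "card {a. a < n \<and> (c, a) \<in> ?S} = (if c = fst v then 1 else n)" by simp
  qed
  also have "\<dots> = (\<Prod>c\<in>{..<k} - {fst v}. n)"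
    using vk(1) by (subst prod.remove[of _ "fst v"]) (auto intro!: prod.cong)
  also have "\<dots> = n ^ (k - 1)" using vk(1) by simp
  finally show ?thesis .
qed

lemma card_edges_two_vertices:
  assumes u: "u \<in> vertices k n" and v: "v \<in> vertices k n" and uv: "u \<noteq> v"
  shows "card {e \<in> complete_edges k n. u \<in> e \<and> v \<in> e} \<le> n ^ (k - 2)"
proof (cases "fst u = fst v")
  case True
  then have "{e \<in> complete_edges k n. u \<in> e \<and> v \<in> e} = {}" using edge_inj uv by blast
  then show ?thesis by (metis card.empty le0)
next
  case False
  let ?S = "{w. (fst w = fst v \<longrightarrow> w = v) \<and> (fst w = fst u \<longrightarrow> w = u)}"
  have vk: "fst v < k" "snd v < n" "fst u < k" "snd u < n" using u v by (auto simp: mem_vertices)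
  have "{e \<in> complete_edges k n. u \<in> e \<and> v \<in> e} \<subseteq> {e \<in> complete_edges k n. e \<subseteq> ?S}"
    using edge_inj by blast
  then have "card {e \<in> complete_edges k n. u \<in> e \<and> v \<in> e} \<le> card {e \<in> complete_edges k n. e \<subseteq> ?S}"
    by (intro card_mono) auto
  also have "\<dots> = (\<Prod>c<k. card {a. a < n \<and> (c, a) \<in> ?S})" by (rule card_edges_subset)
  also have "\<dots> = (\<Prod>c<k. if c = fst v \<or> c = fst u then 1 else n)"
  proof (rule prod.cong[OF refl])
    fix c
    have "{a. a < n \<and> (c, a) \<in> ?S} = (if c = fst v then {snd v} else if c = fst u then {snd u} else {..<n})"
      using vk False by (cases v; cases u) auto
    then show "card {a. a < n \<and> (c, a) \<in> ?S} = (if c = fst v \<or> c = fst u then 1 else n)" by simp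
  qed
  also have "\<dots> = (\<Prod>c\<in>{..<k} - {fst u, fst v}. n)"
    by (rule prod.mono_neutral_cong_right) auto
  also have "\<dots> = n ^ (k - 2)" using vk False by (simp add: card_Diff_subset numeral_2_eq_2)
  finally show ?thesis .
qed

section \<open>Exponential moments over lists of independent edges\<close>

lemma sum_edge_lists_prod:
  fixes f :: "nat \<Rightarrow> vertex set \<Rightarrow> real"
  shows "(\<Sum>l\<in>edge_lists k n m. \<Prod>i<m. f i (l ! i)) = (\<Prod>i<m. \<Sum>e\<in>complete_edges k n. f i e)"
proof (induction m arbitrary: f)
  case 0
  have "edge_lists k n 0 = {[]}" by (auto simp: edge_lists_def)
  then show ?case by simp
next
  case (Suc m)
  let ?K = "complete_edges k n"
  have img: "edge_lists k n (Suc m) = (\<lambda>(e, l). e # l) ` (?K \<times> edge_lists k n m)"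
    by (force simp: edge_lists_def length_Suc_conv image_iff)
  have "(\<Sum>l\<in>edge_lists k n (Suc m). \<Prod>i<Suc m. f i (l ! i))
    = (\<Sum>(e, l)\<in>?K \<times> edge_lists k n m. \<Prod>i<Suc m. f i ((e # l) ! i))"
    unfolding img by (subst sum.reindex) (auto simp: inj_on_def split_beta)
  also have "\<dots> = (\<Sum>(e, l)\<in>?K \<times> edge_lists k n m. f 0 e * (\<Prod>i<m. f (Suc i) (l ! i)))"
    by (intro sum.cong refl) (auto simp: prod.lessThan_Suc_shift simp del: prod.lessThan_Suc)
  also have "\<dots> = (\<Sum>e\<in>?K. f 0 e) * (\<Sum>l\<in>edge_lists k n m. \<Prod>i<m. f (Suc i) (l ! i))"
    by (simp only: sum_product sum.cartesian_product)
  also have "\<dots> = (\<Sum>e\<in>?K. f 0 e) * (\<Prod>i<m. \<Sum>e\<in>?K. f (Suc i) e)" by (simp only: Suc.IH[of "\<lambda>i. f (Suc i)"])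
  also have "\<dots> = (\<Prod>i<Suc m. \<Sum>e\<in>?K. f i e)" by (rule prod.lessThan_Suc_shift[symmetric])
  finally show ?case .
qed

lemma card_edge_lists: "card (edge_lists k n m) = (n ^ k) ^ m"
  unfolding edge_lists_def by (subst card_lists_length_eq) (auto simp: card_complete_edges)

text \<open>Markov's inequality in counting form.\<close>

lemma card_le_sum_weights:
  fixes c :: real
  assumes "finite A" "B \<subseteq> A" "\<And>l. l \<in> A \<Longrightarrow> W l \<ge> (0 :: real)" "\<And>l. l \<in> B \<Longrightarrow> c \<le> W l"
  shows "card B * c \<le> (\<Sum>l\<in>A. W l)"
proof -
  have "card B * c = (\<Sum>l\<in>B. c)" by simp
  also have "\<dots> \<le> (\<Sum>l\<in>B. W l)" using assms by (intro sum_mono) auto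
  also have "\<dots> \<le> (\<Sum>l\<in>A. W l)" using assms by (intro sum_mono2) auto
  finally show ?thesis .
qed

lemma prod_if_power:
  fixes a :: real
  assumes "finite A"
  shows "(\<Prod>i\<in>A. if P i then a else 1) = a ^ card {i \<in> A. P i}"
  using assms by (subst prod.inter_filter[symmetric]) auto

text \<open>Chernoff bound: each edge with \<open>P\<close> gets weight \<open>q \<le> 1\<close>, so
  a list with at most \<open>s\<close> of them has weight at least \<open>q ^ s\<close>, while the
  total weight of all lists is the power of a sum over single edges.\<close>

lemma lower_tail_count:
  fixes q :: real
  assumes l: "0 < q" "q \<le> 1"
  shows "card {l \<in> edge_lists k n m. card {i \<in> {..<m}. P (l ! i)} \<le> s} * q ^ s
    \<le> (real n ^ k - (1 - q) * card {e \<in> complete_edges k n. P e}) ^ m"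
proof -
  let ?K = "complete_edges k n"
  let ?W = "\<lambda>l. \<Prod>i<m. if P (l ! i) then q else 1"
  let ?B = "{l \<in> edge_lists k n m. card {i \<in> {..<m}. P (l ! i)} \<le> s}"
  have "q ^ s \<le> ?W es" if "es \<in> ?B" for es
  proof -
    have "q ^ s \<le> q ^ card {i \<in> {..<m}. P (es ! i)}" using l that by (intro power_decreasing) auto
    then show ?thesis by (simp only: prod_if_power[OF finite_lessThan])
  qed
  moreover have "0 \<le> ?W es" for es using l by (intro prod_nonneg) auto
  ultimately have "card ?B * q ^ s \<le> (\<Sum>l\<in>edge_lists k n m. ?W l)"
    by (intro card_le_sum_weights[OF finite_edge_lists]) auto
  also have "\<dots> = (\<Prod>i<m. \<Sum>e\<in>?K. if P e then q else 1)"
    by (rule sum_edge_lists_prod[of "\<lambda>i e. if P e then q else 1"])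
  also have "(\<Sum>e\<in>?K. if P e then q else 1) = (\<Sum>e\<in>?K. 1 - (if P e then 1 - q else 0))"
    by (intro sum.cong) auto
  also have "\<dots> = real n ^ k - (1 - q) * card {e \<in> ?K. P e}"
    unfolding sum_subtractf
    by (subst sum.inter_filter[symmetric]) (auto simp: card_complete_edges mult.commute)
  finally show ?thesis by simp
qed

text \<open>The quadratic \<open>2 * y - y\<^sup>2\<close> is 0 at 0, 1 at 1 and not positive from 2
  on, so \<open>\<mu> ^ y\<close> minus \<open>\<mu> - \<theta>\<close> times it dominates the
  weight. Its sum needs only vertex degrees and codegrees, and the sum of \<open>\<mu> ^ y\<close>
  factorises over the classes. To first order \<open>\<mu>\<close> cancels and only
  \<open>- (1 - \<theta>) * x\<close> remains.\<close>

lemma sum_edge_weights: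
  assumes R: "R \<subseteq> vertices k n" and k: "k \<ge> 2" and n: "n > 0"
    and x: "x = card R / n" and \<mu>: "\<mu> \<ge> 1" "\<mu> * x \<le> 1" and \<theta>: "0 \<le> \<theta>" "\<theta> \<le> 1"
  shows "(\<Sum>e\<in>complete_edges k n. if card (e \<inter> R) \<ge> 2 then \<mu> ^ card (e \<inter> R) else if card (e \<inter> R) = 1 then \<theta> else 1)
    \<le> real n ^ k * (1 - (1 - \<theta>) * x + \<mu>\<^sup>2 * x\<^sup>2)"
proof -
  let ?K = "complete_edges k n"
  define y where "y e = card (e \<inter> R)" for e
  have finR: "finite R" using R finite_vertices by (rule finite_subset)
  have pw: "(if y e \<ge> 2 then \<mu> ^ y e else if y e = 1 then \<theta> else 1) \<le> \<mu> ^ y e - (\<mu> - \<theta>) * (2 * real (y e) - (real (y e))\<^sup>2)" for e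
  proof -
    consider "y e = 0" | "y e = 1" | "y e \<ge> 2" by linarith
    then show ?thesis
    proof cases
      case 3
      then have *: "2 * real (y e) \<le> (real (y e))\<^sup>2" unfolding power2_eq_square by (intro mult_right_mono) auto
      have "(\<mu> - \<theta>) * (2 * real (y e) - (real (y e))\<^sup>2) \<le> 0"
        using \<mu>(1) \<theta>(2) * by (intro mult_nonneg_nonpos) linarith+
      then show ?thesis using 3 by simp
    qed auto
  qed
  have y_sum: "real (y e) = (\<Sum>v\<in>R. if v \<in> e then 1 else 0)" for e
    unfolding y_def using finR by (subst sum.inter_filter[symmetric]) (auto intro!: arg_cong[of _ _ card])
  have s1: "(\<Sum>e\<in>?K. real (y e)) = card R * real n ^ (k - 1)"
  proof -
    have "(\<Sum>e\<in>?K. real (y e)) = (\<Sum>v\<in>R. \<Sum>e\<in>?K. if v \<in> e then 1 else 0)"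
      unfolding y_sum by (rule sum.swap)
    also have "\<dots> = (\<Sum>v\<in>R. real n ^ (k - 1))"
    proof (rule sum.cong[OF refl])
      fix v assume "v \<in> R"
      then have "card {e \<in> ?K. v \<in> e} = n ^ (k - 1)" using R by (intro card_edges_vertex) auto
      then show "(\<Sum>e\<in>?K. if v \<in> e then 1 else 0) = real n ^ (k - 1)"
        by (subst sum.inter_filter[symmetric]) auto
    qed
    finally show ?thesis by simp
  qed
  have s2: "(\<Sum>e\<in>?K. (real (y e))\<^sup>2) \<le> card R * real n ^ (k - 1) + (card R)\<^sup>2 * real n ^ (k - 2)"
  proof -
    have "(real (y e))\<^sup>2 = (\<Sum>u\<in>R. \<Sum>v\<in>R. if u \<in> e \<and> v \<in> e then 1 else 0)" for e
      unfolding power2_eq_square y_sum sum_product by (intro sum.cong) auto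
    then have "(\<Sum>e\<in>?K. (real (y e))\<^sup>2) = (\<Sum>e\<in>?K. \<Sum>u\<in>R. \<Sum>v\<in>R. if u \<in> e \<and> v \<in> e then 1 else 0)" by simp
    also have "\<dots> = (\<Sum>u\<in>R. \<Sum>v\<in>R. \<Sum>e\<in>?K. if u \<in> e \<and> v \<in> e then 1 else 0)"
      by (subst sum.swap, rule sum.cong[OF refl], rule sum.swap)
    also have "\<dots> = (\<Sum>u\<in>R. \<Sum>v\<in>R. real (card {e \<in> ?K. u \<in> e \<and> v \<in> e}))"
      by (rule sum.cong[OF refl], rule sum.cong[OF refl], subst sum.inter_filter[symmetric]) auto
    also have "\<dots> \<le> (\<Sum>u\<in>R. \<Sum>v\<in>R. (if u = v then real n ^ (k - 1) else 0) + real n ^ (k - 2))"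
    proof (intro sum_mono)
      fix u v assume uv: "u \<in> R" "v \<in> R"
      show "real (card {e \<in> ?K. u \<in> e \<and> v \<in> e}) \<le> (if u = v then real n ^ (k - 1) else 0) + real n ^ (k - 2)"
      proof (cases "u = v")
        case True
        then show ?thesis using card_edges_vertex[of v k n] uv R by auto
      next
        case False
        then have "card {e \<in> ?K. u \<in> e \<and> v \<in> e} \<le> n ^ (k - 2)" using uv R by (intro card_edges_two_vertices) auto
        then have "real (card {e \<in> ?K. u \<in> e \<and> v \<in> e}) \<le> real (n ^ (k - 2))" by (simp only: of_nat_le_iff)
        then show ?thesis using False by simp
      qed
    qed
    also have "\<dots> = card R * real n ^ (k - 1) + (card R)\<^sup>2 * real n ^ (k - 2)"
      using finR by (simp add: sum.distrib power2_eq_square distrib_left)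
    finally show ?thesis .
  qed
  have nk1: "real n ^ (k - 1) = real n ^ k / n" and nk2: "real n ^ (k - 2) = real n ^ k / n\<^sup>2"
    using n k by (simp_all add: power_diff)
  have lower: "real n ^ k * (x - x\<^sup>2) \<le> (\<Sum>e\<in>?K. 2 * real (y e) - (real (y e))\<^sup>2)"
  proof -
    have "real n ^ k * (x - x\<^sup>2) = card R * real n ^ (k - 1) - (card R)\<^sup>2 * real n ^ (k - 2)"
      unfolding x nk1 nk2 by (simp add: algebra_simps power_divide)
    also have "\<dots> \<le> (\<Sum>e\<in>?K. 2 * real (y e) - (real (y e))\<^sup>2)"
      unfolding sum_subtractf sum_distrib_left[symmetric] s1 using s2 by linarith
    finally show ?thesis .
  qed
  \<comment> \<open>The excess of the mean of \<open>\<mu> ^ y\<close> over 1, to first order. The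
    assumption \<open>\<mu> * x \<le> 1\<close> keeps it in the range where
    \<open>exp z \<le> 1 + z + z\<^sup>2\<close>.\<close>
  define z where "z = (\<mu> - 1) * x"
  have x0: "x \<ge> 0" using x by simp
  have "0 \<le> z" using \<mu>(1) x0 by (simp add: z_def)
  moreover have "z \<le> 1" using \<mu>(2) x0 by (simp add: z_def left_diff_distrib)
  ultimately have z: "0 \<le> z" "z \<le> 1" by auto
  have upper: "(\<Sum>e\<in>?K. \<mu> ^ y e) \<le> real n ^ k * (1 + z + z\<^sup>2)"
  proof -
    define r where "r c = card {a. a < n \<and> (c, a) \<in> R}" for c
    have "\<mu> ^ y e = (\<Prod>v\<in>e. if v \<in> R then \<mu> else 1)" if "e \<in> ?K" for e
      using edge_finite[OF that] by (simp add: prod_if_power y_def Int_def)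
    then have "(\<Sum>e\<in>?K. \<mu> ^ y e) = (\<Sum>e\<in>?K. \<Prod>v\<in>e. if v \<in> R then \<mu> else 1)" by (intro sum.cong) auto
    also have "\<dots> = (\<Prod>c<k. \<Sum>a<n. if (c, a) \<in> R then \<mu> else 1)" by (rule sum_edges_prod)
    also have "\<dots> \<le> (\<Prod>c<k. n * exp ((\<mu> - 1) * r c / n))"
    proof (rule prod_mono, intro conjI)
      fix c
      show "0 \<le> (\<Sum>a<n. if (c, a) \<in> R then \<mu> else 1)" using \<mu> by (intro sum_nonneg) auto
      have "(\<Sum>a<n. if (c, a) \<in> R then \<mu> else 1) = (\<Sum>a<n. 1 + (if (c, a) \<in> R then \<mu> - 1 else 0))"
        by (intro sum.cong) auto
      also have "\<dots> = n + (\<mu> - 1) * r c"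
        unfolding sum.distrib r_def by (subst sum.inter_filter[symmetric]) (auto simp: mult.commute)
      also have "\<dots> = n * (1 + (\<mu> - 1) * r c / n)" using n by (simp add: field_simps)
      also have "\<dots> \<le> n * exp ((\<mu> - 1) * r c / n)" by (intro mult_left_mono) auto
      finally show "(\<Sum>a<n. if (c, a) \<in> R then \<mu> else 1) \<le> n * exp ((\<mu> - 1) * r c / n)" .
    qed
    also have "\<dots> = real n ^ k * exp (\<Sum>c<k. (\<mu> - 1) * r c / n)"
      by (simp add: prod.distrib exp_sum)
    also have "(\<Sum>c<k. (\<mu> - 1) * r c / n) = z"
    proof -
      have "R = Sigma {..<k} (\<lambda>c. {a. a < n \<and> (c, a) \<in> R})" using R by (auto simp: mem_vertices dest: subsetD)
      then have "card R = (\<Sum>c<k. r c)" unfolding r_def using card_SigmaI[of "{..<k}" "\<lambda>c. {a. a < n \<and> (c, a) \<in> R}"] by simp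
      then have "real (card R) = (\<Sum>c<k. real (r c))" by simp
      then show ?thesis unfolding z_def x by (simp add: sum_distrib_left sum_divide_distrib)
    qed
    also have "real n ^ k * exp z \<le> real n ^ k * (1 + z + z\<^sup>2)" using exp_bound[OF z] by (intro mult_left_mono) auto
    finally show ?thesis .
  qed
  have "(\<Sum>e\<in>?K. if y e \<ge> 2 then \<mu> ^ y e else if y e = 1 then \<theta> else 1)
    \<le> (\<Sum>e\<in>?K. \<mu> ^ y e - (\<mu> - \<theta>) * (2 * real (y e) - (real (y e))\<^sup>2))" using pw by (intro sum_mono) simp
  also have "\<dots> = (\<Sum>e\<in>?K. \<mu> ^ y e) - (\<mu> - \<theta>) * (\<Sum>e\<in>?K. 2 * real (y e) - (real (y e))\<^sup>2)"
    by (subst sum_subtractf) (simp only: sum_distrib_left)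
  also have "\<dots> \<le> real n ^ k * (1 + z + z\<^sup>2) - (\<mu> - \<theta>) * (real n ^ k * (x - x\<^sup>2))"
    using upper mult_left_mono[OF lower, of "\<mu> - \<theta>"] \<mu>(1) \<theta>(2) by linarith
  also have "\<dots> = real n ^ k * (1 - (1 - \<theta>) * x + (\<mu>\<^sup>2 - (\<mu> - (1 - \<theta>))) * x\<^sup>2)"
    unfolding z_def by (simp add: algebra_simps power2_eq_square)
  also have "\<dots> \<le> real n ^ k * (1 - (1 - \<theta>) * x + \<mu>\<^sup>2 * x\<^sup>2)"
    using \<mu>(1) \<theta> by (intro mult_left_mono add_left_mono mult_right_mono) auto
  finally show ?thesis unfolding y_def .
qed

text \<open>Markov's inequality for a weight that penalises, by \<open>q\<close>, single incidences
  among the first \<open>m1\<close> positions and rewards, by \<open>\<mu>\<close> per vertex,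
  multiple incidences among all \<open>m2\<close>. The lists counted here have weight at least
  \<open>q ^ s * \<mu> ^ card R\<close>.\<close>

lemma expansion_count:
  fixes q \<mu> x :: real and m1 m2 :: nat
  assumes R: "R \<subseteq> vertices k n" and k: "k \<ge> 2" and n: "n > 0"
    and x: "x = card R / n" and \<mu>: "\<mu> \<ge> 1" "\<mu> * x \<le> 1" and q: "0 < q" "q \<le> 1" and m: "m1 \<le> m2"
  shows "card {l \<in> edge_lists k n m2. card {i \<in> {..<m1}. card (l ! i \<inter> R) = 1} \<le> s \<and>
      card R \<le> (\<Sum>i<m2. if card (l ! i \<inter> R) \<ge> 2 then card (l ! i \<inter> R) else 0)} * (q ^ s * \<mu> ^ card R)
    \<le> (real n ^ k) ^ m2 * exp (m2 * (\<mu>\<^sup>2 * x\<^sup>2) - m1 * ((1 - q) * x))"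
proof -
  let ?K = "complete_edges k n"
  define y where "y e = card (e \<inter> R)" for e
  define f where "f i e = (if y e \<ge> 2 then \<mu> ^ y e else if y e = 1 then (if i < m1 then q else 1) else 1)"
    for i :: nat and e
  let ?B = "{l \<in> edge_lists k n m2. card {i \<in> {..<m1}. y (l ! i) = 1} \<le> s \<and>
      card R \<le> (\<Sum>i<m2. if y (l ! i) \<ge> 2 then y (l ! i) else 0)}"
  have f0: "0 \<le> f i e" for i e using \<mu> q by (auto simp: f_def)
  have prod_f: "(\<Prod>i<m2. f i (es ! i)) = \<mu> ^ (\<Sum>i<m2. if y (es ! i) \<ge> 2 then y (es ! i) else 0) *
    q ^ card {i \<in> {..<m1}. y (es ! i) = 1}" for es
  proof -
    have "(\<Prod>i<m2. f i (es ! i)) = (\<Prod>i<m2. \<mu> ^ (if y (es ! i) \<ge> 2 then y (es ! i) else 0) *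
      (if y (es ! i) = 1 \<and> i < m1 then q else 1))"
      by (intro prod.cong) (auto simp: f_def)
    also have "\<dots> = \<mu> ^ (\<Sum>i<m2. if y (es ! i) \<ge> 2 then y (es ! i) else 0) *
      q ^ card {i \<in> {..<m2}. y (es ! i) = 1 \<and> i < m1}"
      by (simp only: prod.distrib power_sum prod_if_power[OF finite_lessThan])
    also have "{i \<in> {..<m2}. y (es ! i) = 1 \<and> i < m1} = {i \<in> {..<m1}. y (es ! i) = 1}" using m by auto
    finally show ?thesis .
  qed
  have "q ^ s * \<mu> ^ card R \<le> (\<Prod>i<m2. f i (es ! i))" if "es \<in> ?B" for es
  proof -
    have "q ^ s \<le> q ^ card {i \<in> {..<m1}. y (es ! i) = 1}" using that q by (intro power_decreasing) auto
    moreover have "\<mu> ^ card R \<le> \<mu> ^ (\<Sum>i<m2. if y (es ! i) \<ge> 2 then y (es ! i) else 0)"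
      using that \<mu>(1) by (intro power_increasing) auto
    ultimately show ?thesis unfolding prod_f using q \<mu>(1) by (subst mult.commute) (intro mult_mono, auto)
  qed
  then have "card ?B * (q ^ s * \<mu> ^ card R) \<le> (\<Sum>l\<in>edge_lists k n m2. \<Prod>i<m2. f i (l ! i))"
    using f0 by (intro card_le_sum_weights[OF finite_edge_lists]) (auto intro!: prod_nonneg)
  also have "\<dots> = (\<Prod>i<m2. \<Sum>e\<in>?K. f i e)" by (rule sum_edge_lists_prod)
  also have "\<dots> \<le> (\<Prod>i<m2. real n ^ k * exp ((if i < m1 then - ((1 - q) * x) else 0) + \<mu>\<^sup>2 * x\<^sup>2))"
  proof (rule prod_mono, intro conjI)
    fix i
    show "0 \<le> (\<Sum>e\<in>?K. f i e)" using f0 by (intro sum_nonneg) auto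
    let ?\<theta> = "if i < m1 then q else 1"
    have "(\<Sum>e\<in>?K. f i e) \<le> real n ^ k * (1 - (1 - ?\<theta>) * x + \<mu>\<^sup>2 * x\<^sup>2)"
      unfolding f_def y_def by (rule sum_edge_weights[OF R k n x \<mu>]) (use q in auto)
    also have "\<dots> = real n ^ k * (1 + ((if i < m1 then - ((1 - q) * x) else 0) + \<mu>\<^sup>2 * x\<^sup>2))" by simp
    also have "\<dots> \<le> real n ^ k * exp ((if i < m1 then - ((1 - q) * x) else 0) + \<mu>\<^sup>2 * x\<^sup>2)"
      by (intro mult_left_mono exp_ge_add_one_self) auto
    finally show "(\<Sum>e\<in>?K. f i e) \<le> real n ^ k * exp ((if i < m1 then - ((1 - q) * x) else 0) + \<mu>\<^sup>2 * x\<^sup>2)" .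
  qed
  also have "\<dots> = (real n ^ k) ^ m2 * exp (\<Sum>i<m2. (if i < m1 then - ((1 - q) * x) else 0) + \<mu>\<^sup>2 * x\<^sup>2)"
    by (simp add: prod.distrib exp_sum)
  also have "(\<Sum>i<m2. (if i < m1 then - ((1 - q) * x) else 0) + \<mu>\<^sup>2 * x\<^sup>2) = m2 * (\<mu>\<^sup>2 * x\<^sup>2) - m1 * ((1 - q) * x)"
  proof -
    have "(\<Sum>i<m2. if i < m1 then - ((1 - q) * x) else 0) = (\<Sum>i\<in>{i \<in> {..<m2}. i < m1}. - ((1 - q) * x))"
      by (rule sum.inter_filter[symmetric]) simp
    also have "{i \<in> {..<m2}. i < m1} = {..<m1}" using m by auto
    finally show ?thesis by (simp add: sum.distrib)
  qed
  finally show ?thesis unfolding y_def .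
qed

section \<open>From independent edges to random orders\<close>

lemma card_permutations_prefix:
  assumes "finite A"
  shows "card {es \<in> permutations_of_set A. take m es = l} \<le> fact (card A - length l)"
proof (cases "{es \<in> permutations_of_set A. take m es = l} = {}")
  case True
  then show ?thesis by (metis card.empty le0)
next
  case False
  then obtain es where es: "set es = A" "distinct es" "take m es = l" by (auto simp: permutations_of_set_def)
  have l: "distinct l" "set l \<subseteq> A" using es by (auto dest: in_set_takeD)
  have "inj_on (drop m) {es \<in> permutations_of_set A. take m es = l}"
  proof (rule inj_onI)
    fix xs ys assume "xs \<in> {es \<in> permutations_of_set A. take m es = l}" "ys \<in> {es \<in> permutations_of_set A. take m es = l}" "drop m xs = drop m ys"
    then have "take m xs = take m ys" "drop m xs = drop m ys" by auto
    then show "xs = ys" by (metis append_take_drop_id)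
  qed
  moreover have "drop m ` {es \<in> permutations_of_set A. take m es = l} \<subseteq> permutations_of_set (A - set l)"
  proof clarify
    fix xs assume xs: "xs \<in> permutations_of_set A" "l = take m xs"
    have "set (take m xs) \<union> set (drop m xs) = A" "set (take m xs) \<inter> set (drop m xs) = {}" "distinct (drop m xs)"
      using xs(1) set_append[of "take m xs" "drop m xs"] distinct_append[of "take m xs" "drop m xs"]
      by (auto simp: permutations_of_set_def)
    then have "set (drop m xs) = A - set (take m xs)" by blast
    then show "drop m xs \<in> permutations_of_set (A - set (take m xs))"
      using \<open>distinct (drop m xs)\<close> by (rule permutations_of_setI)
  qed
  ultimately have "card {es \<in> permutations_of_set A. take m es = l} \<le> card (permutations_of_set (A - set l))"
    using assms by (intro card_inj_on_le) auto
  also have "\<dots> = fact (card A - length l)"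
    using assms l by (simp add: card_Diff_subset distinct_card finite_subset)
  finally show ?thesis .
qed

lemma fact_ge_power_diff:
  assumes "m \<le> N"
  shows "fact (N - m) * (N - m) ^ m \<le> (fact N :: nat)"
  using assms
proof (induction m)
  case (Suc m)
  have N: "N - m = Suc (N - Suc m)" using Suc.prems by simp
  have "fact (N - Suc m) * (N - Suc m) ^ Suc m \<le> fact (N - Suc m) * ((N - m) * (N - m) ^ m)"
    unfolding power_Suc by (intro mult_left_mono mult_mono power_mono) auto
  also have "\<dots> = fact (N - m) * (N - m) ^ m" unfolding N fact_Suc by (simp only: mult_ac of_nat_id)
  also have "\<dots> \<le> fact N" using Suc by simp
  finally show ?case .
qed simp

text \<open>The first \<open>m\<close> edges of a random order are \<open>m\<close> independent uniform edges conditioned on being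
  distinct, an event of probability at least one half if \<open>2 m\<^sup>2 \<le> n\<^sup>k\<close>.\<close>

lemma prefix_probability:
  assumes m: "2 * m\<^sup>2 \<le> n ^ k" and n: "n > 0"
  shows "measure_pmf.prob (edge_order k n) {es. take m es \<in> B}
    \<le> 2 * card (B \<inter> edge_lists k n m) / (real n ^ k) ^ m"
proof -
  let ?K = "complete_edges k n" and ?N = "n ^ k"
  let ?P = "permutations_of_set ?K"
  have mm: "m \<le> m\<^sup>2" by (cases m) (auto simp: power2_eq_square)
  have mN: "m \<le> ?N" using m mm by linarith
  have N0: "?N > 0" using n by simp
  have "{es \<in> ?P. take m es \<in> B} \<subseteq> (\<Union>l\<in>B \<inter> edge_lists k n m. {es \<in> ?P. take m es = l})"
  proof
    fix es assume es: "es \<in> {es \<in> ?P. take m es \<in> B}"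
    then have "set es = ?K" "distinct es" by (auto simp: permutations_of_set_def)
    then have "length es = ?N" using distinct_card[of es] card_complete_edges by simp
    then have "take m es \<in> edge_lists k n m"
      using mN \<open>set es = ?K\<close> by (auto simp: edge_lists_def dest: in_set_takeD)
    then show "es \<in> (\<Union>l\<in>B \<inter> edge_lists k n m. {es \<in> ?P. take m es = l})" using es by blast
  qed
  then have "card {es \<in> ?P. take m es \<in> B} \<le> card (\<Union>l\<in>B \<inter> edge_lists k n m. {es \<in> ?P. take m es = l})"
    by (intro card_mono) (auto simp: finite_edge_lists)
  also have "\<dots> \<le> (\<Sum>l\<in>B \<inter> edge_lists k n m. card {es \<in> ?P. take m es = l})"
    by (rule card_UN_le) (simp add: finite_edge_lists)
  also have "\<dots> \<le> (\<Sum>l\<in>B \<inter> edge_lists k n m. fact (?N - m))"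
  proof (rule sum_mono)
    fix l assume "l \<in> B \<inter> edge_lists k n m"
    then show "card {es \<in> ?P. take m es = l} \<le> fact (?N - m)"
      using card_permutations_prefix[OF finite_complete_edges, of k n m l]
      by (simp add: edge_lists_def card_complete_edges)
  qed
  finally have c1: "card {es \<in> ?P. take m es \<in> B} \<le> card (B \<inter> edge_lists k n m) * fact (?N - m)" by simp
  \<comment> \<open>By Bernoulli's inequality \<open>(1 - m / ?N) ^ m\<close> is at least
    \<open>1 - m\<^sup>2 / ?N\<close>, hence at least one half.\<close>
  have half: "real ?N ^ m \<le> 2 * real (?N - m) ^ m"
  proof -
    have "real m / real ?N * m \<le> 1 / 2"
    proof -
      have "2 * (real m * real m) \<le> real ?N" using m unfolding power2_eq_square by (metis of_nat_le_iff of_nat_mult of_nat_numeral)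
      then show ?thesis using N0 by (simp add: field_simps)
    qed
    moreover have "1 + m * (- (real m / real ?N)) \<le> (1 + (- (real m / real ?N))) ^ m"
      using mN N0 by (intro Bernoulli_inequality) (simp add: field_simps)
    ultimately have "1 / 2 \<le> (1 - real m / real ?N) ^ m" by (simp add: mult.commute)
    then have "real ?N ^ m * (1 / 2) \<le> real ?N ^ m * (1 - real m / real ?N) ^ m" by (intro mult_left_mono) auto
    also have "\<dots> = (real ?N * (1 - real m / real ?N)) ^ m" by (rule power_mult_distrib[symmetric])
    also have "real ?N * (1 - real m / real ?N) = real (?N - m)" using mN N0 by (simp add: field_simps of_nat_diff)
    finally show ?thesis by simp
  qed
  have "real (fact (?N - m)) * real ?N ^ m \<le> real (fact (?N - m)) * (2 * real (?N - m) ^ m)"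
    using half by (intro mult_left_mono) auto
  also have "\<dots> = 2 * real (fact (?N - m) * (?N - m) ^ m)" by simp
  also have "\<dots> \<le> 2 * real (fact ?N)" using fact_ge_power_diff[OF mN] by (intro mult_left_mono) (simp_all only: of_nat_le_iff)
  finally have c2: "real (fact (?N - m)) * real ?N ^ m \<le> 2 * real (fact ?N)" .
  have P: "?P \<noteq> {}" "finite ?P" by auto
  have "measure_pmf.prob (edge_order k n) {es. take m es \<in> B} = card (?P \<inter> {es. take m es \<in> B}) / card ?P"
    unfolding edge_order_def by (rule measure_pmf_of_set[OF P])
  also have "?P \<inter> {es. take m es \<in> B} = {es \<in> ?P. take m es \<in> B}" by blast
  also have "card ?P = fact ?N" by (simp add: card_complete_edges)
  also have "card {es \<in> ?P. take m es \<in> B} / real (fact ?N)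
    \<le> real (card (B \<inter> edge_lists k n m) * fact (?N - m)) / real (fact ?N)"
    using c1 by (intro divide_right_mono) (simp_all only: of_nat_le_iff of_nat_0_le_iff)
  also have "\<dots> \<le> 2 * card (B \<inter> edge_lists k n m) / real ?N ^ m"
  proof -
    have "real (card (B \<inter> edge_lists k n m)) * (real (fact (?N - m)) * real ?N ^ m)
      \<le> real (card (B \<inter> edge_lists k n m)) * (2 * real (fact ?N))"
      using c2 by (intro mult_left_mono) auto
    then show ?thesis using N0 by (simp add: field_simps)
  qed
  finally show ?thesis by simp
qed

text \<open>Second moment method for the number of vertices of the first class that lie on no edge.\<close>

lemma covering_count:
  fixes a :: real
  assumes k: "k > 0" and n: "n \<ge> 2" and a: "a = n * (1 - 1 / n) ^ m"
  shows "card {l \<in> edge_lists k n m. \<forall>v\<in>vertices k n. fst v = 0 \<longrightarrow> (\<exists>e\<in>set l. v \<in> e)} * a \<le> (real n ^ k) ^ m"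
proof -
  let ?K = "complete_edges k n" and ?L = "edge_lists k n m" and ?Q = "real n ^ k"
  define A where "A = {v \<in> vertices k n. fst v = 0}"
  have cardA: "card A = n" unfolding A_def using k by (rule class_card)
  have finA: "finite A" unfolding A_def by simp
  define I where "I v l = (if \<forall>e\<in>set l. v \<notin> e then 1 else 0 :: real)" for v and l :: "vertex set list"
  define Z where "Z l = (\<Sum>v\<in>A. I v l)" for l
  have a0: "a > 0" using n a by simp
  have avoid: "(\<Sum>l\<in>?L. if \<forall>e\<in>set l. P e then 1 else 0) = real (card {e \<in> ?K. P e}) ^ m" for P
  proof -
    have "(\<Sum>l\<in>?L. if \<forall>e\<in>set l. P e then 1 else 0) = real (card {l \<in> ?L. \<forall>e\<in>set l. P e})"
      by (subst sum.inter_filter[symmetric]) (auto simp: finite_edge_lists)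
    also have "{l \<in> ?L. \<forall>e\<in>set l. P e} = {l. set l \<subseteq> {e \<in> ?K. P e} \<and> length l = m}"
      by (auto simp: edge_lists_def)
    also have "card \<dots> = card {e \<in> ?K. P e} ^ m" by (rule card_lists_length_eq) simp
    finally show ?thesis by simp
  qed
  have cv: "real (card {e \<in> ?K. v \<in> e}) = ?Q / n" if "v \<in> A" for v
  proof -
    have "card {e \<in> ?K. v \<in> e} = n ^ (k - 1)" using that by (intro card_edges_vertex) (simp add: A_def)
    then have "real (card {e \<in> ?K. v \<in> e}) = real n ^ (k - 1)" by simp
    also have "\<dots> = ?Q / n" using n k by (simp add: power_diff)
    finally show ?thesis .
  qed
  have cn: "real (card {e \<in> ?K. v \<notin> e}) = ?Q * (1 - 1 / n)" if "v \<in> A" for v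
  proof -
    have "{e \<in> ?K. v \<notin> e} = ?K - {e \<in> ?K. v \<in> e}" by blast
    then have "real (card {e \<in> ?K. v \<notin> e}) = real (card ?K) - real (card {e \<in> ?K. v \<in> e})"
      by (simp add: card_Diff_subset of_nat_diff card_mono)
    then show ?thesis using cv[OF that] by (simp add: card_complete_edges algebra_simps)
  qed
  have cn2: "real (card {e \<in> ?K. u \<notin> e \<and> v \<notin> e}) = ?Q * (1 - 2 / n)" if uv: "u \<in> A" "v \<in> A" "u \<noteq> v" for u v
  proof -
    have disj: "{e \<in> ?K. u \<in> e} \<inter> {e \<in> ?K. v \<in> e} = {}"
      using edge_inj uv unfolding A_def by fastforce
    have "{e \<in> ?K. u \<notin> e \<and> v \<notin> e} = ?K - ({e \<in> ?K. u \<in> e} \<union> {e \<in> ?K. v \<in> e})" by blast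
    moreover have "card ({e \<in> ?K. u \<in> e} \<union> {e \<in> ?K. v \<in> e}) = card {e \<in> ?K. u \<in> e} + card {e \<in> ?K. v \<in> e}"
      by (rule card_Un_disjoint[OF _ _ disj]) auto
    moreover have "card ({e \<in> ?K. u \<in> e} \<union> {e \<in> ?K. v \<in> e}) \<le> card ?K" by (rule card_mono) auto
    ultimately have "real (card {e \<in> ?K. u \<notin> e \<and> v \<notin> e}) =
      real (card ?K) - (real (card {e \<in> ?K. u \<in> e}) + real (card {e \<in> ?K. v \<in> e}))"
      by (simp add: card_Diff_subset of_nat_diff)
    then show ?thesis using cv[OF uv(1)] cv[OF uv(2)] by (simp add: card_complete_edges algebra_simps)
  qed
  have S1: "(\<Sum>l\<in>?L. Z l) = ?Q ^ m * a"
  proof -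
    have "(\<Sum>l\<in>?L. Z l) = (\<Sum>v\<in>A. \<Sum>l\<in>?L. I v l)" unfolding Z_def by (rule sum.swap)
    also have "\<dots> = (\<Sum>v\<in>A. (?Q * (1 - 1 / n)) ^ m)"
      by (rule sum.cong[OF refl]) (simp only: I_def avoid cn)
    also have "\<dots> = ?Q ^ m * a" by (simp add: cardA a power_mult_distrib)
    finally show ?thesis .
  qed
  have S2: "(\<Sum>l\<in>?L. (Z l)\<^sup>2) \<le> ?Q ^ m * (a + a\<^sup>2)"
  proof -
    have "(\<Sum>l\<in>?L. (Z l)\<^sup>2) = (\<Sum>l\<in>?L. \<Sum>u\<in>A. \<Sum>v\<in>A. I u l * I v l)"
      unfolding Z_def power2_eq_square sum_product ..
    also have "\<dots> = (\<Sum>u\<in>A. \<Sum>v\<in>A. \<Sum>l\<in>?L. I u l * I v l)"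
      by (subst sum.swap, rule sum.cong[OF refl], rule sum.swap)
    also have "\<dots> \<le> (\<Sum>u\<in>A. \<Sum>v\<in>A. (if u = v then ?Q ^ m * (1 - 1 / n) ^ m else 0) + ?Q ^ m * ((1 - 1 / n)\<^sup>2) ^ m)"
    proof (intro sum_mono)
      fix u v assume uv: "u \<in> A" "v \<in> A"
      have "(\<Sum>l\<in>?L. I u l * I v l) = (\<Sum>l\<in>?L. if \<forall>e\<in>set l. u \<notin> e \<and> v \<notin> e then 1 else 0)"
        by (intro sum.cong) (auto simp: I_def)
      also have "\<dots> = real (card {e \<in> ?K. u \<notin> e \<and> v \<notin> e}) ^ m" by (rule avoid)
      also have "\<dots> \<le> (if u = v then ?Q ^ m * (1 - 1 / n) ^ m else 0) + ?Q ^ m * ((1 - 1 / n)\<^sup>2) ^ m"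
      proof (cases "u = v")
        case True
        then have "real (card {e \<in> ?K. u \<notin> e \<and> v \<notin> e}) ^ m = ?Q ^ m * (1 - 1 / n) ^ m"
          using cn[OF uv(1)] by (simp add: power_mult_distrib)
        then show ?thesis using True by simp
      next
        case False
        \<comment> \<open>Two vertices of one class are never in a common edge, so their being
          isolated is negatively correlated.\<close>
        have "1 - 2 / real n \<le> (1 - 1 / n)\<^sup>2" by (simp add: power2_eq_square algebra_simps)
        moreover have "0 \<le> 1 - 2 / real n" using n by simp
        ultimately have "(1 - 2 / real n) ^ m \<le> ((1 - 1 / n)\<^sup>2) ^ m" by (intro power_mono)
        then have "?Q ^ m * (1 - 2 / real n) ^ m \<le> ?Q ^ m * ((1 - 1 / n)\<^sup>2) ^ m" by (intro mult_left_mono) auto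
        then show ?thesis using cn2[OF uv False] False by (simp add: power_mult_distrib)
      qed
      finally show "(\<Sum>l\<in>?L. I u l * I v l) \<le> (if u = v then ?Q ^ m * (1 - 1 / n) ^ m else 0) + ?Q ^ m * ((1 - 1 / n)\<^sup>2) ^ m" .
    qed
    also have "\<dots> = n * (?Q ^ m * (1 - 1 / n) ^ m) + n * (n * (?Q ^ m * ((1 - 1 / n)\<^sup>2) ^ m))"
      using finA by (simp add: sum.distrib cardA distrib_left)
    also have "\<dots> = ?Q ^ m * (a + a\<^sup>2)"
    proof -
      have "((1 - 1 / real n)\<^sup>2) ^ m = ((1 - 1 / real n) ^ m)\<^sup>2" by (simp only: power_mult[symmetric] mult.commute)
      then show ?thesis unfolding a by (simp add: power2_eq_square algebra_simps)
    qed
    finally show ?thesis .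
  qed
  let ?B = "{l \<in> ?L. \<forall>v\<in>vertices k n. fst v = 0 \<longrightarrow> (\<exists>e\<in>set l. v \<in> e)}"
  have "a\<^sup>2 \<le> (Z l - a)\<^sup>2" if "l \<in> ?B" for l
  proof -
    have "Z l = 0" unfolding Z_def using that by (intro sum.neutral) (auto simp: I_def A_def)
    then show ?thesis by simp
  qed
  \<comment> \<open>Chebyshev's inequality: on a list covering the class, \<open>Z\<close> is 0 and
    deviates by \<open>a\<close> from its mean \<open>a\<close>, while the variance is at most
    \<open>a\<close>.\<close>
  then have "card ?B * a\<^sup>2 \<le> (\<Sum>l\<in>?L. (Z l - a)\<^sup>2)"
    by (intro card_le_sum_weights[OF finite_edge_lists]) auto
  also have "\<dots> = (\<Sum>l\<in>?L. (Z l)\<^sup>2) - 2 * a * (\<Sum>l\<in>?L. Z l) + ?Q ^ m * a\<^sup>2"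
  proof -
    have "(\<Sum>l\<in>?L. (Z l - a)\<^sup>2) = (\<Sum>l\<in>?L. (Z l)\<^sup>2 - 2 * a * Z l + a\<^sup>2)"
      by (intro sum.cong) (auto simp: power2_eq_square algebra_simps)
    also have "\<dots> = (\<Sum>l\<in>?L. (Z l)\<^sup>2) - 2 * a * (\<Sum>l\<in>?L. Z l) + real (card ?L) * a\<^sup>2"
      by (simp add: sum.distrib sum_subtractf sum_distrib_left)
    finally show ?thesis by (simp add: card_edge_lists)
  qed
  also have "\<dots> \<le> ?Q ^ m * a"
    using S2 unfolding S1 by (simp add: power2_eq_square algebra_simps)
  finally have "(card ?B * a) * a \<le> ?Q ^ m * a" by (simp add: power2_eq_square mult_ac)
  then show ?thesis using a0 by (rule mult_right_le_imp_le)
qed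

section \<open>Prefixes of distinct lists and union bounds for bad events\<close>

lemma sum_set_take:
  assumes "distinct l" "m \<le> length l"
  shows "(\<Sum>e\<in>set (take m l). F e) = (\<Sum>i<m. F (l ! i))"
proof -
  have "set (take m l) = (!) l ` {..<m}" using nth_image[OF assms(2)] by (simp add: lessThan_atLeast0)
  moreover have "inj_on ((!) l) {..<m}" using assms by (auto simp: inj_on_def nth_eq_iff_index_eq)
  ultimately show ?thesis by (simp add: sum.reindex)
qed

lemma card_set_take:
  assumes "distinct l" "m \<le> length l"
  shows "card {e \<in> set (take m l). P e} = card {i \<in> {..<m}. P (l ! i)}"
proof -
  have "card {e \<in> set (take m l). P e} = (\<Sum>e\<in>set (take m l). if P e then 1 else 0)"
    by (subst sum.inter_filter[symmetric]) auto
  also have "\<dots> = (\<Sum>i<m. if P (l ! i) then 1 else 0)" by (rule sum_set_take[OF assms])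
  also have "\<dots> = card {i \<in> {..<m}. P (l ! i)}" by (subst sum.inter_filter[symmetric]) auto
  finally show ?thesis .
qed

text \<open>The single term \<open>r ^ r / fact r\<close> in the series of \<open>exp r\<close>
  bounds \<open>fact r\<close> from below.\<close>

lemma binomial_le_exp_power:
  assumes "r > 0"
  shows "real (N choose r) \<le> (exp 1 * N / r) ^ r"
proof -
  have "(\<Sum>i\<in>{r}. real r ^ i /\<^sub>R fact i) \<le> (\<Sum>i. real r ^ i /\<^sub>R fact i)"
    using summable_exp_generic[of "real r"] by (intro sum_le_suminf) auto
  then have "real r ^ r / fact r \<le> exp r"
    by (simp add: exp_def divide_inverse mult.commute)
  then have e: "real r ^ r \<le> exp 1 ^ r * fact r"
    by (simp add: divide_le_eq exp_of_nat_mult[symmetric])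
  have "(N choose r) * fact r \<le> N ^ r" by (rule binomial_fact_pow)
  then have "real ((N choose r) * fact r) \<le> real (N ^ r)" by (simp only: of_nat_le_iff)
  then have b: "real (N choose r) * fact r \<le> real N ^ r" by simp
  have "real (N choose r) * real r ^ r \<le> real (N choose r) * (exp 1 ^ r * fact r)"
    using e by (intro mult_left_mono) auto
  also have "\<dots> = exp 1 ^ r * (real (N choose r) * fact r)" by simp
  also have "\<dots> \<le> exp 1 ^ r * real N ^ r" using b by (intro mult_left_mono) auto
  finally show ?thesis using assms by (simp add: power_mult_distrib power_divide pos_le_divide_eq)
qed

lemma sum_powers_le:
  fixes y :: real
  assumes "0 \<le> y" "y \<le> 1 / 2"
  shows "(\<Sum>r\<in>{1..N}. y ^ r) \<le> 2 * y"
proof -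
  have "(\<Sum>r\<in>{1..N}. y ^ r) \<le> 2 * y - 2 * y * (1 / 2) ^ N"
  proof (induction N)
    case (Suc N)
    have "y ^ N \<le> (1 / 2) ^ N" using assms by (intro power_mono) auto
    then have "y * y ^ N \<le> y * (1 / 2) ^ N" using assms by (intro mult_left_mono) auto
    then show ?case using Suc by simp
  qed simp
  also have "\<dots> \<le> 2 * y" using assms by simp
  finally show ?thesis .
qed

text \<open>Incidences are counted by position because lists may repeat edges; on prefixes of an
  order this agrees with counting edges.\<close>

definition nonexpanding :: "nat \<Rightarrow> nat \<Rightarrow> nat \<Rightarrow> nat \<Rightarrow> nat \<Rightarrow> vertex set \<Rightarrow> vertex set list set" where
  "nonexpanding k n d m1 m2 R = {l. card {i \<in> {..<m1}. card (l ! i \<inter> R) = 1} \<le> d * card R \<and>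
     card R \<le> (\<Sum>i<m2. if card (l ! i \<inter> R) \<ge> 2 then card (l ! i \<inter> R) else 0)}"

context
  fixes k n d m1 m2 :: nat and L :: real
  assumes k: "k \<ge> 2" and n: "n > 0" and L_def: "L = ln n" and L1: "L \<ge> 1" and m: "m1 \<le> m2"
    and m1: "3 / 4 * n * L - 1 \<le> m1" and m2: "m2 \<le> 3 * n * L"
begin

text \<open>The weights are \<open>1/L\<close> for an edge meeting \<open>R\<close> once and \<open>\<mu>\<^sup>j\<close> for an edge meeting \<open>R\<close> in
  \<open>j \<ge> 2\<close> vertices, where \<open>\<mu>\<close> is chosen so that the latter increase the mean weight only slightly.\<close>

lemma nonexpanding_count:
  assumes R: "R \<subseteq> vertices k n" "R \<noteq> {}" "card R \<le> n / 32"
  shows "card (nonexpanding k n d m1 m2 R \<inter> edge_lists k n m2)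
    \<le> (real n ^ k) ^ m2 * (exp 5 * L ^ d * sqrt (card R * L / n) * n powr (- 21 / 32)) ^ card R"
proof -
  define r where "r = card R"
  have r: "r \<ge> 1" using R(1,2) finite_subset[OF R(1) finite_vertices] unfolding r_def by (simp add: Suc_le_eq card_gt_0_iff)
  define x where "x = real r / n"
  define q where "q = 1 / L"
  \<comment> \<open>With this size \<open>\<mu>\<^sup>2 * x\<^sup>2\<close> exceeds
    \<open>x\<^sup>2\<close> by at most \<open>x / L\<close>, so over
    \<open>m2 \<le> 3 * n * L\<close> positions the excess costs only \<open>3 * r\<close> in the
    exponent.\<close>
  define \<mu> where "\<mu> = max 1 (sqrt (n / (r * L)))"
  have q: "0 < q" "q \<le> 1" using L1 by (auto simp: q_def)
  have x: "0 < x" "x \<le> 1 / 32" using r n R(3) by (auto simp: x_def r_def field_simps)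
  have \<mu>1: "\<mu> \<ge> 1" by (simp add: \<mu>_def)
  have \<mu>2: "\<mu>\<^sup>2 \<le> 1 + n / (r * L)"
    using L1 by (cases "sqrt (n / (r * L)) \<le> 1") (auto simp: \<mu>_def max_def)
  have "\<mu>\<^sup>2 * x\<^sup>2 \<le> (1 + n / (r * L)) * x\<^sup>2" using \<mu>2 by (intro mult_right_mono) auto
  also have "\<dots> = x\<^sup>2 + x / L" using r n L1 by (simp add: x_def field_simps power2_eq_square)
  finally have \<mu>x: "\<mu>\<^sup>2 * x\<^sup>2 \<le> x\<^sup>2 + x / L" .
  have x2: "x\<^sup>2 \<le> x / 32" using x mult_left_mono[of x "1 / 32" x] by (simp add: power2_eq_square)
  have xL: "x / L \<le> x" using x L1 by (simp add: divide_le_eq mult_le_cancel_left1)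
  have "(\<mu> * x)\<^sup>2 \<le> 1\<^sup>2" using \<mu>x x2 xL x by (simp add: power_mult_distrib)
  then have \<mu>x1: "\<mu> * x \<le> 1" by (rule power2_le_imp_le) simp
  \<comment> \<open>Single incidences gain \<open>3 / 4 * L\<close> per vertex of \<open>R\<close>.
    As \<open>x \<le> 1 / 32\<close>, the term \<open>x\<^sup>2\<close> loses at most
    \<open>3 / 32 * L\<close>, which leaves 21/32. The bounded terms 3 and 2 make up the 5.\<close>
  have E: "m2 * (\<mu>\<^sup>2 * x\<^sup>2) - m1 * ((1 - q) * x) \<le> r * (5 - 21 / 32 * L)"
  proof -
    have "m2 * (\<mu>\<^sup>2 * x\<^sup>2) \<le> (3 * n * L) * (x / 32 + x / L)"
      using \<mu>x x2 m2 n L1 by (intro mult_mono) auto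
    also have "\<dots> = r * (3 / 32 * L + 3)" using n L1 by (simp add: x_def field_simps)
    finally have 1: "m2 * (\<mu>\<^sup>2 * x\<^sup>2) \<le> r * (3 / 32 * L + 3)" .
    have "(3 / 4 * n * L - 1) * x \<le> m1 * x" using m1 x by (intro mult_right_mono) auto
    moreover have "r * (3 / 4 * L - 1) \<le> (3 / 4 * n * L - 1) * x"
      using n r by (simp add: x_def field_simps)
    ultimately have "r * (3 / 4 * L - 1) \<le> m1 * x" by linarith
    then have "(r * (3 / 4 * L - 1)) * (1 - q) \<le> (m1 * x) * (1 - q)" using q by (intro mult_right_mono) auto
    moreover have "r * (3 / 4 * L - 2) \<le> (r * (3 / 4 * L - 1)) * (1 - q)"
    proof -
      have "(3 / 4 * L - 1) * (1 - q) = 3 / 4 * L - 1 - 3 / 4 + q" using L1 by (simp add: q_def field_simps)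
      then have "3 / 4 * L - 2 \<le> (3 / 4 * L - 1) * (1 - q)" using q by linarith
      then show ?thesis using mult_left_mono[of "3 / 4 * L - 2" "(3 / 4 * L - 1) * (1 - q)" "real r"] by (simp add: mult.assoc)
    qed
    ultimately have 2: "r * (3 / 4 * L - 2) \<le> m1 * ((1 - q) * x)" by (simp add: mult_ac)
    have "r * (3 / 32 * L + 3) - r * (3 / 4 * L - 2) = r * (5 - 21 / 32 * L)" by (simp add: algebra_simps)
    then show ?thesis using 1 2 by linarith
  qed
  let ?b = "exp 5 * L ^ d * sqrt (r * L / n) * n powr (- 21 / 32)"
  let ?w = "q ^ (d * r) * \<mu> ^ r"
  have w0: "?w > 0" using q \<mu>1 by simp
  have sq: "1 \<le> sqrt (r * L / n) * \<mu>"
  proof -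
    have "1 = sqrt (r * L / n) * sqrt (n / (r * L))"
      using r n L1 by (simp add: real_sqrt_mult[symmetric])
    also have "\<dots> \<le> sqrt (r * L / n) * \<mu>" using r n L1 by (intro mult_left_mono) (auto simp: \<mu>_def)
    finally show ?thesis .
  qed
  have Lq: "L ^ d * q ^ d = 1" using L1 by (simp add: q_def power_mult_distrib[symmetric])
  have "exp (r * (5 - 21 / 32 * L)) = (exp 5 * n powr (- 21 / 32)) ^ r"
    using n by (simp add: powr_def L_def exp_add[symmetric] exp_of_nat_mult[symmetric] algebra_simps)
  also have "\<dots> \<le> (?b * (q ^ d * \<mu>)) ^ r"
  proof (rule power_mono)
    have "?b * (q ^ d * \<mu>) = (exp 5 * n powr (- 21 / 32)) * (L ^ d * q ^ d) * (sqrt (r * L / n) * \<mu>)"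
      by (simp add: mult_ac)
    also have "\<dots> \<ge> (exp 5 * n powr (- 21 / 32)) * 1 * 1"
      unfolding Lq using sq by (intro mult_left_mono) auto
    finally show "exp 5 * n powr (- 21 / 32) \<le> ?b * (q ^ d * \<mu>)" by simp
  qed simp
  also have "\<dots> = ?b ^ r * ?w" by (simp only: power_mult_distrib power_mult)
  finally have expE: "exp (r * (5 - 21 / 32 * L)) \<le> ?b ^ r * ?w" .
  have "card (nonexpanding k n d m1 m2 R \<inter> edge_lists k n m2) * ?w
    \<le> (real n ^ k) ^ m2 * exp (m2 * (\<mu>\<^sup>2 * x\<^sup>2) - m1 * ((1 - q) * x))"
    using expansion_count[OF R(1) k n _ \<mu>1 \<mu>x1 q m, of "d * r"]
    by (simp add: nonexpanding_def r_def x_def Int_def conj_ac)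
  also have "\<dots> \<le> (real n ^ k) ^ m2 * (?b ^ r * ?w)"
    using E expE order_trans[of "exp (m2 * (\<mu>\<^sup>2 * x\<^sup>2) - m1 * ((1 - q) * x))" "exp (r * (5 - 21 / 32 * L))"]
    by (intro mult_left_mono) auto
  finally have "card (nonexpanding k n d m1 m2 R \<inter> edge_lists k n m2) * ?w \<le> ((real n ^ k) ^ m2 * ?b ^ r) * ?w"
    by (simp add: mult_ac)
  then have "card (nonexpanding k n d m1 m2 R \<inter> edge_lists k n m2) \<le> (real n ^ k) ^ m2 * ?b ^ r"
    using w0 by (rule mult_right_le_imp_le)
  then show ?thesis unfolding r_def .
qed

text \<open>There are at most \<open>(exp 1 * (k * n) / r) ^ r\<close> sets of size
  \<open>r\<close>. The factor \<open>sqrt (r * L / n)\<close> gained from multiple incidences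
  reduces \<open>n / r\<close> in this bound to \<open>sqrt (n * L / r)\<close>, so the exponent of
  \<open>n\<close> becomes \<open>1 / 2 - 21 / 32 = - 5 / 32\<close>. Without that factor the bound
  for sets of bounded size would grow with \<open>n\<close>.\<close>

lemma nonexpanding_union_count:
  assumes y: "y = exp 6 * k * L ^ (d + 1) * n powr (- 5 / 32)" "y \<le> 1 / 2"
  shows "card ({l. \<exists>R. R \<subseteq> vertices k n \<and> R \<noteq> {} \<and> card R \<le> n / 32 \<and> l \<in> nonexpanding k n d m1 m2 R}
      \<inter> edge_lists k n m2) \<le> (real n ^ k) ^ m2 * (2 * y)"
proof -
  let ?V = "vertices k n"
  define S where "S = {R. R \<subseteq> ?V \<and> R \<noteq> {} \<and> card R \<le> n / 32}"
  define u where "u r = (exp 5 * L ^ d * sqrt (real r * L / n) * n powr (- 21 / 32)) ^ r" for r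
  have finS: "finite S" unfolding S_def by (rule finite_subset[of _ "Pow ?V"]) auto
  have u0: "u r \<ge> 0" for r unfolding u_def using L1 n by (intro zero_le_power mult_nonneg_nonneg) auto
  have y0: "y \<ge> 0" unfolding y using L1 by simp
  have cardV: "card ?V = k * n"
  proof -
    have "?V = {..<k} \<times> {..<n}" by (auto simp: mem_vertices)
    then show ?thesis by simp
  qed
  have term_le: "real (k * n choose r) * u r \<le> y ^ r" if r: "r \<ge> 1" for r
  proof -
    have "real (k * n choose r) * u r \<le> (exp 1 * (k * n) / r) ^ r * u r"
      using binomial_le_exp_power[of r "k * n"] r u0 by (intro mult_right_mono) auto
    also have "\<dots> = (exp 1 * (k * n) / r * (exp 5 * L ^ d * sqrt (real r * L / n) * n powr (- 21 / 32))) ^ r"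
      unfolding u_def by (simp only: power_mult_distrib)
    also have "\<dots> \<le> y ^ r"
    proof (rule power_mono)
      have "sqrt (real r * L / n) * (n / r) = sqrt (n * L / r)"
        using r n L1 by (simp add: real_sqrt_divide real_sqrt_mult field_simps)
      also have "\<dots> \<le> sqrt (n * L\<^sup>2)"
      proof (rule real_sqrt_le_mono)
        have "L * 1 \<le> L * L" using L1 by (intro mult_left_mono) auto
        have "n * L / r \<le> n * L / 1" using r L1 by (intro divide_left_mono) auto
        also have "\<dots> \<le> n * L\<^sup>2" using \<open>L * 1 \<le> L * L\<close> by (simp add: power2_eq_square mult_left_mono)
        finally show "n * L / r \<le> n * L\<^sup>2" .
      qed
      also have "\<dots> = n powr (1 / 2) * L" using L1 n by (simp add: real_sqrt_mult powr_half_sqrt)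
      finally have s: "sqrt (real r * L / n) * (n / r) \<le> n powr (1 / 2) * L" .
      have "exp 1 * (k * n) / r * (exp 5 * L ^ d * sqrt (real r * L / n) * n powr (- 21 / 32))
        = (exp 1 * exp 5 * k * L ^ d * n powr (- 21 / 32)) * (sqrt (real r * L / n) * (n / r))" by simp
      also have "\<dots> \<le> (exp 1 * exp 5 * k * L ^ d * n powr (- 21 / 32)) * (n powr (1 / 2) * L)"
        using L1 by (intro mult_left_mono[OF s]) auto
      also have "\<dots> = (exp 1 * exp 5) * k * (L ^ d * L) * (n powr (- 21 / 32) * n powr (1 / 2))" by simp
      also have "\<dots> = y" unfolding y using n by (simp add: exp_add[symmetric] powr_add[symmetric] mult.commute)
      finally show "exp 1 * (k * n) / r * (exp 5 * L ^ d * sqrt (real r * L / n) * n powr (- 21 / 32)) \<le> y" .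
    qed (use L1 in auto)
    finally show ?thesis .
  qed
  have "card ({l. \<exists>R. R \<subseteq> ?V \<and> R \<noteq> {} \<and> card R \<le> n / 32 \<and> l \<in> nonexpanding k n d m1 m2 R} \<inter> edge_lists k n m2)
    \<le> card (\<Union>R\<in>S. nonexpanding k n d m1 m2 R \<inter> edge_lists k n m2)"
    by (rule card_mono) (auto simp: S_def finite_edge_lists)
  also have "\<dots> \<le> (\<Sum>R\<in>S. card (nonexpanding k n d m1 m2 R \<inter> edge_lists k n m2))" by (rule card_UN_le[OF finS])
  finally have "real (card ({l. \<exists>R. R \<subseteq> ?V \<and> R \<noteq> {} \<and> card R \<le> n / 32 \<and> l \<in> nonexpanding k n d m1 m2 R} \<inter> edge_lists k n m2))
    \<le> (\<Sum>R\<in>S. real (card (nonexpanding k n d m1 m2 R \<inter> edge_lists k n m2)))"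
    by (simp only: of_nat_sum[symmetric] of_nat_le_iff)
  also have "\<dots> \<le> (\<Sum>R\<in>S. (real n ^ k) ^ m2 * u (card R))"
    unfolding u_def by (intro sum_mono nonexpanding_count) (auto simp: S_def)
  also have "\<dots> = (real n ^ k) ^ m2 * (\<Sum>R\<in>S. u (card R))" by (rule sum_distrib_left[symmetric])
  also have "(\<Sum>R\<in>S. u (card R)) = (\<Sum>r\<in>{1..k * n}. \<Sum>R\<in>{R \<in> S. card R = r}. u (card R))"
  proof (rule sum.group[symmetric])
    show "card ` S \<subseteq> {1..k * n}"
    proof clarify
      fix R assume R: "R \<in> S"
      then have "finite R" "R \<subseteq> ?V" "R \<noteq> {}" unfolding S_def using finite_subset[OF _ finite_vertices] by auto
      then show "card R \<in> {1..k * n}" using card_mono[of ?V R] cardV by (simp add: Suc_le_eq card_gt_0_iff)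
    qed
  qed (use finS in auto)
  also have "(real n ^ k) ^ m2 * \<dots> \<le> (real n ^ k) ^ m2 * (\<Sum>r\<in>{1..k * n}. y ^ r)"
  proof (intro mult_left_mono sum_mono)
    fix r assume "r \<in> {1..k * n}"
    then have r: "r \<ge> 1" by simp
    have "(\<Sum>R\<in>{R \<in> S. card R = r}. u (card R)) = card {R \<in> S. card R = r} * u r" by simp
    also have "\<dots> \<le> real (k * n choose r) * u r"
    proof (intro mult_right_mono u0)
      have "card {R \<in> S. card R = r} \<le> card {R. R \<subseteq> ?V \<and> card R = r}"
        by (rule card_mono) (auto simp: S_def)
      also have "\<dots> = k * n choose r" using n_subsets[OF finite_vertices, of k n r] cardV by simp
      finally show "real (card {R \<in> S. card R = r}) \<le> real (k * n choose r)" by simp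
    qed
    also have "\<dots> \<le> y ^ r" using r by (rule term_le)
    finally show "(\<Sum>R\<in>{R \<in> S. card R = r}. u (card R)) \<le> y ^ r" .
  qed simp
  also have "\<dots> \<le> (real n ^ k) ^ m2 * (2 * y)" using sum_powers_le[OF y0 y(2)] by (intro mult_left_mono) auto
  finally show ?thesis .
qed

end

text \<open>The union bound over at most \<open>2 ^ (k * n)\<close> sets \<open>S\<close> is
  affordable: the lower tail, taken with \<open>q = 1 / 2\<close>, is exponentially small in
  \<open>m\<close>, which will be of order \<open>n * ln n\<close>.\<close>

lemma sparse_boxes_count:
  fixes \<delta> :: real
  assumes \<delta>: "0 < \<delta>" "\<delta> \<le> 1"
  shows "card ({l. \<exists>S\<in>Pow (vertices k n). (\<forall>c<k. \<delta> * n \<le> card {v \<in> S. fst v = c}) \<and> card {i \<in> {..<m}. l ! i \<subseteq> S} \<le> n}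
      \<inter> edge_lists k n m) \<le> (real n ^ k) ^ m * (2 ^ (k * n) * 2 ^ n * exp (- (\<delta> ^ k / 2) * m))"
proof -
  let ?V = "vertices k n"
  define D where "D = {S \<in> Pow ?V. \<forall>c<k. \<delta> * n \<le> card {v \<in> S. fst v = c}}"
  let ?B = "\<lambda>S. {l \<in> edge_lists k n m. card {i \<in> {..<m}. l ! i \<subseteq> S} \<le> n}"
  let ?X = "2 ^ n * ((real n ^ k) ^ m * exp (- (\<delta> ^ k / 2) * m))"
  have finD: "finite D" unfolding D_def by simp
  have "card D \<le> card (Pow ?V)" unfolding D_def by (rule card_mono) auto
  also have "\<dots> = 2 ^ (k * n)"
  proof -
    have "?V = {..<k} \<times> {..<n}" by (auto simp: mem_vertices)
    then show ?thesis by (simp add: card_Pow)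
  qed
  finally have "real (card D) \<le> real (2 ^ (k * n))" by (simp only: of_nat_le_iff)
  then have cD: "real (card D) \<le> 2 ^ (k * n)" by simp
  have single: "real (card (?B S)) \<le> ?X" if S: "S \<in> D" for S
  proof -
    let ?b = "card {e \<in> complete_edges k n. e \<subseteq> S}"
    have "\<delta> ^ k * real n ^ k = (\<Prod>c<k. \<delta> * n)" by (simp add: power_mult_distrib)
    also have "\<dots> \<le> (\<Prod>c<k. real (card {a. a < n \<and> (c, a) \<in> S}))"
    proof (rule prod_mono, intro conjI)
      fix c assume c: "c \<in> {..<k}"
      show "0 \<le> \<delta> * n" using \<delta> by simp
      have "{v \<in> S. fst v = c} = Pair c ` {a. a < n \<and> (c, a) \<in> S}"
        using S unfolding D_def by (force simp: mem_vertices)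
      then have "card {v \<in> S. fst v = c} = card {a. a < n \<and> (c, a) \<in> S}"
        by (simp add: card_image inj_on_def)
      then show "\<delta> * n \<le> real (card {a. a < n \<and> (c, a) \<in> S})" using S c unfolding D_def by auto
    qed
    also have "\<dots> = real ?b" unfolding card_edges_subset by simp
    finally have b: "\<delta> ^ k * real n ^ k \<le> real ?b" .
    have "?b \<le> card (complete_edges k n)" by (rule card_mono) auto
    then have b2: "real ?b \<le> real n ^ k" unfolding card_complete_edges by (metis of_nat_le_iff of_nat_power)
    have "card (?B S) * (1 / 2) ^ n \<le> (real n ^ k - (1 - 1 / 2) * ?b) ^ m"
      by (rule lower_tail_count) auto
    also have "\<dots> \<le> (real n ^ k * exp (- (\<delta> ^ k / 2))) ^ m"
    proof (rule power_mono)
      have "real n ^ k - (1 - 1 / 2) * ?b \<le> real n ^ k * (1 + (- (\<delta> ^ k / 2)))" using b by (simp add: algebra_simps)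
      also have "\<dots> \<le> real n ^ k * exp (- (\<delta> ^ k / 2))" by (intro mult_left_mono exp_ge_add_one_self) auto
      finally show "real n ^ k - (1 - 1 / 2) * ?b \<le> real n ^ k * exp (- (\<delta> ^ k / 2))" .
      have "(1 - 1 / 2) * real ?b \<le> 1 * real ?b" by (intro mult_right_mono) auto
      then have "(1 - 1 / 2) * real ?b \<le> real n ^ k" using b2 by (simp only: mult_1)
      then show "0 \<le> real n ^ k - (1 - 1 / 2) * ?b" by (simp only: diff_ge_0_iff_ge)
    qed
    also have "\<dots> = (real n ^ k) ^ m * exp (- (\<delta> ^ k / 2) * m)"
      by (simp add: power_mult_distrib exp_of_nat_mult[symmetric] mult.commute)
    finally have "card (?B S) * (1 / 2) ^ n \<le> (real n ^ k) ^ m * exp (- (\<delta> ^ k / 2) * m)" .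
    then show ?thesis by (simp add: power_one_over field_simps)
  qed
  have "card ({l. \<exists>S\<in>Pow ?V. (\<forall>c<k. \<delta> * n \<le> card {v \<in> S. fst v = c}) \<and> card {i \<in> {..<m}. l ! i \<subseteq> S} \<le> n} \<inter> edge_lists k n m)
    \<le> card (\<Union>S\<in>D. ?B S)"
    by (rule card_mono) (auto simp: D_def finite_edge_lists)
  also have "\<dots> \<le> (\<Sum>S\<in>D. card (?B S))" by (rule card_UN_le[OF finD])
  finally have "real (card ({l. \<exists>S\<in>Pow ?V. (\<forall>c<k. \<delta> * n \<le> card {v \<in> S. fst v = c}) \<and> card {i \<in> {..<m}. l ! i \<subseteq> S} \<le> n} \<inter> edge_lists k n m))
    \<le> (\<Sum>S\<in>D. real (card (?B S)))" by (simp only: of_nat_sum[symmetric] of_nat_le_iff)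
  also have "\<dots> \<le> (\<Sum>S\<in>D. ?X)" by (intro sum_mono single)
  also have "\<dots> = card D * ?X" by simp
  also have "\<dots> \<le> 2 ^ (k * n) * ?X" using cD by (intro mult_right_mono) auto
  finally show ?thesis by (simp add: mult_ac)
qed

text \<open>The lower tail for the edges at a vertex, a fraction \<open>1 / n\<close> of all edges.
  The later choice \<open>q = 1 / L\<close> makes the loss \<open>(1 / q) ^ d\<close> a mere power
  of \<open>ln n\<close>.\<close>

lemma low_degree_count:
  fixes q :: real
  assumes q: "0 < q" "q \<le> 1" and k: "k > 0" and n: "n > 0"
  shows "card ({l. \<exists>v\<in>vertices k n. card {i \<in> {..<m}. v \<in> l ! i} \<le> d} \<inter> edge_lists k n m)
    \<le> (real n ^ k) ^ m * (k * n * ((1 / q) ^ d * exp (- ((1 - q) / n * m))))"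
proof -
  let ?V = "vertices k n"
  let ?B = "\<lambda>v. {l \<in> edge_lists k n m. card {i \<in> {..<m}. v \<in> l ! i} \<le> d}"
  let ?X = "(1 / q) ^ d * ((real n ^ k) ^ m * exp (- ((1 - q) / n * m)))"
  have single: "real (card (?B v)) \<le> ?X" if v: "v \<in> ?V" for v
  proof -
    have "card (?B v) * q ^ d \<le> (real n ^ k - (1 - q) * card {e \<in> complete_edges k n. v \<in> e}) ^ m"
      by (rule lower_tail_count[OF q])
    also have "real n ^ k - (1 - q) * card {e \<in> complete_edges k n. v \<in> e} = real n ^ k * (1 + (- ((1 - q) / n)))"
    proof -
      have "real (card {e \<in> complete_edges k n. v \<in> e}) = real n ^ (k - 1)"
        unfolding card_edges_vertex[OF v] by simp
      also have "\<dots> = real n ^ k / n" using n k by (simp add: power_diff)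
      finally show ?thesis by (simp add: algebra_simps)
    qed
    also have "(real n ^ k * (1 + (- ((1 - q) / n)))) ^ m \<le> (real n ^ k * exp (- ((1 - q) / n))) ^ m"
    proof (rule power_mono)
      show "real n ^ k * (1 + (- ((1 - q) / n))) \<le> real n ^ k * exp (- ((1 - q) / n))"
        by (intro mult_left_mono exp_ge_add_one_self) auto
      have "(1 - q) / n \<le> 1" using q n by (simp add: divide_le_eq)
      then show "0 \<le> real n ^ k * (1 + (- ((1 - q) / n)))" by simp
    qed
    also have "\<dots> = (real n ^ k) ^ m * exp (- ((1 - q) / n * m))"
      by (simp add: power_mult_distrib exp_of_nat_mult[symmetric] mult.commute)
    finally have "card (?B v) * q ^ d \<le> (real n ^ k) ^ m * exp (- ((1 - q) / n * m))" .
    then show ?thesis using q by (simp add: power_one_over field_simps)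
  qed
  have "card ({l. \<exists>v\<in>?V. card {i \<in> {..<m}. v \<in> l ! i} \<le> d} \<inter> edge_lists k n m) \<le> card (\<Union>v\<in>?V. ?B v)"
    by (rule card_mono) (auto simp: finite_edge_lists)
  also have "\<dots> \<le> (\<Sum>v\<in>?V. card (?B v))" by (rule card_UN_le) simp
  finally have "real (card ({l. \<exists>v\<in>?V. card {i \<in> {..<m}. v \<in> l ! i} \<le> d} \<inter> edge_lists k n m)) \<le> (\<Sum>v\<in>?V. real (card (?B v)))"
    by (simp only: of_nat_sum[symmetric] of_nat_le_iff)
  also have "\<dots> \<le> (\<Sum>v\<in>?V. ?X)" by (intro sum_mono single)
  also have "\<dots> = k * n * ?X"
  proof -
    have "?V = {..<k} \<times> {..<n}" by (auto simp: mem_vertices)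
    then show ?thesis by simp
  qed
  finally show ?thesis by (simp add: mult_ac)
qed

section \<open>Asymptotics\<close>

text \<open>The sets \<open>B1\<close> to \<open>B4\<close> collect the failures: no isolated vertex
  in class 0 at time \<open>m1\<close>, a degree of at most \<open>d\<close> at time
  \<open>m2\<close>, a small non-expanding set, a sparse box. Orders avoiding them fall under
  \<open>nondefective_of_good_order\<close>, and each error term carries the factor 2 of
  \<open>prefix_probability\<close>.\<close>

lemma nondefective_probability:
  fixes \<delta> L a y :: real and k d n m1 m2 :: nat
  assumes k: "k \<ge> 3" and d: "d \<ge> 1" and \<delta>: "0 < \<delta>" "\<delta> \<le> 1" and nd: "d + 1 \<le> n" and n1: "2 * real k * \<delta> * n \<ge> 1"
    and \<delta>1: "\<delta> * (k * real ((d + 1) ^ k) + 2 * real k + 2) * (2 * (real d + 1)) \<le> 1"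
    and \<delta>2: "(k * real ((d + 1) ^ k) + 2 * real k) * \<delta> \<le> 1 / 32"
    and L: "L = ln n" "L \<ge> 1" and m: "m1 \<le> m2" and m1: "3 / 4 * n * L - 1 \<le> m1" and m2: "m2 \<le> 3 * n * L"
    and mn: "2 * m2\<^sup>2 \<le> n ^ k"
    and a: "a = n * (1 - 1 / n) ^ m1" and y: "y = exp 6 * k * L ^ (d + 1) * n powr (- 5 / 32)" "y \<le> 1 / 2"
  shows "1 - (2 / a + 2 * (k * n * (L ^ d * exp (- ((1 - 1 / L) / n * m2)))) + 2 * (2 * y) +
      2 * (2 ^ (k * n) * 2 ^ n * exp (- (\<delta> ^ k / 2) * m1)))
    \<le> measure_pmf.prob (edge_order k n) {es. let G = process_graph es (hitting_time k n (d + 1) es)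
        in tangentially_weakly_nondefective G (graph_variety k n G) d}"
proof -
  let ?V = "vertices k n" and ?M = "edge_order k n"
  let ?A = "{es. let G = process_graph es (hitting_time k n (d + 1) es)
        in tangentially_weakly_nondefective G (graph_variety k n G) d}"
  define B1 where "B1 = {l. \<forall>v\<in>?V. fst v = 0 \<longrightarrow> (\<exists>e\<in>set l. v \<in> e)}"
  define B2 where "B2 = {l. \<exists>v\<in>?V. card {i \<in> {..<m2}. v \<in> l ! i} \<le> d}"
  define B3 where "B3 = {l. \<exists>R. R \<subseteq> ?V \<and> R \<noteq> {} \<and> card R \<le> n / 32 \<and> l \<in> nonexpanding k n d m1 m2 R}"
  define B4 where "B4 = {l. \<exists>S\<in>Pow ?V. (\<forall>c<k. \<delta> * n \<le> card {v \<in> S. fst v = c}) \<and> card {i \<in> {..<m1}. l ! i \<subseteq> S} \<le> n}"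
  define E where "E m B = {es. take m es \<in> B}" for m and B :: "vertex set list set"
  have n: "n > 0" "n \<ge> 2" using nd d by auto
  have "m1\<^sup>2 \<le> m2\<^sup>2" using m by (rule power_mono) simp
  then have mn1: "2 * m1\<^sup>2 \<le> n ^ k" using mn by linarith
  have prob_le: "measure_pmf.prob ?M (E m B) \<le> 2 * c"
    if "2 * m\<^sup>2 \<le> n ^ k" "real (card (B \<inter> edge_lists k n m)) \<le> (real n ^ k) ^ m * c" for m B c
  proof -
    have "measure_pmf.prob ?M (E m B) \<le> 2 * card (B \<inter> edge_lists k n m) / (real n ^ k) ^ m"
      unfolding E_def by (rule prefix_probability[OF that(1) n(1)])
    also have "\<dots> \<le> 2 * ((real n ^ k) ^ m * c) / (real n ^ k) ^ m"
      using that(2) by (intro divide_right_mono mult_left_mono) auto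
    also have "\<dots> = 2 * c" using n by simp
    finally show ?thesis .
  qed
  have a0: "a > 0" using n unfolding a by simp
  have p1: "measure_pmf.prob ?M (E m1 B1) \<le> 2 * (1 / a)"
  proof (rule prob_le[OF mn1])
    have "{l \<in> edge_lists k n m1. \<forall>v\<in>?V. fst v = 0 \<longrightarrow> (\<exists>e\<in>set l. v \<in> e)} = B1 \<inter> edge_lists k n m1"
      unfolding B1_def by blast
    then have "card (B1 \<inter> edge_lists k n m1) * a \<le> (real n ^ k) ^ m1"
      using covering_count[OF _ n(2) a, of k] k by simp
    then show "real (card (B1 \<inter> edge_lists k n m1)) \<le> (real n ^ k) ^ m1 * (1 / a)"
      using a0 by (simp add: pos_le_divide_eq)
  qed
  have p2: "measure_pmf.prob ?M (E m2 B2) \<le> 2 * (k * n * (L ^ d * exp (- ((1 - 1 / L) / n * m2))))"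
  proof (rule prob_le[OF mn])
    show "real (card (B2 \<inter> edge_lists k n m2)) \<le> (real n ^ k) ^ m2 * (k * n * (L ^ d * exp (- ((1 - 1 / L) / n * m2))))"
      using low_degree_count[of "1 / L" k n m2 d] L(2) k n unfolding B2_def by simp
  qed
  have p3: "measure_pmf.prob ?M (E m2 B3) \<le> 2 * (2 * y)"
  proof (rule prob_le[OF mn])
    show "real (card (B3 \<inter> edge_lists k n m2)) \<le> (real n ^ k) ^ m2 * (2 * y)"
      unfolding B3_def by (rule nonexpanding_union_count[OF _ n(1) L m m1 m2 y]) (use k in simp)
  qed
  have p4: "measure_pmf.prob ?M (E m1 B4) \<le> 2 * (2 ^ (k * n) * 2 ^ n * exp (- (\<delta> ^ k / 2) * m1))"
    by (rule prob_le[OF mn1]) (unfold B4_def, rule sparse_boxes_count[OF \<delta>])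
  have supp: "set_pmf ?M \<subseteq> ?A \<union> (E m1 B1 \<union> (E m2 B2 \<union> (E m2 B3 \<union> E m1 B4)))"
  proof (rule subsetI, rule ccontr)
    fix es assume es: "es \<in> set_pmf ?M" and bad: "es \<notin> ?A \<union> (E m1 B1 \<union> (E m2 B2 \<union> (E m2 B3 \<union> E m1 B4)))"
    have "es \<in> permutations_of_set (complete_edges k n)"
      using es unfolding edge_order_def by (subst (asm) set_pmf_of_set) auto
    then have K: "set es = complete_edges k n" and dist: "distinct es" by (auto simp: permutations_of_set_def)
    have len: "length es = n ^ k" using distinct_card[OF dist] unfolding K card_complete_edges by simp
    have "m2 \<le> m2\<^sup>2" by (cases m2) (auto simp: power2_eq_square)
    then have m2l: "m2 \<le> length es" and m1l: "m1 \<le> length es" using mn m unfolding len by linarith+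
    have nb: "take m1 es \<notin> B1" "take m2 es \<notin> B2" "take m2 es \<notin> B3" "take m1 es \<notin> B4"
      using bad unfolding E_def by auto
    \<comment> \<open>Since the order has no repetitions, counts of positions are counts of edges;
      this carries the list events over to the graphs of the process.\<close>
    have c2: "card {i \<in> {..<m2}. P (take m2 es ! i)} = card {e \<in> set (take m2 es). P e}" for P
      unfolding card_set_take[OF dist m2l] by (rule arg_cong[of _ _ card]) auto
    have c1: "card {i \<in> {..<m1}. P (take m2 es ! i)} = card {e \<in> set (take m1 es). P e}" for P
      unfolding card_set_take[OF dist m1l] using m by (intro arg_cong[of _ _ card]) auto
    have c1': "card {i \<in> {..<m1}. P (take m1 es ! i)} = card {e \<in> set (take m1 es). P e}" for P
      unfolding card_set_take[OF dist m1l] by (rule arg_cong[of _ _ card]) auto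
    have s2: "(\<Sum>i<m2. F (take m2 es ! i)) = (\<Sum>e\<in>set (take m2 es). F e)" for F :: "vertex set \<Rightarrow> nat"
      unfolding sum_set_take[OF dist m2l] by (rule sum.cong) auto
    have "es \<in> ?A"
      unfolding mem_Collect_eq
    proof (rule nondefective_of_good_order[OF k d K \<delta>(1) nd n1 \<delta>1 \<delta>2 m])
      show "\<exists>v\<in>?V. \<forall>e\<in>set (take m1 es). v \<notin> e" using nb(1) unfolding B1_def by blast
    next
      fix v assume "v \<in> ?V"
      then have "\<not> card {i \<in> {..<m2}. v \<in> take m2 es ! i} \<le> d" using nb(2) unfolding B2_def by blast
      then show "d + 1 \<le> card {e \<in> set (take m2 es). v \<in> e}" unfolding c2[of "\<lambda>e. v \<in> e"] by simp
    next
      fix R assume R: "R \<subseteq> ?V" "R \<noteq> {}" "card R \<le> n / 32"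
        and one: "card {e \<in> set (take m1 es). card (e \<inter> R) = 1} \<le> d * card R"
        and two: "card R \<le> (\<Sum>e\<in>set (take m2 es). if card (e \<inter> R) \<ge> 2 then card (e \<inter> R) else 0)"
      have "take m2 es \<in> nonexpanding k n d m1 m2 R"
        unfolding nonexpanding_def mem_Collect_eq c1[of "\<lambda>e. card (e \<inter> R) = 1"]
          s2[of "\<lambda>e. if card (e \<inter> R) \<ge> 2 then card (e \<inter> R) else 0"]
        using one two by blast
      then show False using nb(3) R unfolding B3_def by blast
    next
      fix T :: "nat \<Rightarrow> vertex set"
      assume T: "\<And>c. c < k \<Longrightarrow> T c \<subseteq> ?V \<and> (\<forall>v\<in>T c. fst v = c) \<and> \<delta> * n \<le> card (T c)"
      define S where "S = (\<Union>c<k. T c)"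
      have SV: "S \<in> Pow ?V" unfolding S_def using T by blast
      have cls: "{v \<in> S. fst v = c} = T c" if "c < k" for c
      proof
        show "{v \<in> S. fst v = c} \<subseteq> T c"
        proof clarify
          fix i j assume "(i, j) \<in> S" "c = fst (i, j)"
          then obtain c' where c': "c' < k" "(i, j) \<in> T c'" unfolding S_def by auto
          then have "c' = c" using T[OF c'(1)] \<open>c = fst (i, j)\<close> by force
          then show "(i, j) \<in> T (fst (i, j))" using c' \<open>c = fst (i, j)\<close> by simp
        qed
        show "T c \<subseteq> {v \<in> S. fst v = c}" unfolding S_def using T[OF that] that by auto
      qed
      have "\<not> card {i \<in> {..<m1}. take m1 es ! i \<subseteq> S} \<le> n"
      proof
        assume c: "card {i \<in> {..<m1}. take m1 es ! i \<subseteq> S} \<le> n"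
        have "\<forall>c<k. \<delta> * n \<le> card {v \<in> S. fst v = c}" using T cls by simp
        then have "take m1 es \<in> B4" unfolding B4_def using SV c by blast
        then show False using nb(4) by simp
      qed
      then have "n < card {e \<in> set (take m1 es). e \<subseteq> S}" unfolding c1'[of "\<lambda>e. e \<subseteq> S"] by simp
      also have "{e \<in> set (take m1 es). e \<subseteq> S} = {e \<in> set (take m1 es). \<forall>v\<in>e. v \<in> T (fst v)}"
      proof (intro Collect_cong conj_cong refl)
        fix e assume "e \<in> set (take m1 es)"
        then have eV: "e \<subseteq> ?V" using K edge_subset in_set_takeD by metis
        show "e \<subseteq> S \<longleftrightarrow> (\<forall>v\<in>e. v \<in> T (fst v))"
        proof
          assume "e \<subseteq> S"
          then show "\<forall>v\<in>e. v \<in> T (fst v)" unfolding S_def using T by fastforce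
        next
          assume *: "\<forall>v\<in>e. v \<in> T (fst v)"
          show "e \<subseteq> S"
          proof
            fix v assume v: "v \<in> e"
            then have "fst v < k" using eV mem_vertices by blast
            then show "v \<in> S" using * v unfolding S_def by blast
          qed
        qed
      qed
      finally show "n < card {e \<in> set (take m1 es). \<forall>v\<in>e. v \<in> T (fst v)}" .
    qed
    then show False using bad by blast
  qed
  have sub: "measure_pmf.prob ?M (A \<union> B) \<le> measure_pmf.prob ?M A + measure_pmf.prob ?M B" for A B
    by (rule measure_Un_le) auto
  have "1 = measure_pmf.prob ?M (set_pmf ?M)" by (simp add: measure_pmf.prob_eq_1 AE_measure_pmf)
  also have "\<dots> \<le> measure_pmf.prob ?M (?A \<union> (E m1 B1 \<union> (E m2 B2 \<union> (E m2 B3 \<union> E m1 B4))))"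
    by (rule measure_pmf.finite_measure_mono[OF supp]) simp
  finally show ?thesis
    using p1 p2 p3 p4 sub[of ?A "E m1 B1 \<union> (E m2 B2 \<union> (E m2 B3 \<union> E m1 B4))"]
      sub[of "E m1 B1" "E m2 B2 \<union> (E m2 B3 \<union> E m1 B4)"] sub[of "E m2 B2" "E m2 B3 \<union> E m1 B4"]
      sub[of "E m2 B3" "E m1 B4"]
    by simp
qed

theorem theorem6p12:
  fixes k d :: nat
  assumes "k \<ge> 3" and "d \<ge> 1"
  shows "(\<lambda>n. measure_pmf.prob (edge_order k n)
            {es. let G = process_graph es (hitting_time k n (d + 1) es)
                 in tangentially_weakly_nondefective G (graph_variety k n G) d})
         \<longlonglongrightarrow> 1"
proof -
  define C where "C = k * real ((d + 1) ^ k) + 2 * real k + 2"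
  \<comment> \<open>The factor \<open>(d + 1) * C\<close> comes from the block sizes; 64 brings the
    part outside the core below the fraction \<open>1 / 32\<close> of \<open>n\<close> up to which
    expansion is available.\<close>
  define \<delta> where "\<delta> = 1 / (64 * (d + 1) * C)"
  have C: "C \<ge> 2" unfolding C_def by simp
  have \<delta>0: "\<delta> > 0" using C by (simp add: \<delta>_def)
  have \<delta>1: "\<delta> * C * (2 * (real d + 1)) \<le> 1" using C by (simp add: \<delta>_def divide_simps)
  have "64 * (d + 1) * C \<ge> 64 * 1 * C" using C by (intro mult_right_mono) auto
  then have dC: "\<delta> \<le> 1 / (64 * C)" using C unfolding \<delta>_def by (intro divide_left_mono) auto
  have "1 / (64 * C) \<le> 1" using C by simp
  then have \<delta>le: "\<delta> \<le> 1" using dC by linarith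
  have "(C - 2) * \<delta> \<le> C * (1 / (64 * C))" using C dC \<delta>0 by (intro mult_mono) auto
  moreover have "C * (1 / (64 * C)) = 1 / 64" using C by simp
  ultimately have "(C - 2) * \<delta> \<le> 1 / 32" by linarith
  moreover have "k * real ((d + 1) ^ k) + 2 * real k = C - 2" by (simp add: C_def)
  ultimately have \<delta>2: "(k * real ((d + 1) ^ k) + 2 * real k) * \<delta> \<le> 1 / 32" by (simp only:)
  define c where "c = \<delta> ^ k / 2"
  have c0: "c > 0" using \<delta>0 by (simp add: c_def)
  \<comment> \<open>Orders of magnitude: \<open>e1\<close> is about \<open>n powr (- 1 / 4)\<close>,
    \<open>e2\<close> is \<open>1 / n\<close> and \<open>y\<close> is
    \<open>n powr (- 5 / 32)\<close>, both up to powers of \<open>ln n\<close>, and in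
    \<open>e4\<close> the term of order \<open>n * ln n\<close> beats
    \<open>(k + 1) * n\<close>.\<close>
  define e1 where "e1 n = 2 * (exp (3 / 4 * n * ln n * (1 / n + 2 / n\<^sup>2)) / n)" for n :: nat
  define e2 where "e2 n = 2 * (k * (n * ln n ^ d * exp (- (2 * ln n * (1 - 1 / ln n)))))" for n :: nat
  define y where "y n = exp 6 * k * ln n ^ (d + 1) * n powr (- 5 / 32)" for n :: nat
  define e4 where "e4 n = 2 * exp ((k + 1) * n - c * (3 / 4 * n * ln n - 1))" for n :: nat
  define P where "P n = measure_pmf.prob (edge_order k n)
            {es. let G = process_graph es (hitting_time k n (d + 1) es)
                 in tangentially_weakly_nondefective G (graph_variety k n G) d}" for n
  have lim1: "e1 \<longlonglongrightarrow> 0" unfolding e1_def by real_asymp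
  have "(\<lambda>n::nat. real n * ln n ^ d * exp (- (2 * ln n * (1 - 1 / ln n)))) \<longlonglongrightarrow> 0" by real_asymp
  from tendsto_mult_right_zero[OF tendsto_mult_right_zero[OF this, of "real k"], of 2]
  have lim2: "e2 \<longlonglongrightarrow> 0" unfolding e2_def by simp
  have "(\<lambda>n::nat. ln n ^ (d + 1) * n powr (- 5 / 32)) \<longlonglongrightarrow> 0" by real_asymp
  from tendsto_mult_right_zero[OF this, of "exp 6 * real k"]
  have limy: "y \<longlonglongrightarrow> 0" unfolding y_def by (simp add: mult.assoc)
  have "(\<lambda>n::nat. exp (K * n - c * (3 / 4 * n * ln n - 1))) \<longlonglongrightarrow> 0" for K :: real using c0 by real_asymp
  from tendsto_mult_right_zero[OF this[of "real k + 1"], of 2]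
  have lim4: "e4 \<longlonglongrightarrow> 0" unfolding e4_def by (simp add: algebra_simps)
  have ev_y: "\<forall>\<^sub>F n in sequentially. y n \<le> 1 / 2"
    using order_tendstoD(2)[OF limy, of "1 / 2"] by (auto elim: eventually_mono)
  have ev_L: "\<forall>\<^sub>F n::nat in sequentially. ln n \<ge> (1 :: real)" by real_asymp
  have ev_nL: "\<forall>\<^sub>F n::nat in sequentially. n * ln n \<ge> (1 :: real)" by real_asymp
  \<comment> \<open>For \<open>k \<ge> 3\<close> there are at least \<open>n ^ 3\<close> edges,
    enough for prefixes of length \<open>3 * n * ln n\<close> in
    \<open>prefix_probability\<close>.\<close>
  have ev_m: "\<forall>\<^sub>F n::nat in sequentially. 2 * (3 * n * ln n)\<^sup>2 \<le> real n ^ 3" by real_asymp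
  have ev_n: "\<forall>\<^sub>F n in sequentially. max (d + 2) (nat \<lceil>1 / (2 * k * \<delta>)\<rceil>) \<le> n" by (rule eventually_ge_at_top)
  have lower: "\<forall>\<^sub>F n in sequentially. 1 - (e1 n + e2 n + 2 * (2 * y n) + e4 n) \<le> P n"
    using ev_y ev_L ev_nL ev_m ev_n
  proof eventually_elim
    case (elim n)
    define L where "L = ln (real n)"
    \<comment> \<open>As \<open>3 / 4 < 1\<close>, about \<open>n powr (1 / 4)\<close> isolated
      vertices are expected in a class at time \<open>m1\<close>; as \<open>2 > 1\<close>, the
      degrees exceed \<open>d\<close> at time \<open>m2\<close> with high probability.\<close>
    define m1 where "m1 = nat \<lfloor>3 / 4 * n * L\<rfloor>"
    define m2 where "m2 = nat \<lceil>2 * n * L\<rceil>"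
    define a where "a = n * (1 - 1 / real n) ^ m1"
    have L: "L \<ge> 1" using elim(2) by (simp add: L_def)
    have nL: "n * L \<ge> 1" using elim(3) by (simp add: L_def)
    have nd: "d + 1 \<le> n" and n2: "n \<ge> 2" using elim(5) assms by auto
    have n1: "1 \<le> 2 * real k * \<delta> * n"
    proof -
      have "nat \<lceil>1 / (2 * k * \<delta>)\<rceil> \<le> n" using elim(5) by simp
      then have "1 / (2 * k * \<delta>) \<le> n" by linarith
      then show ?thesis using assms \<delta>0 by (simp add: divide_le_eq mult_ac)
    qed
    have rounding: "t - 1 \<le> nat \<lfloor>t\<rfloor>" "nat \<lfloor>t\<rfloor> \<le> t" "t \<le> nat \<lceil>t\<rceil>" "nat \<lceil>t\<rceil> \<le> t + 1" if "t \<ge> 0" for t :: real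
      using that by linarith+
    have nL0: "3 / 4 * n * L \<ge> 0" "2 * n * L \<ge> 0" using L by auto
    have m1: "3 / 4 * n * L - 1 \<le> m1" "m1 \<le> 3 / 4 * n * L"
      unfolding m1_def using rounding(1,2)[OF nL0(1)] by auto
    have m2: "2 * n * L \<le> m2" unfolding m2_def using rounding(3)[OF nL0(2)] .
    have "real m2 \<le> 2 * n * L + 1" unfolding m2_def using rounding(4)[OF nL0(2)] .
    also have "\<dots> \<le> 2 * n * L + n * L" using nL by (intro add_left_mono)
    also have "\<dots> = 3 * n * L" by simp
    finally have m2': "m2 \<le> 3 * n * L" .
    have "real m1 \<le> 3 / 4 * n * L" by (rule m1)
    also have "\<dots> \<le> 2 * n * L" using L by (intro mult_right_mono) auto
    also have "\<dots> \<le> m2" by (rule m2)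
    finally have m12: "m1 \<le> m2" by simp
    have mn: "2 * m2\<^sup>2 \<le> n ^ k"
    proof -
      have "(real m2)\<^sup>2 \<le> (3 * n * L)\<^sup>2" using m2' by (intro power_mono) auto
      then have "2 * (real m2)\<^sup>2 \<le> real n ^ 3" using elim(4) unfolding L_def by linarith
      also have "\<dots> \<le> real n ^ k" using assms n2 by (intro power_increasing) auto
      finally have "real (2 * m2\<^sup>2) \<le> real (n ^ k)" by simp
      then show ?thesis by (simp only: of_nat_le_iff)
    qed
    have main: "1 - (2 / a + 2 * (k * n * (L ^ d * exp (- ((1 - 1 / L) / n * m2)))) + 2 * (2 * y n) +
      2 * (2 ^ (k * n) * 2 ^ n * exp (- (\<delta> ^ k / 2) * m1))) \<le> P n"
      unfolding P_def
    proof (rule nondefective_probability[OF assms \<delta>0 \<delta>le nd n1 _ \<delta>2 L_def L m12 m1(1) m2' mn a_def])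
      show "y n = exp 6 * k * L ^ (d + 1) * n powr (- 5 / 32)" by (simp add: y_def L_def)
    qed (use \<delta>1 elim(1) in \<open>simp_all only: C_def\<close>)
    have b1: "2 / a \<le> e1 n"
    proof -
      let ?z = "1 / real n + 2 / (real n)\<^sup>2"
      have "- (1 / real n) - 2 * (1 / real n)\<^sup>2 \<le> ln (1 - 1 / real n)"
        using n2 by (intro ln_one_minus_pos_lower_bound) auto
      then have "exp (- ?z) \<le> exp (ln (1 - 1 / real n))" by (simp add: power_divide)
      then have "exp (- ?z) \<le> 1 - 1 / real n" using n2 by simp
      then have "exp (- ?z) ^ m1 \<le> (1 - 1 / real n) ^ m1" by (intro power_mono) auto
      moreover have "exp (- (3 / 4 * n * L * ?z)) \<le> exp (- ?z) ^ m1"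
      proof -
        have "m1 * ?z \<le> 3 / 4 * n * L * ?z" by (rule mult_right_mono[OF m1(2)]) simp
        then have "exp (- (3 / 4 * n * L * ?z)) \<le> exp (- (m1 * ?z))" by (simp only: exp_le_cancel_iff neg_le_iff_le)
        also have "\<dots> = exp (- ?z) ^ m1" by (simp only: exp_of_nat_mult[symmetric] mult_minus_right)
        finally show ?thesis .
      qed
      ultimately have "n * exp (- (3 / 4 * n * L * ?z)) \<le> a" unfolding a_def by (intro mult_left_mono) auto
      then have "1 / a \<le> 1 / (n * exp (- (3 / 4 * n * L * ?z)))" using n2 by (intro divide_left_mono) (auto simp: a_def)
      also have "\<dots> = exp (3 / 4 * n * L * ?z) / n" by (simp add: exp_minus field_simps)
      finally show ?thesis unfolding e1_def L_def by simp
    qed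
    have b2: "2 * (k * n * (L ^ d * exp (- ((1 - 1 / L) / n * m2)))) \<le> e2 n"
    proof -
      have "(1 - 1 / L) / n * (2 * n * L) \<le> (1 - 1 / L) / n * m2"
        using m2 L by (intro mult_left_mono) auto
      moreover have "(1 - 1 / L) / n * (2 * n * L) = 2 * L * (1 - 1 / L)" using n2 by simp
      ultimately have "exp (- ((1 - 1 / L) / n * m2)) \<le> exp (- (2 * L * (1 - 1 / L)))" by simp
      then have "k * n * (L ^ d * exp (- ((1 - 1 / L) / n * m2))) \<le> k * n * (L ^ d * exp (- (2 * L * (1 - 1 / L))))"
        using L by (intro mult_left_mono) auto
      then show ?thesis unfolding e2_def L_def[symmetric] by (simp add: mult_ac)
    qed
    have b4: "2 * (2 ^ (k * n) * 2 ^ n * exp (- (\<delta> ^ k / 2) * m1)) \<le> e4 n"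
    proof -
      have "2 ^ (k * n) * 2 ^ n = (2 :: real) ^ ((k + 1) * n)" by (simp add: power_add[symmetric] add.commute)
      also have "\<dots> \<le> exp 1 ^ ((k + 1) * n)"
        using exp_ge_add_one_self[of 1] by (intro power_mono) auto
      also have "\<dots> = exp ((k + 1) * n)" by (simp only: exp_of_nat_mult[symmetric] mult_1_right)
      finally have 1: "2 ^ (k * n) * 2 ^ n \<le> exp (real ((k + 1) * n))" .
      have "c * (3 / 4 * n * L - 1) \<le> c * m1" using m1(1) c0 by (intro mult_left_mono) auto
      then have 2: "exp (- (\<delta> ^ k / 2) * m1) \<le> exp (- (c * (3 / 4 * n * L - 1)))" by (simp add: c_def)
      have "2 ^ (k * n) * 2 ^ n * exp (- (\<delta> ^ k / 2) * m1) \<le> exp (real ((k + 1) * n)) * exp (- (c * (3 / 4 * n * L - 1)))"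
        using 1 2 by (intro mult_mono) auto
      also have "\<dots> = exp ((k + 1) * n - c * (3 / 4 * n * L - 1))" by (simp add: exp_add[symmetric])
      finally show ?thesis unfolding e4_def L_def by simp
    qed
    show ?case using main b1 b2 b4 by linarith
  qed
  have "(\<lambda>n. 1 - (e1 n + e2 n + 2 * (2 * y n) + e4 n)) \<longlonglongrightarrow> 1 - (0 + 0 + 2 * (2 * 0) + 0)"
    by (intro tendsto_intros lim1 lim2 limy lim4)
  then have lim: "(\<lambda>n. 1 - (e1 n + e2 n + 2 * (2 * y n) + e4 n)) \<longlonglongrightarrow> 1" by simp
  have "P \<longlonglongrightarrow> 1"
    by (rule tendsto_sandwich[OF lower _ lim tendsto_const]) (simp add: P_def)
  then show ?thesis unfolding P_def .
qed

end
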